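(* There exist absolute constants $1<C_1<14$ and $1<C_2<e^{10}$ such that: (i) for every fraction $p/q=[a_1,a_2,\dots,a_n]$ in lowest terms, $q\ge 1$, with $a_1$ odd and $a_k$ even for $2\le k\le n$, one has $|\sigma'(0)|<C_2q^{C_1}$ and $w_0\ge \frac{4}{|\sigma'(0)|}>4C_2^{-1}q^{-C_1}$, where $\sigma$ is the discriminant and $w_0$ is half the width of the centermost band of $S(p/q)$; (ii) with the same constants $C_1,C_2$, for every $p/q=[a_1,a_2,\dots,a_n]$ in lowest terms with $q\ge3$, $a_1$ odd, and $a_k$ even for $2\le k\le n$, the widths $\Delta_j$ of the gaps of $S(p/q)$ satisfy $$\Delta_0>\left(\frac{1}{C_2q^{C_1}}\right)^2,\qquad \Delta_j>\left(\frac{1}{2C_2q^{C_1}}\right)^{2j},\quad 1\le j<\frac{q-1}{2}.$$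
   Context: Continued fractions: for positive integers $a_j$, $[a_1,a_2,\dots,a_n]=\cfrac{1}{a_1+\cfrac{1}{a_2+\cdots+\cfrac1{a_n}}}$. The parity conditions on the $a_k$ in the claim imply that $q$ is odd. For $\alpha,\theta\in(0,1]$ let $H_{\alpha,\theta}$ be the self-adjoint operator on $l^2(\mathbb{Z})$ given by $(H_{\alpha,\theta}\phi)(n)=\phi(n-1)+\phi(n+1)+2\cos(2\pi(\alpha n+\theta))\,\phi(n)$. Let $S(\alpha)$ be the union over all $\theta\in(0,1]$ of the spectra of $H_{\alpha,\theta}$. For $\alpha=p/q$ with $(p,q)=1$, the discriminant is the polynomial of degree $q$ $$\sigma(E)=-\operatorname{tr}\left\{\begin{pmatrix}E-2\cos(2\pi p/q+\frac{\pi}{2q})&-1\\1&0\end{pmatrix}\begin{pmatrix}E-2\cos(2\pi\cdot 2p/q+\frac{\pi}{2q})&-1\\1&0\end{pmatrix}\cdots\begin{pmatrix}E-2\cos(2\pi qp/q+\frac{\pi}{2q})&-1\\1&0\end{pmatrix}\right\},$$ and $S(p/q)=\sigma^{-1}([-4,4])$. One has $\sigma(E)=(-1)^q\sigma(-E)$, so $S(p/q)$ is symmetric about $0$. For $q$ odd, $S(p/q)$ consists of $q$ disjoint closed intervals (bands) separated by $q-1$ nonempty open intervals (gaps), and each band contains exactly one zero of $\sigma$. Number the bands $B_j$ from left to right, $j=-(q-1)/2,\dots,(q-1)/2$; the centermost band $B_0$ contains $0$, is symmetric about $0$, and $B_0=[-w_0,w_0]$. The gap $G_j$, $-(q-1)/2\le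 j<(q-1)/2$, is the open interval between $B_j$ and $B_{j+1}$, and $\Delta_j$ is its length. *)

theory Defs
  imports "HOL-Analysis.Analysis"
begin

(* cfrac [a1, ..., an] = 1/(a1 + 1/(a2 + ... + 1/an)); the value at the empty list
   only terminates the recursion. *)
primrec cfrac :: "nat list \<Rightarrow> real" where
  "cfrac [] = 0"
| "cfrac (a # as) = 1 / (real a + cfrac as)"

definition l2_space :: "(int \<Rightarrow> complex) set" where
  "l2_space = {\<phi>. (\<lambda>n. (cmod (\<phi> n))\<^sup>2) summable_on UNIV}"

definition l2_norm :: "(int \<Rightarrow> complex) \<Rightarrow> real" where
  "l2_norm \<phi> = sqrt (\<Sum>\<^sub>\<infinity>n. (cmod (\<phi> n))\<^sup>2)"

definition amo :: "real \<Rightarrow> real \<Rightarrow> (int \<Rightarrow> complex) \<Rightarrow> (int \<Rightarrow> complex)" where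
  "amo \<alpha> \<theta> \<phi> =
     (\<lambda>n. \<phi> (n - 1) + \<phi> (n + 1)
          + complex_of_real (2 * cos (2 * pi * (\<alpha> * of_int n + \<theta>))) * \<phi> n)"

(* For a bounded linear operator T on l2_space. The estimate says that the inverse
   of T - z is bounded. *)
definition l2_resolvent_set :: "((int \<Rightarrow> complex) \<Rightarrow> (int \<Rightarrow> complex)) \<Rightarrow> complex set" where
  "l2_resolvent_set T =
     {z. bij_betw (\<lambda>\<phi> n. T \<phi> n - z * \<phi> n) l2_space l2_space \<and>
         (\<exists>C. \<forall>\<phi>\<in>l2_space. l2_norm \<phi> \<le> C * l2_norm (\<lambda>n. T \<phi> n - z * \<phi> n))}"

definition l2_spectrum :: "((int \<Rightarrow> complex) \<Rightarrow> (int \<Rightarrow> complex)) \<Rightarrow> complex set" where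
  "l2_spectrum T = - l2_resolvent_set T"

(* A subset of the real line: the operators are self-adjoint, so their spectra are real. *)
definition spec_union :: "real \<Rightarrow> real set" where
  "spec_union \<alpha> = {E. \<exists>\<theta>\<in>{0<..1}. complex_of_real E \<in> l2_spectrum (amo \<alpha> \<theta>)}"

definition transfer_matrix :: "nat \<Rightarrow> nat \<Rightarrow> real \<Rightarrow> nat \<Rightarrow> real^2^2" where
  "transfer_matrix p q E k =
     vector [vector [E - 2 * cos (2 * pi * real k * real p / real q + pi / (2 * real q)), -1],
             vector [1, 0]]"

definition discriminant :: "nat \<Rightarrow> nat \<Rightarrow> real \<Rightarrow> real" where
  "discriminant p q E =
     - trace (foldr (**) (map (transfer_matrix p q E) [1..<Suc q]) (mat 1))"

(* The bands are the connected components of spec_union (p/q). For p, q coprime and q odd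
   they are q disjoint compact intervals, and the one with exactly j + (q-1)/2 bands to its
   left has index j, for -(q-1)/2 \<le> j \<le> (q-1)/2. *)
definition band :: "nat \<Rightarrow> nat \<Rightarrow> int \<Rightarrow> real set" where
  "band p q j =
     (let \<B> = components (spec_union (real p / real q))
      in THE B. B \<in> \<B> \<and> int (card {B' \<in> \<B>. Sup B' < Inf B}) = j + (int q - 1) div 2)"

(* The centermost band is symmetric about 0, so this is the w with band p q 0 = {-w..w}. *)
definition center_half_width :: "nat \<Rightarrow> nat \<Rightarrow> real" where
  "center_half_width p q = (Sup (band p q 0) - Inf (band p q 0)) / 2"

definition gap_width :: "nat \<Rightarrow> nat \<Rightarrow> int \<Rightarrow> real" where
  "gap_width p q j = Inf (band p q (j + 1)) - Sup (band p q j)"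

definition odd_even_cfrac :: "nat \<Rightarrow> nat \<Rightarrow> nat list \<Rightarrow> bool" where
  "odd_even_cfrac p q as \<longleftrightarrow>
     q \<ge> 1 \<and> coprime p q \<and> real p / real q = cfrac as \<and>
     as \<noteq> [] \<and> (\<forall>a\<in>set as. a > 0) \<and> odd (hd as) \<and> (\<forall>a\<in>set (tl as). even a)"

end

theory Submission
  imports Defs "HOL-Computational_Algebra.Computational_Algebra" "HOL-Real_Asymp.Real_Asymp"
begin

text \<open>
  The spectrum is \<open>{E. \<bar>\<sigma> E\<bar> \<le> 4}\<close>, and each of its points \<open>E\<close> is an eigenvalue of the operator \<open>H\<close> acting
  on a space of \<open>q\<close>-quasiperiodic functions of dimension \<open>q = 2m + 1\<close>. If \<open>\<ell>\<close> is the quotient of the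
  characteristic polynomial by \<open>X - E\<close>, then \<open>A = \<ell>(H)\<close> is self-adjoint with \<open>A\<^sup>2 = \<plusminus>\<sigma>'(E) A\<close>, so no matrix
  entry of \<open>A\<close> exceeds \<open>\<bar>\<sigma>'(E)\<bar>\<close>. On the other hand the trace of \<open>A\<close> against the right word in the two
  generating unitaries only sees the leading term of \<open>\<ell>\<close>, and equals \<open>q\<close> times a Gaussian binomial
  coefficient of modulus 1. Hence \<open>\<bar>\<sigma>'\<bar> \<ge> 1\<close> on the whole spectrum. Since \<open>\<sigma> = \<plusminus>4\<close> has \<open>q\<close> real solutions
  with product of modulus 4, this bounds the gaps from below in terms of \<open>w\<^sub>0 \<ge> 4 / \<bar>\<sigma>'(0)\<bar>\<close>.

  A Fourier transform turns the operator at \<open>\<sigma> = 0\<close> into a Jacobi matrix with vanishing diagonal, whence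
  \<open>\<bar>\<sigma>'(0)\<bar> = q \<Sum>k\<le>m. \<Prod>j\<le>k. sin\<^sup>2(\<pi>(2j-1)p/q) / sin\<^sup>2(2\<pi>jp/q)\<close>. The logarithms of these products are
  alternating sums of \<open>ln \<bar>sin(\<pi>n\<alpha>)\<bar>\<close>, \<open>\<alpha> = p/q\<close>. They are renormalised along the continued fraction by means
  of a monotone function \<open>L\<close> with \<open>L(x) + L(x+\<alpha>) = ln tan(\<pi>x/2)\<close> and \<open>L(x) + L(x+1) = ln tan(\<pi>x/(2\<alpha>))\<close>: the
  alternating sum telescopes, up to the same kind of sum for the Gauss map of \<open>\<alpha>\<close> and two boundary values
  of size \<open>ln(1/\<alpha>)\<close>, and the successive \<open>\<alpha>\<close> multiply to \<open>1/q\<close>.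
\<close>
section \<open>Transfer matrices and the Chambers relation\<close>

text \<open>The parity conditions are what makes the renormalisation close up. If the multiples of
  \<alpha> cross their K-th integer between n and n + 1, then n is the integer part of K/\<alpha>,
  that is, n = K a + floor(K \<alpha>') with a the first partial quotient and \<alpha>' the Gauss
  map of \<alpha>. For a odd, the sign (-1)^n has the parity of K + floor(K \<alpha>'); with ln tan
  in place of ln sin, signs of this second kind reproduce themselves under every even a. Each even
  step has \<alpha> \<le> 1/2 and costs at most 4 ln(1/\<alpha>), so nothing depends on the number
  of steps. The ratios of squared sines are then at most \<open>exp 6 * real q ^ 8\<close>; a factor
  q from a product of sines and at most q summands lead to the exponent 10. At a gap edge, \<sigma>'
  is the product of the distances to the other roots of the same level, one of which is the gap. The
  remaining distances must be bounded from above. Measured against the roots themselves, those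
  outside the gap can be paired to stay bounded; only the 2j roots further inside cost a factor of
  order 1/w_0 each, whence the exponent 2j.\<close>

fun transfer :: "'a::comm_ring_1 list \<Rightarrow> 'a \<times> 'a \<times> 'a \<times> 'a" where
  "transfer [] = (1, 0, 0, 1)"
| "transfer (e # es) = (case transfer es of (a, b, c, d) \<Rightarrow> (e * a - c, e * b - d, a, b))"

definition transfer_trace :: "'a::comm_ring_1 list \<Rightarrow> 'a" where
  "transfer_trace es = (case transfer es of (a, b, c, d) \<Rightarrow> a + d)"

lemma transfer_det: "transfer es = (a, b, c, d) \<Longrightarrow> a * d - b * c = 1"
proof (induction es arbitrary: a b c d)
  case (Cons e es)
  obtain a' b' c' d' where t: "transfer es = (a', b', c', d')" by (cases "transfer es") auto
  have eqs: "a = e * a' - c'" "b = e * b' - d'" "c = a'" "d = b'"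
    using Cons.prems t by auto
  show ?case
    unfolding eqs using Cons.IH[OF t] by (simp add: algebra_simps)
qed auto

lemma transfer_append:
  "transfer xs = (a, b, c, d) \<Longrightarrow> transfer ys = (a', b', c', d') \<Longrightarrow>
   transfer (xs @ ys) = (a * a' + b * c', a * b' + b * d', c * a' + d * c', c * b' + d * d')"
proof (induction xs arbitrary: a b c d)
  case (Cons e es)
  obtain a1 b1 c1 d1 where t: "transfer es = (a1, b1, c1, d1)" by (cases "transfer es") auto
  have eqs: "a = e * a1 - c1" "b = e * b1 - d1" "c = a1" "d = b1"
    using Cons.prems t by auto
  show ?case
    unfolding eqs using Cons.IH[OF t Cons.prems(2)] by (simp add: algebra_simps)
qed auto

lemma transfer_trace_rotate: "transfer_trace (xs @ ys) = transfer_trace (ys @ xs)"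
proof -
  obtain a b c d where x: "transfer xs = (a, b, c, d)" by (cases "transfer xs") auto
  obtain a' b' c' d' where y: "transfer ys = (a', b', c', d')" by (cases "transfer ys") auto
  show ?thesis
    using transfer_append[OF x y] transfer_append[OF y x] by (simp add: transfer_trace_def algebra_simps)
qed

text \<open>Each factor \<open>M\<close> equals its transpose conjugated by
  \<open>diag(1, -1)\<close>, so reversing a product transposes it and changes the signs off the
  diagonal.\<close>

lemma transfer_rev: "transfer es = (a, b, c, d) \<Longrightarrow> transfer (rev es) = (a, - c, - b, d)"
proof (induction es arbitrary: a b c d)
  case (Cons e es)
  obtain a' b' c' d' where t: "transfer es = (a', b', c', d')" by (cases "transfer es") auto
  have e: "transfer [e] = (e, -1, 1, 0)" by simp
  from transfer_append[OF Cons.IH[OF t] e] show ?case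
    using Cons.prems t by (auto simp: algebra_simps)
qed auto

lemma transfer_trace_rev: "transfer_trace (rev es) = transfer_trace es"
  using transfer_rev[of es] by (cases "transfer es") (auto simp: transfer_trace_def)

text \<open>Only ring operations occur in \<open>transfer\<close>, so it commutes with evaluation
  and, below, with the embedding of the reals; this is why it is set up over any commutative
  ring.\<close>

lemma transfer_poly:
  "transfer es = (a, b, c, d) \<Longrightarrow>
   transfer (map (\<lambda>e. poly e x) es) = (poly a x, poly b x, poly c x, poly d x)"
  by (induction es arbitrary: a b c d) (auto split: prod.splits)

lemma poly_transfer_trace: "poly (transfer_trace es) x = transfer_trace (map (\<lambda>e. poly e x) es)"
  using transfer_poly[of es _ _ _ _ x] by (cases "transfer es") (auto simp: transfer_trace_def)

lemma transfer_of_real: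
  "transfer es = (a, b, c, d) \<Longrightarrow>
   transfer (map complex_of_real es) = (of_real a, of_real b, of_real c, of_real d)"
  by (induction es arbitrary: a b c d) (auto split: prod.splits)

lemma transfer_trace_of_real: "transfer_trace (map complex_of_real es) = of_real (transfer_trace es)"
  using transfer_of_real[of es] by (cases "transfer es") (auto simp: transfer_trace_def)

lemma transfer_matrix:
  fixes es :: "real list"
  assumes "transfer es = (a, b, c, d)"
  shows "foldr (**) (map (\<lambda>e. vector [vector [e, -1], vector [1, 0]]) es) (mat 1)
          = (vector [vector [a, b], vector [c, d]] :: real^2^2)"
  using assms
proof (induction es arbitrary: a b c d)
  case Nil
  then have "a = 1" "b = 0" "c = 0" "d = 1" by auto
  then show ?case
    by (simp add: vec_eq_iff forall_2 mat_def)
next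
  case (Cons e es)
  obtain a' b' c' d' where t: "transfer es = (a', b', c', d')" by (cases "transfer es") auto
  have eqs: "a = e * a' - c'" "b = e * b' - d'" "c = a'" "d = b'"
    using Cons.prems t by auto
  have "foldr (**) (map (\<lambda>e. vector [vector [e, -1], vector [1, 0]]) (e # es)) (mat 1)
      = (vector [vector [e, -1], vector [1, 0]] :: real^2^2) ** vector [vector [a', b'], vector [c', d']]"
    by (simp only: list.map foldr.simps o_apply Cons.IH[OF t])
  also have "\<dots> = vector [vector [a, b], vector [c, d]]"
    unfolding eqs by (simp add: vec_eq_iff forall_2 matrix_matrix_mult_def sum_2)
  finally show ?case .
qed

lemma discriminant_eq_transfer_trace:
  "discriminant p q E = - transfer_trace (map (\<lambda>k. E - 2 * cos (2 * pi * real k * real p / real q + pi / (2 * real q))) [1..<Suc q])"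
proof -
  let ?es = "map (\<lambda>k. E - 2 * cos (2 * pi * real k * real p / real q + pi / (2 * real q))) [1..<Suc q]"
  obtain a b c d where t: "transfer ?es = (a, b, c, d)" by (cases "transfer ?es") auto
  have "map (transfer_matrix p q E) [1..<Suc q] = map (\<lambda>e. vector [vector [e, -1], vector [1, 0]]) ?es"
    by (simp add: transfer_matrix_def)
  then have "discriminant p q E = - trace (vector [vector [a, b], vector [c, d]] :: real^2^2)"
    using transfer_matrix[OF t] unfolding discriminant_def by metis
  then show ?thesis using t by (simp add: transfer_trace_def trace_def sum_2)
qed

text \<open>Every factor raises the degree of \<open>a\<close> by one while the other entries lag
  behind. The proviso \<open>i > 0\<close> accommodates the empty list, where
  \<open>d = 1\<close>.\<close>

lemma transfer_linear_coeffs: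
  fixes vs :: "'a::comm_ring_1 list"
  assumes "transfer (map (\<lambda>v. [:-v, 1:]) vs) = (a, b, c, d)"
  shows "coeff a (length vs) = 1 \<and> (\<forall>i>length vs. coeff a i = 0) \<and>
         (\<forall>i\<ge>length vs. coeff b i = 0) \<and> (\<forall>i\<ge>length vs. coeff c i = 0) \<and>
         (\<forall>i\<ge>length vs. i > 0 \<longrightarrow> coeff d i = 0)"
  using assms
proof (induction vs arbitrary: a b c d)
  case (Cons v vs)
  obtain a' b' c' d' where t: "transfer (map (\<lambda>v. [:-v, 1:]) vs) = (a', b', c', d')"
    by (cases "transfer (map (\<lambda>v. [:-v, 1:]) vs)") auto
  note IH = Cons.IH[OF t]
  have eqs: "a = [:-v, 1:] * a' - c'" "b = [:-v, 1:] * b' - d'" "c = a'" "d = b'"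
    using Cons.prems t by auto
  show ?case
    unfolding eqs using IH
    by (auto simp: mult_pCons_left coeff_pCons split: nat.splits)
qed auto

lemma transfer_trace_linear_monic:
  fixes vs :: "'a::comm_ring_1 list"
  assumes "vs \<noteq> []"
  shows "degree (transfer_trace (map (\<lambda>v. [:-v, 1:]) vs)) = length vs"
    and "coeff (transfer_trace (map (\<lambda>v. [:-v, 1:]) vs)) (length vs) = 1"
proof -
  obtain a b c d where t: "transfer (map (\<lambda>v. [:-v, 1:]) vs) = (a, b, c, d)"
    by (cases "transfer (map (\<lambda>v. [:-v, 1:]) vs)") auto
  have l: "length vs > 0" using assms by simp
  note h = transfer_linear_coeffs[OF t]
  have e: "transfer_trace (map (\<lambda>v. [:-v, 1:]) vs) = a + d" by (simp add: transfer_trace_def t)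
  show c1: "coeff (transfer_trace (map (\<lambda>v. [:-v, 1:]) vs)) (length vs) = 1"
    unfolding e using h l by simp
  show "degree (transfer_trace (map (\<lambda>v. [:-v, 1:]) vs)) = length vs"
  proof (rule antisym)
    show "degree (transfer_trace (map (\<lambda>v. [:-v, 1:]) vs)) \<le> length vs"
      unfolding e using h l by (intro degree_le) auto
    show "length vs \<le> degree (transfer_trace (map (\<lambda>v. [:-v, 1:]) vs))"
      using c1 by (intro le_degree) simp
  qed
qed

text \<open>Multiplying every entry by an indeterminate \<open>y\<close> clears the denominators in \<open>E - (c y + 1/(c y))\<close>.\<close>

fun scaled_transfer :: "'a::comm_ring_1 poly list \<Rightarrow> 'a poly \<times> 'a poly \<times> 'a poly \<times> 'a poly" where
  "scaled_transfer [] = (1, 0, 0, 1)"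
| "scaled_transfer (e # es) = (case scaled_transfer es of (a, b, c, d) \<Rightarrow>
     (e * a - pCons 0 c, e * b - pCons 0 d, pCons 0 a, pCons 0 b))"

lemma scaled_transfer_poly:
  fixes y :: "'a::field"
  assumes "y \<noteq> 0" "scaled_transfer es = (a, b, c, d)" "transfer (map (\<lambda>e. poly e y / y) es) = (a', b', c', d')"
  shows "poly a y = y ^ length es * a' \<and> poly b y = y ^ length es * b' \<and>
         poly c y = y ^ length es * c' \<and> poly d y = y ^ length es * d'"
  using assms(2,3)
proof (induction es arbitrary: a b c d a' b' c' d')
  case (Cons e es)
  obtain a1 b1 c1 d1 where t: "scaled_transfer es = (a1, b1, c1, d1)" by (cases "scaled_transfer es") auto
  obtain a2 b2 c2 d2 where s: "transfer (map (\<lambda>e. poly e y / y) es) = (a2, b2, c2, d2)"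
    by (cases "transfer (map (\<lambda>e. poly e y / y) es)") auto
  have eqs: "a = e * a1 - pCons 0 c1" "b = e * b1 - pCons 0 d1" "c = pCons 0 a1" "d = pCons 0 b1"
    "a' = poly e y / y * a2 - c2" "b' = poly e y / y * b2 - d2" "c' = a2" "d' = b2"
    using Cons.prems t s by auto
  show ?case
    unfolding eqs using Cons.IH[OF t s] assms(1) by (simp add: field_simps)
qed auto

lemma scaled_transfer_degree:
  assumes "\<forall>e\<in>set es. degree e \<le> 2" "scaled_transfer es = (a, b, c, d)"
  shows "degree a \<le> 2 * length es \<and> degree b \<le> 2 * length es \<and>
         degree c \<le> 2 * length es \<and> degree d \<le> 2 * length es"
  using assms
proof (induction es arbitrary: a b c d)
  case (Cons e es)
  obtain a1 b1 c1 d1 where t: "scaled_transfer es = (a1, b1, c1, d1)" by (cases "scaled_transfer es") auto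
  have IH: "degree a1 \<le> 2 * length es" "degree b1 \<le> 2 * length es"
      "degree c1 \<le> 2 * length es" "degree d1 \<le> 2 * length es"
    using Cons.IH[OF _ t] Cons.prems by auto
  have e: "degree e \<le> 2" using Cons.prems by simp
  have m: "degree (e * f) \<le> 2 * length (e # es)" if "degree f \<le> 2 * length es" for f
    using degree_mult_le[of e f] e that by simp
  have P: "degree (pCons 0 f) \<le> 2 * length (e # es)" if "degree f \<le> 2 * length es" for f :: "'a poly"
    using degree_pCons_le[of 0 f] that by simp
  have eqs: "a = e * a1 - pCons 0 c1" "b = e * b1 - pCons 0 d1" "c = pCons 0 a1" "d = pCons 0 b1"
    using Cons.prems t by auto
  show ?case
    unfolding eqs by (intro conjI degree_diff_le m P IH)
qed auto

lemma scaled_transfer_at_0: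
  assumes "scaled_transfer es = (a, b, c, d)" "es \<noteq> []"
  shows "poly a 0 = (\<Prod>e\<leftarrow>es. poly e 0) \<and> poly b 0 = 0 \<and> poly c 0 = 0 \<and> poly d 0 = 0"
  using assms
proof (induction es arbitrary: a b c d)
  case (Cons e es)
  obtain a1 b1 c1 d1 where t: "scaled_transfer es = (a1, b1, c1, d1)" by (cases "scaled_transfer es") auto
  show ?case
  proof (cases "es = []")
    case False
    with Cons.IH[OF t] Cons.prems t show ?thesis by auto
  qed (use Cons.prems in auto)
qed auto

text \<open>Moving a window of one period by one step rotates the factors cyclically, which the
  trace does not see.\<close>

lemma map_shift_rotate:
  assumes "g (n + q) = g n"
  shows "transfer_trace (map g [Suc n..<Suc (n + q)]) = transfer_trace (map g [n..<n + q])"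
proof (cases q)
  case (Suc r)
  have "Suc n \<le> n + q" using Suc by simp
  then have "map g [Suc n..<Suc (n + q)] = map g [Suc n..<n + q] @ [g n]"
    by (simp only: upt_Suc_append map_append list.map assms)
  moreover have "map g [n..<n + q] = [g n] @ map g [Suc n..<n + q]"
    using \<open>Suc n \<le> n + q\<close> by (simp only: upt_conv_Cons Suc_le_eq list.map append.simps)
  ultimately show ?thesis by (metis transfer_trace_rotate)
qed simp

text \<open>As a function of \<open>y\<close> the trace is a Laurent polynomial with exponents
  between -q and q. Invariance under multiplication of \<open>y\<close> by \<open>w\<close> leaves
  only the exponents -q, 0 and q; the lowest coefficient is computed, and the symmetry under
  inversion of \<open>y\<close> carries it over to the highest.\<close>

lemma chambers:
  fixes w E :: complex
  assumes q: "odd q" and unit_root: "w ^ q = 1" and prim: "\<And>i. 0 < i \<Longrightarrow> i < q \<Longrightarrow> w ^ i \<noteq> 1"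
  shows "\<exists>B. \<forall>y. y \<noteq> 0 \<longrightarrow>
    transfer_trace (map (\<lambda>k. E - (w ^ k * y + inverse (w ^ k * y))) [1..<Suc q]) = B - (y ^ q + inverse (y ^ q))"
proof -
  define f where "f y = transfer_trace (map (\<lambda>k. E - (w ^ k * y + inverse (w ^ k * y))) [1..<Suc q])" for y
  have q0: "q > 0" using q by (cases q) auto
  have w0: "w \<noteq> 0" using unit_root q0 by (metis power_0_left zero_neq_one less_not_refl)
  define es where "es = map (\<lambda>k. [: - inverse (w ^ k), E, - (w ^ k) :]) [1..<Suc q]"
  obtain a b c d where t: "scaled_transfer es = (a, b, c, d)" by (cases "scaled_transfer es") auto
  define Q where "Q = a + d"
  have len: "length es = q" by (simp add: es_def del: upt_Suc)
  have Qf: "poly Q y = y ^ q * f y" if y: "y \<noteq> 0" for y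
  proof -
    have m: "map (\<lambda>e. poly e y / y) es = map (\<lambda>k. E - (w ^ k * y + inverse (w ^ k * y))) [1..<Suc q]"
      using y w0 by (simp add: es_def field_simps power2_eq_square del: upt_Suc)
    obtain a' b' c' d' where s: "transfer (map (\<lambda>e. poly e y / y) es) = (a', b', c', d')"
      by (cases "transfer (map (\<lambda>e. poly e y / y) es)") auto
    have "f y = a' + d'" using s unfolding f_def transfer_trace_def m by simp
    then show ?thesis using scaled_transfer_poly[OF y t s] by (simp add: Q_def len algebra_simps)
  qed
  \<comment> \<open>Multiplying \<open>y\<close> by \<open>w\<close> moves the window of factors by
    one step.\<close>
  have fw: "f (w * y) = f y" for y
  proof -
    define g where "g = (\<lambda>k. E - (w ^ k * y + inverse (w ^ k * y)))"
    have "f (w * y) = transfer_trace (map (\<lambda>k. g (Suc k)) [1..<Suc q])"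
      by (simp add: f_def g_def mult_ac del: upt_Suc)
    also have "map (\<lambda>k. g (Suc k)) [1..<Suc q] = map g [Suc 1..<Suc (1 + q)]"
      by (metis (no_types, lifting) ext list.map_comp map_Suc_upt o_apply plus_1_eq_Suc)
    also have "transfer_trace \<dots> = transfer_trace (map g [1..<1 + q])"
      by (rule map_shift_rotate) (simp add: g_def power_add unit_root)
    also have "\<dots> = f y" by (simp add: f_def g_def del: upt_Suc)
    finally show ?thesis .
  qed
  \<comment> \<open>Inverting \<open>y\<close> reverses the order of the factors, because
    \<open>w ^ k\<close> and \<open>w ^ (q - k)\<close> are inverse to each other.\<close>
  have finv: "f (inverse y) = f y" if "y \<noteq> 0" for y
  proof -
    define g where "g = (\<lambda>k. E - (w ^ k * y + inverse (w ^ k * y)))"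
    have "map (\<lambda>k. E - (w ^ k * inverse y + inverse (w ^ k * inverse y))) [1..<Suc q]
       = rev (map g [0..<q])"
    proof (rule nth_equalityI)
      fix i assume "i < length (map (\<lambda>k. E - (w ^ k * inverse y + inverse (w ^ k * inverse y))) [1..<Suc q])"
      then have i: "i < q" by (simp del: upt_Suc)
      have "w ^ Suc i * w ^ (q - Suc i) = w ^ (Suc i + (q - Suc i))"
        by (simp only: power_add)
      also have "\<dots> = 1" using i unit_root by simp
      finally have "w ^ Suc i * w ^ (q - Suc i) = 1" .
      then have inv: "inverse (w ^ Suc i) = w ^ (q - Suc i)"
        by (rule inverse_unique)
      have inv': "inverse (w ^ (q - Suc i)) = w ^ Suc i" using inv by (metis inverse_inverse_eq)
      show "map (\<lambda>k. E - (w ^ k * inverse y + inverse (w ^ k * inverse y))) [1..<Suc q] ! i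
          = rev (map g [0..<q]) ! i"
        using i unfolding g_def
        by (simp add: rev_nth inverse_mult_distrib inv inv' del: upt_Suc power_Suc)
    qed simp
    then have "f (inverse y) = transfer_trace (map g [0..<q])"
      by (simp add: f_def transfer_trace_rev del: upt_Suc)
    also have "\<dots> = transfer_trace (map g [Suc 0..<Suc (0 + q)])"
      using map_shift_rotate[of g 0 q] by (simp add: g_def unit_root)
    also have "\<dots> = f y" by (simp add: f_def g_def del: upt_Suc)
    finally show ?thesis .
  qed
  have comp: "pcompose Q [:0, w:] = Q"
  proof (subst poly_eq_poly_eq_iff [symmetric], rule ext)
    fix y
    show "poly (pcompose Q [:0, w:]) y = poly Q y"
    proof (cases "y = 0")
      case False
      have "poly (pcompose Q [:0, w:]) y = poly Q (w * y)" by (simp add: poly_pcompose mult.commute)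
      also have "\<dots> = poly Q y"
        using Qf[of "w * y"] Qf[of y] False w0 fw[of y] unit_root by (simp add: power_mult_distrib)
      finally show ?thesis .
    qed (simp add: poly_pcompose)
  qed
  have c0: "coeff Q i = 0" if "\<not> q dvd i" for i
  proof -
    have "coeff Q i = w ^ i * coeff Q i"
      using arg_cong[OF comp, of "\<lambda>r. coeff r i"] by (simp add: coeff_pcompose_linear)
    moreover have "w ^ i \<noteq> 1"
    proof -
      have "w ^ i = w ^ (q * (i div q) + i mod q)" by simp
      also have "\<dots> = w ^ (i mod q)" unfolding power_add power_mult unit_root by simp
      finally show ?thesis using prim[of "i mod q"] that q0 by (auto simp: dvd_eq_mod_eq_0)
    qed
    ultimately show ?thesis by (metis mult_cancel_right1)
  qed
  have deg: "degree Q \<le> 2 * q"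
    using scaled_transfer_degree[OF _ t] unfolding Q_def len
    by (intro degree_add_le) (auto simp: es_def intro!: order.trans[OF degree_pCons_le])
  have Qy: "poly Q y = coeff Q 0 + coeff Q q * y ^ q + coeff Q (2 * q) * y ^ (2 * q)" for y
  proof -
    have "poly Q y = (\<Sum>i\<le>2*q. coeff Q i * y ^ i)"
      unfolding poly_altdef
      by (rule sum.mono_neutral_left) (use deg in \<open>auto simp: coeff_eq_0\<close>)
    also have "\<dots> = (\<Sum>i\<in>{0, q, 2*q}. coeff Q i * y ^ i)"
    proof (rule sum.mono_neutral_right)
      show "\<forall>i\<in>{..2 * q} - {0, q, 2 * q}. coeff Q i * y ^ i = 0"
      proof
        fix i assume i: "i \<in> {..2 * q} - {0, q, 2 * q}"
        have "\<not> q dvd i"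
        proof
          assume "q dvd i"
          then obtain k where k: "i = q * k" by auto
          with i q0 have "k \<le> 2" "k \<noteq> 0" "k \<noteq> 1" "k \<noteq> 2" by auto
          then show False by auto
        qed
        then show "coeff Q i * y ^ i = 0" using c0 by simp
      qed
    qed auto
    also have "\<dots> = coeff Q 0 + coeff Q q * y ^ q + coeff Q (2 * q) * y ^ (2 * q)"
      using q0 by simp
    finally show ?thesis .
  qed
  \<comment> \<open>Only the product of the lowest terms \<open>- inverse (w ^ k)\<close> reaches
    this coefficient. The exponents add up to q (q + 1) / 2, a multiple of q since q is odd, so the
    powers of \<open>w\<close> disappear and the sign (-1)^q remains.\<close>
  have A: "coeff Q 0 = -1"
  proof -
    have "es \<noteq> []" using len q0 by auto
    then have "coeff Q 0 = (\<Prod>e\<leftarrow>es. poly e 0)"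
      using scaled_transfer_at_0[OF t] by (simp add: Q_def poly_0_coeff_0)
    also have "\<dots> = (\<Prod>k\<in>{1..<Suc q}. - inverse (w ^ k))"
      using prod.distinct_set_conv_list[of "[1..<Suc q]" "\<lambda>k. - inverse (w ^ k)"]
      by (simp add: es_def o_def del: upt_Suc prod.op_ivl_Suc)
    also have "\<dots> = (-1) ^ q * inverse (w ^ (\<Sum>k\<in>{1..<Suc q}. k))"
    proof -
      have "(\<Prod>k\<in>A. - inverse (w ^ k)) = (-1) ^ card A * inverse (w ^ (\<Sum>k\<in>A. k))"
        if "finite A" for A
        using that by (induction A) (simp_all add: power_add)
      then show ?thesis by (metis card_atLeastLessThan diff_Suc_1 finite_atLeastLessThan)
    qed
    also have "(\<Sum>k\<in>{1..<Suc q}. k) = q * ((q + 1) div 2)"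
    proof -
      have "(\<Sum>k\<in>{1..<Suc q}. k) = (\<Sum>k\<in>{0..q}. k)"
        by (rule sum.mono_neutral_left) auto
      also have "\<dots> = q * (q + 1) div 2" using gauss_sum_nat by simp
      also have "\<dots> = q * ((q + 1) div 2)"
      proof -
        have "2 * ((q + 1) div 2) = q + 1" using q by presburger
        then have "q * (q + 1) = 2 * (q * ((q + 1) div 2))" by (metis mult.left_commute)
        then show ?thesis by linarith
      qed
      finally show ?thesis .
    qed
    also have "(-1) ^ q * inverse (w ^ (q * ((q + 1) div 2))) = -1"
      unfolding power_mult unit_root using q by simp
    finally show ?thesis .
  qed
  have fy: "f y = coeff Q q - inverse (y ^ q) + coeff Q (2 * q) * y ^ q" if "y \<noteq> 0" for y
  proof -
    have "y ^ q * f y = y ^ q * (coeff Q q - inverse (y ^ q) + coeff Q (2 * q) * y ^ q)"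
    proof -
      have "y ^ (q * 2) = y ^ q * y ^ q" by (metis power2_eq_square power_mult)
      then show ?thesis using Qf[OF that] Qy[of y] that A by (simp add: algebra_simps)
    qed
    then show ?thesis using that by simp
  qed
  \<comment> \<open>One comparison of \<open>f\<close> at 2 and 1/2 suffices, since
    \<open>2 ^ q\<close> differs from its inverse.\<close>
  have C: "coeff Q (2 * q) = -1"
  proof -
    define u where "u = (2::complex) ^ q"
    have n: "norm u > 1" using q0 by (simp add: u_def norm_power one_less_power)
    then have u: "u \<noteq> 0" "u * u \<noteq> 1"
      by (auto, metis norm_mult norm_one less_1_mult less_irrefl)
    have "coeff Q q - inverse u + coeff Q (2 * q) * u = coeff Q q - u + coeff Q (2 * q) * inverse u"
    proof -
      have i: "(inverse 2 :: complex) ^ q = inverse u" by (simp only: u_def power_inverse)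
      show ?thesis
        using finv[of 2] fy[of 2] fy[of "inverse 2"] unfolding i u_def[symmetric] by simp
    qed
    then have "(coeff Q (2 * q) + 1) * (u - inverse u) = 0"
      by (simp add: algebra_simps)
    moreover have "u - inverse u \<noteq> 0"
      using u by (auto simp: field_simps)
    ultimately have "coeff Q (2 * q) + 1 = 0" by simp
    then show ?thesis by (simp add: eq_neg_iff_add_eq_0)
  qed
  show ?thesis
    by (rule exI[of _ "coeff Q q"]) (use fy C in \<open>auto simp: f_def simp del: upt_Suc\<close>)
qed

section \<open>Polynomials in a periodic Schroedinger operator\<close>

definition schr :: "(int \<Rightarrow> real) \<Rightarrow> (int \<Rightarrow> complex) \<Rightarrow> int \<Rightarrow> complex" where
  "schr v \<phi> = (\<lambda>n. \<phi> (n - 1) + \<phi> (n + 1) + complex_of_real (v n) * \<phi> n)"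

text \<open>Horner's rule for a polynomial in the operator, on arbitrary sequences, so that the same
  algebra serves quasiperiodic and square summable ones.\<close>

definition poly_act :: "(int \<Rightarrow> real) \<Rightarrow> complex poly \<Rightarrow> (int \<Rightarrow> complex) \<Rightarrow> int \<Rightarrow> complex" where
  "poly_act v f \<phi> = fold_coeffs (\<lambda>a \<psi> n. a * \<phi> n + schr v \<psi> n) f (\<lambda>_. 0)"

lemma schr_0 [simp]: "schr v (\<lambda>_. 0) = (\<lambda>_. 0)"
  by (simp add: schr_def)

lemma poly_act_0 [simp]: "poly_act v 0 \<phi> = (\<lambda>_. 0)"
  by (simp add: poly_act_def)

lemma poly_act_pCons: "poly_act v (pCons a f) \<phi> = (\<lambda>n. a * \<phi> n + schr v (poly_act v f \<phi>) n)"
  by (cases "f = 0 \<and> a = 0") (auto simp: poly_act_def)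

lemma schr_add: "schr v (\<lambda>n. \<phi> n + \<psi> n) = (\<lambda>n. schr v \<phi> n + schr v \<psi> n)"
  and schr_scale: "schr v (\<lambda>n. s * \<phi> n) = (\<lambda>n. s * schr v \<phi> n)"
  by (simp_all add: schr_def fun_eq_iff algebra_simps)

lemma poly_act_add: "poly_act v (f + g) \<phi> = (\<lambda>n. poly_act v f \<phi> n + poly_act v g \<phi> n)"
proof (induction f arbitrary: g)
  case (pCons a f)
  show ?case
  proof (cases g)
    case (pCons b h)
    show ?thesis unfolding \<open>g = _\<close>
      using pCons.IH[of h] by (simp add: poly_act_pCons schr_add algebra_simps)
  qed
qed simp

lemma poly_act_smult: "poly_act v (smult s f) \<phi> = (\<lambda>n. s * poly_act v f \<phi> n)"
  by (induction f) (simp_all add: poly_act_pCons schr_scale algebra_simps)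

lemma poly_act_uminus: "poly_act v (- f) \<phi> = (\<lambda>n. - poly_act v f \<phi> n)"
  using poly_act_smult[of v "-1" f \<phi>] by simp

lemma poly_act_diff: "poly_act v (f - g) \<phi> = (\<lambda>n. poly_act v f \<phi> n - poly_act v g \<phi> n)"
  using poly_act_add[of v f "- g" \<phi>] by (simp add: poly_act_uminus)

lemma poly_act_mult: "poly_act v (f * g) \<phi> = poly_act v f (poly_act v g \<phi>)"
  by (induction f) (simp_all add: poly_act_pCons poly_act_add poly_act_smult)

lemma poly_act_const [simp]: "poly_act v [:a:] \<phi> = (\<lambda>n. a * \<phi> n)"
  by (simp add: poly_act_pCons)

lemma poly_act_1 [simp]: "poly_act v 1 \<phi> = \<phi>"
  unfolding one_pCons by simp

lemma poly_act_linear: "poly_act v [:a, 1:] \<phi> = (\<lambda>n. a * \<phi> n + schr v \<phi> n)"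
  by (simp add: poly_act_pCons)

lemma poly_act_sum: "poly_act v (\<Sum>i\<in>A. f i) \<phi> = (\<lambda>n. \<Sum>i\<in>A. poly_act v (f i) \<phi> n)"
  by (induction A rule: infinite_finite_induct) (auto simp: poly_act_add)

text \<open>Solving the definition of \<open>schr\<close> at \<open>n + 1\<close> for the value at
  \<open>n\<close> gives the usual transfer recursion with the operator itself in the place of the
  energy. Polynomials in the operator commute, so the recursion can be iterated with polynomial
  matrix entries.\<close>

lemma poly_act_transfer:
  assumes "transfer (map (\<lambda>i. [: - complex_of_real (v (n + 1 + int i)), 1 :]) [0..<k]) = (a, b, c, d)"
  shows "poly_act v f \<phi> n = poly_act v (a * f) \<phi> (n + int k) + poly_act v (b * f) \<phi> (n + int k + 1) \<and>
         poly_act v f \<phi> (n + 1) = poly_act v (c * f) \<phi> (n + int k) + poly_act v (d * f) \<phi> (n + int k + 1)"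
  using assms
proof (induction k arbitrary: n a b c d f)
  case (Suc k)
  define e where "e = [: - complex_of_real (v (n + 1)), 1 :]"
  obtain a' b' c' d' where
    t: "transfer (map (\<lambda>i. [: - complex_of_real (v ((n + 1) + 1 + int i)), 1 :]) [0..<k]) = (a', b', c', d')"
    by (cases "transfer (map (\<lambda>i. [: - complex_of_real (v ((n + 1) + 1 + int i)), 1 :]) [0..<k])") auto
  have l: "map (\<lambda>i. [: - complex_of_real (v (n + 1 + int i)), 1 :]) [0..<Suc k]
      = e # map (\<lambda>i. [: - complex_of_real (v ((n + 1) + 1 + int i)), 1 :]) [0..<k]"
    by (simp add: e_def upt_conv_Cons map_Suc_upt[symmetric] o_def add_ac del: upt_Suc map_Suc_upt)
  have eqs: "a = e * a' - c'" "b = e * b' - d'" "c = a'" "d = b'"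
    using Suc.prems t unfolding l by auto
  have step: "poly_act v f \<phi> n = poly_act v (e * f) \<phi> (n + 1) - poly_act v f \<phi> (n + 2)"
    by (simp add: e_def poly_act_mult[of v "[:_, 1:]"] poly_act_linear schr_def add_ac del: mult_pCons_left)
  have k: "n + int (Suc k) = n + 1 + int k" by simp
  show ?case
    using Suc.IH[OF t, of f] Suc.IH[OF t, of "e * f"] step
    unfolding eqs k by (simp add: left_diff_distrib poly_act_diff algebra_simps)
qed simp

definition linear_factors :: "(int \<Rightarrow> real) \<Rightarrow> int \<Rightarrow> nat \<Rightarrow> complex poly list" where
  "linear_factors v n k = map (\<lambda>i. [: - complex_of_real (v (n + 1 + int i)), 1 :]) [0..<k]"

lemma transfer_trace_linear_factors_shift:
  assumes per: "\<And>n. v (n + int q) = v n"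
  shows "transfer_trace (linear_factors v n q) = transfer_trace (linear_factors v 0 q)"
proof -
  have step: "transfer_trace (linear_factors v (n + 1) q) = transfer_trace (linear_factors v n q)" for n
  proof -
    define g where "g = (\<lambda>i. [: - complex_of_real (v (n + 1 + int i)), 1 :])"
    have "linear_factors v (n + 1) q = map g [Suc 0..<Suc (0 + q)]"
      by (simp add: linear_factors_def g_def map_Suc_upt[symmetric] o_def add_ac del: upt_Suc map_Suc_upt)
    moreover have "g (0 + q) = g 0" using per[of "n + 1"] by (simp add: g_def)
    ultimately show ?thesis
      using map_shift_rotate[of g 0 q] by (simp add: linear_factors_def g_def)
  qed
  show ?thesis
  proof (induction n rule: int_induct[where k = 0])
    case (step2 i)
    then show ?case using step[of "i - 1"] by simp
  qed (use step in auto)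
qed

text \<open>Cayley--Hamilton for the one-period transfer matrix, whose entries are polynomials in the operator.\<close>

lemma poly_act_transfer_trace:
  assumes per: "\<And>n. v (n + int q) = v n"
  shows "poly_act v (transfer_trace (linear_factors v 0 q)) \<phi> n = \<phi> (n - int q) + \<phi> (n + int q)"
proof -
  define n0 where "n0 = n - int q"
  obtain a b c d where t: "transfer (linear_factors v n0 q) = (a, b, c, d)" by (cases "transfer (linear_factors v n0 q)") auto
  have t': "transfer (linear_factors v (n0 + int q) q) = (a, b, c, d)"
  proof -
    have "v (n0 + int q + 1 + int i) = v (n0 + 1 + int i)" for i
      using per[of "n0 + 1 + int i"] by (simp add: add_ac)
    then have "linear_factors v (n0 + int q) q = linear_factors v n0 q" by (simp add: linear_factors_def)
    then show ?thesis using t by simp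
  qed
  have det: "a * d = 1 + b * c" using transfer_det[OF t] by (simp add: algebra_simps)
  note A = poly_act_transfer[OF t[unfolded linear_factors_def], of _ \<phi>]
  note B = poly_act_transfer[OF t'[unfolded linear_factors_def], of _ \<phi>]
  define F where "F f = poly_act v f \<phi> (n0 + int q + int q)" for f
  define G where "G f = poly_act v f \<phi> (n0 + int q + int q + 1)" for f
  have FG: "F (f + g) = F f + F g" "G (f + g) = G f + G g" for f g
    by (simp_all add: F_def G_def poly_act_add)
  have "\<phi> n0 = F (a * a) + G (b * a) + (F (c * b) + G (d * b))"
    using A[of 1] B[of a] B[of b] by (simp add: F_def G_def)
  also have "\<dots> = F (a * a + c * b) + G (b * a + d * b)" by (simp add: FG)
  \<comment> \<open>This and the next line are the first row of M^2 = (tr M) M - 1 for the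
    one-period matrix M of determinant 1.\<close>
  also have "a * a + c * b = a * (a + d) - 1" using det by (simp add: algebra_simps)
  also have "b * a + d * b = b * (a + d)" by (simp add: algebra_simps)
  also have "F (a * (a + d) - 1) = F (a * (a + d)) - F 1" by (simp add: F_def poly_act_diff)
  also have "F 1 = \<phi> (n0 + int q + int q)" by (simp add: F_def)
  finally have "\<phi> n0 + \<phi> (n0 + int q + int q) = F (a * (a + d)) + G (b * (a + d))" by simp
  also have "\<dots> = poly_act v (a + d) \<phi> (n0 + int q)"
    using B[of "a + d"] by (simp add: F_def G_def)
  also have "a + d = transfer_trace (linear_factors v n0 q)" by (simp add: transfer_trace_def t)
  also have "\<dots> = transfer_trace (linear_factors v 0 q)" by (rule transfer_trace_linear_factors_shift) (rule per)
  finally show ?thesis by (simp add: n0_def)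
qed

text \<open>Here \<open>w\<close> is a primitive q-th root of unity, \<open>y\<close> the phase of
  the cosine potential, and \<open>z\<close> the Floquet multiplier for a translation by one period.
  The operator maps the q-dimensional space \<open>Q\<close> to itself and is self-adjoint there
  because \<open>z\<close> is unimodular.\<close>

locale bloch =
  fixes q m :: nat and w y z :: complex and v :: "int \<Rightarrow> real"
  assumes q: "q = 2 * m + 1"
    and w: "norm w = 1" "w ^ q = 1" "\<And>i. 0 < i \<Longrightarrow> i < q \<Longrightarrow> w ^ i \<noteq> 1"
    and y: "norm y = 1" and z: "norm z = 1"
    and v: "\<And>n. complex_of_real (v n) = w powi n * y + inverse (w powi n * y)"
begin

lemma q_pos: "q > 0" using q by simp

lemma nonzero: "w \<noteq> 0" "y \<noteq> 0" "z \<noteq> 0"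
  using w y z by auto

lemma w_powi_period: "w powi (n + int q) = w powi n"
  using nonzero w(2) by (simp add: power_int_add)

lemma v_period: "v (n + int q) = v n"
proof -
  have "complex_of_real (v (n + int q)) = complex_of_real (v n)"
    unfolding v w_powi_period ..
  then show ?thesis by simp
qed

lemma w_powi_eq_1_iff: "w powi n = 1 \<longleftrightarrow> int q dvd n"
proof -
  define r where "r = nat (n mod int q)"
  have r: "int r = n mod int q" "r < q" using q_pos by (auto simp: r_def nat_less_iff)
  have "w powi n = w powi (int q * (n div int q) + int r)" using r by simp
  also have "\<dots> = (w powi int q) powi (n div int q) * w powi int r"
    using nonzero by (simp only: power_int_add power_int_mult simp_thms)
  also have "\<dots> = w ^ r" using w(2) by simp
  finally have "w powi n = 1 \<longleftrightarrow> r = 0" using w(3)[of r] r by (cases "r = 0") auto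
  also have "\<dots> \<longleftrightarrow> int q dvd n" using r by (auto simp: dvd_eq_mod_eq_0)
  finally show ?thesis .
qed

definition Q :: "(int \<Rightarrow> complex) set" where
  "Q = {\<phi>. \<forall>n. \<phi> (n + int q) = z * \<phi> n}"

lemma schr_Q: "\<phi> \<in> Q \<Longrightarrow> schr v \<phi> \<in> Q"
proof -
  assume a: "\<phi> \<in> Q"
  have A: "\<phi> (k + int q) = z * \<phi> k" for k using a by (simp add: Q_def)
  have "\<phi> (n + int q - 1) = z * \<phi> (n - 1)" "\<phi> (n + int q + 1) = z * \<phi> (n + 1)" "\<phi> (n + int q) = z * \<phi> n" for n
    using A[of "n - 1"] A[of "n + 1"] A[of n] by (simp_all add: algebra_simps)
  then show ?thesis by (simp add: Q_def schr_def v_period algebra_simps)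
qed

lemma poly_act_Q: "\<phi> \<in> Q \<Longrightarrow> poly_act v f \<phi> \<in> Q"
proof (induction f)
  case (pCons a f)
  then have "schr v (poly_act v f \<phi>) \<in> Q" by (intro schr_Q) auto
  then show ?case using pCons.prems by (simp add: poly_act_pCons Q_def algebra_simps)
qed (simp add: Q_def)

definition ip :: "(int \<Rightarrow> complex) \<Rightarrow> (int \<Rightarrow> complex) \<Rightarrow> complex" where
  "ip \<phi> \<psi> = (\<Sum>n\<in>{0..<int q}. cnj (\<phi> n) * \<psi> n)"

lemma sum_period:
  fixes h :: "int \<Rightarrow> complex"
  assumes "\<And>n. h (n + int q) = h n"
  shows "(\<Sum>n\<in>{0..<int q}. h (n + 1)) = (\<Sum>n\<in>{0..<int q}. h n)"
proof -
  have "(\<Sum>n\<in>{0..<int q}. h (n + 1)) = (\<Sum>n\<in>{1..<int q + 1}. h n)"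
    by (rule sum.reindex_bij_witness[of _ "\<lambda>n. n - 1" "\<lambda>n. n + 1"]) auto
  also have "{1..<int q + 1} = insert (int q) {1..<int q}" using q_pos by auto
  also have "sum h \<dots> = h (0 + int q) + sum h {1..<int q}" by simp
  also have "h (0 + int q) = h 0" by (rule assms)
  also have "h 0 + sum h {1..<int q} = sum h (insert 0 {1..<int q})" by simp
  also have "insert 0 {1..<int q} = {0..<int q}" using q_pos by auto
  finally show ?thesis .
qed

lemma sum_period':
  fixes h :: "int \<Rightarrow> complex"
  assumes "\<And>n. h (n + int q) = h n"
  shows "(\<Sum>n\<in>{0..<int q}. h (n - 1)) = (\<Sum>n\<in>{0..<int q}. h n)"
proof -
  have "h (n + int q - 1) = h (n - 1)" for n
    using assms[of "n - 1"] by (simp add: algebra_simps)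
  then show ?thesis using sum_period[of "\<lambda>n. h (n - 1)"] by simp
qed

lemma cnj_z: "cnj z * z = 1"
  using z by (metis complex_norm_square mult.commute norm_one of_real_1 power_one)

lemma ip_schr:
  assumes "\<phi> \<in> Q" "\<psi> \<in> Q"
  shows "ip (schr v \<phi>) \<psi> = ip \<phi> (schr v \<psi>)"
proof -
  have p: "cnj (\<phi> (n + int q)) * \<psi> (n' + int q) = cnj (\<phi> n) * \<psi> n'" for n n'
    using assms cnj_z by (simp add: Q_def algebra_simps)
  have 1: "(\<Sum>n\<in>{0..<int q}. cnj (\<phi> (n - 1)) * \<psi> n) = (\<Sum>n\<in>{0..<int q}. cnj (\<phi> n) * \<psi> (n + 1))"
    using sum_period'[of "\<lambda>n. cnj (\<phi> n) * \<psi> (n + 1)"] p[of _ "_ + 1"] by (simp add: algebra_simps)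
  have 2: "(\<Sum>n\<in>{0..<int q}. cnj (\<phi> (n + 1)) * \<psi> n) = (\<Sum>n\<in>{0..<int q}. cnj (\<phi> n) * \<psi> (n - 1))"
    using sum_period[of "\<lambda>n. cnj (\<phi> n) * \<psi> (n - 1)"] p[of _ "_ - 1"] by (simp add: algebra_simps)
  show ?thesis
    using 1 2 by (simp add: ip_def schr_def algebra_simps sum.distrib)
qed

lemma ip_poly_act:
  assumes "\<phi> \<in> Q" "\<psi> \<in> Q"
  shows "ip (poly_act v f \<phi>) \<psi> = ip \<phi> (poly_act v (map_poly cnj f) \<psi>)"
  using assms(2)
proof (induction f arbitrary: \<psi>)
  case (pCons a f)
  have c: "poly_act v (map_poly cnj f) (schr v \<psi>) = schr v (poly_act v (map_poly cnj f) \<psi>)"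
  proof -
    have s: "schr v \<xi> = poly_act v [:0, 1:] \<xi>" for \<xi> by (simp add: poly_act_linear)
    show ?thesis unfolding s by (simp only: poly_act_mult[symmetric] mult.commute)
  qed
  have "ip (poly_act v (pCons a f) \<phi>) \<psi> = cnj a * ip \<phi> \<psi> + ip (schr v (poly_act v f \<phi>)) \<psi>"
    by (simp add: poly_act_pCons ip_def algebra_simps sum.distrib sum_distrib_left)
  also have "ip (schr v (poly_act v f \<phi>)) \<psi> = ip (poly_act v f \<phi>) (schr v \<psi>)"
    by (intro ip_schr poly_act_Q assms pCons.prems)
  also have "\<dots> = ip \<phi> (poly_act v (map_poly cnj f) (schr v \<psi>))"
    by (rule pCons.IH) (intro schr_Q pCons.prems)
  finally show ?case
    unfolding c by (simp add: map_poly_pCons poly_act_pCons ip_def algebra_simps sum.distrib sum_distrib_left)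
qed (simp add: ip_def)

text \<open>The unit mass at x made quasiperiodic. Over one period of x these functions form the
  orthonormal basis of \<open>Q\<close> in which matrix entries are read off.\<close>

definition delta :: "int \<Rightarrow> int \<Rightarrow> complex" where
  "delta x n = (if int q dvd n - x then z powi ((n - x) div int q) else 0)"

lemma delta_Q: "delta x \<in> Q"
proof -
  have "delta x (n + int q) = z * delta x n" for n
  proof (cases "int q dvd n - x")
    case True
    then obtain k where k: "n - x = int q * k" by auto
    then have "n + int q - x = int q * (k + 1)" by (simp add: algebra_simps)
    then show ?thesis using k q_pos nonzero by (simp add: delta_def power_int_add)
  next
    case False
    have "n + int q - x = (n - x) + int q" by simp
    then have "\<not> int q dvd n + int q - x" using False by (metis dvd_add_triv_right_iff)
    then show ?thesis using False by (simp add: delta_def)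
  qed
  then show ?thesis by (simp add: Q_def)
qed

lemma delta_shift: "delta (x + int q) = (\<lambda>n. inverse z * delta x n)"
proof
  fix n
  have "delta (x + int q) (n + int q) = delta x n" by (simp add: delta_def)
  moreover have "delta (x + int q) (n + int q) = z * delta (x + int q) n"
    using delta_Q[of "x + int q"] by (simp add: Q_def)
  ultimately show "delta (x + int q) n = inverse z * delta x n" using nonzero by (simp add: field_simps)
qed

section \<open>Traces of words in translations and multiplications\<close>

lemma poly_act_scale: "poly_act v f (\<lambda>n. s * \<phi> n) = (\<lambda>n. s * poly_act v f \<phi> n)"
  by (induction f) (simp_all add: poly_act_pCons schr_scale algebra_simps)

text \<open>The trace on \<open>Q\<close> of the k-th power of the operator against a translation by
  i and the multiplication by \<open>w powi (- j * n)\<close>. Expanding the power, it collects the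
  words of length k in the two unitaries and their inverses whose displacement matches (i, j) modulo
  q.\<close>

definition word_trace :: "nat \<Rightarrow> int \<Rightarrow> int \<Rightarrow> complex" where
  "word_trace k i j = (\<Sum>n\<in>{0..<int q}. w powi (- j * n) * poly_act v (monom 1 k) (delta (n + i)) n)"

lemma poly_act_delta_period:
  "poly_act v f (delta (x + int q)) (n + int q) = poly_act v f (delta x) n"
proof -
  have "poly_act v f (delta (x + int q)) (n + int q) = z * poly_act v f (delta (x + int q)) n"
    using poly_act_Q[OF delta_Q] by (simp add: Q_def)
  also have "\<dots> = poly_act v f (delta x) n"
    using nonzero by (simp add: delta_shift poly_act_scale)
  finally show ?thesis .
qed

lemma w_powi_mult_period: "w powi (j * (n + int q)) = w powi (j * n)"
proof -
  have "w powi (j * int q) = 1" unfolding w_powi_eq_1_iff by simp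
  then show ?thesis using nonzero by (simp add: distrib_left power_int_add)
qed

text \<open>This peels off the outermost letter of each word: a translation changes i, a factor of
  the potential changes j, and the powers of \<open>w\<close> arise from moving a translation past
  the multiplication operator.\<close>

lemma word_trace_Suc:
  "word_trace (Suc k) i j = w powi j * word_trace k (i - 1) j + w powi (- j) * word_trace k (i + 1) j
     + y * word_trace k i (j - 1) + inverse y * word_trace k i (j + 1)"
proof -
  define P where "P x n = poly_act v (monom 1 k) (delta x) n" for x n
  have per: "P (x + int q) (n + int q) = P x n" for x n
    unfolding P_def by (rule poly_act_delta_period)
  have S: "word_trace (Suc k) i j = (\<Sum>n\<in>{0..<int q}. w powi (- j * n) * P (n + i) (n - 1))
     + (\<Sum>n\<in>{0..<int q}. w powi (- j * n) * P (n + i) (n + 1))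
     + (\<Sum>n\<in>{0..<int q}. w powi (- j * n) * complex_of_real (v n) * P (n + i) n)"
    by (simp add: word_trace_def monom_Suc poly_act_pCons schr_def P_def algebra_simps sum.distrib)
  have 1: "(\<Sum>n\<in>{0..<int q}. w powi (- j * n) * P (n + i) (n - 1)) = w powi (- j) * word_trace k (i + 1) j"
  proof -
    define h where "h n = w powi (- j * n) * P (n + (i + 1)) n" for n
    have "w powi (- j * n) * P (n + i) (n - 1) = w powi (- j) * h (n - 1)" for n
    proof -
      have "w powi (- j) * w powi (- j * (n - 1)) = w powi (- j * n)"
        using nonzero by (simp add: algebra_simps flip: power_int_add)
      then show ?thesis by (simp add: h_def mult.assoc[symmetric])
    qed
    moreover have "h (n + int q) = h n" for n
      using per[of "n + (i + 1)" n] w_powi_mult_period[of "- j" n] by (simp add: h_def add_ac)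
    ultimately have "(\<Sum>n\<in>{0..<int q}. w powi (- j * n) * P (n + i) (n - 1)) = w powi (- j) * (\<Sum>n\<in>{0..<int q}. h n)"
      using sum_period'[of h] by (simp only: sum_distrib_left[symmetric])
    then show ?thesis by (simp only: word_trace_def h_def P_def)
  qed
  have 2: "(\<Sum>n\<in>{0..<int q}. w powi (- j * n) * P (n + i) (n + 1)) = w powi j * word_trace k (i - 1) j"
  proof -
    define h where "h n = w powi (- j * n) * P (n + (i - 1)) n" for n
    have "w powi (- j * n) * P (n + i) (n + 1) = w powi j * h (n + 1)" for n
    proof -
      have "w powi j * w powi (- j * (n + 1)) = w powi (- j * n)"
        using nonzero by (simp add: algebra_simps flip: power_int_add)
      then show ?thesis by (simp add: h_def mult.assoc[symmetric])
    qed
    moreover have "h (n + int q) = h n" for n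
      using per[of "n + (i - 1)" n] w_powi_mult_period[of "- j" n] by (simp add: h_def algebra_simps)
    ultimately have "(\<Sum>n\<in>{0..<int q}. w powi (- j * n) * P (n + i) (n + 1)) = w powi j * (\<Sum>n\<in>{0..<int q}. h n)"
      using sum_period[of h] by (simp only: sum_distrib_left[symmetric])
    then show ?thesis by (simp only: word_trace_def h_def P_def)
  qed
  have 3: "(\<Sum>n\<in>{0..<int q}. w powi (- j * n) * complex_of_real (v n) * P (n + i) n)
     = y * word_trace k i (j - 1) + inverse y * word_trace k i (j + 1)"
  proof -
    have "w powi (- j * n) * complex_of_real (v n)
        = y * w powi (- (j - 1) * n) + inverse y * w powi (- (j + 1) * n)" for n
    proof -
      have "w powi (- j * n) * w powi n = w powi (- (j - 1) * n)"
        "w powi (- j * n) * w powi (- n) = w powi (- (j + 1) * n)"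
        using nonzero by (simp_all add: algebra_simps flip: power_int_add)
      moreover have "inverse (w powi n * y) = w powi (- n) * inverse y"
        by (simp add: power_int_minus)
      moreover have "w powi (- j * n) * (w powi n * y + w powi (- n) * inverse y)
          = y * (w powi (- j * n) * w powi n) + inverse y * (w powi (- j * n) * w powi (- n))"
        by (simp only: distrib_left mult_ac)
      ultimately show ?thesis unfolding v by (simp only:)
    qed
    then show ?thesis
      by (simp add: word_trace_def P_def algebra_simps sum.distrib sum_distrib_left)
  qed
  show ?thesis unfolding S 1 2 3 by (simp add: algebra_simps)
qed

lemma word_trace_0: "word_trace 0 i j = (if int q dvd i \<and> int q dvd j then of_nat q * z powi (- i div int q) else 0)"
proof -
  have d: "delta (n + i) n = (if int q dvd i then z powi (- i div int q) else 0)" for n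
    by (simp add: delta_def)
  have "word_trace 0 i j = (if int q dvd i then z powi (- i div int q) else 0) * (\<Sum>n\<in>{0..<int q}. w powi (- j * n))"
    by (simp add: word_trace_def monom_0 d sum_distrib_left mult.commute)
  also have "(\<Sum>n\<in>{0..<int q}. w powi (- j * n)) = (if int q dvd j then of_nat q else 0)"
  proof (cases "int q dvd j")
    case True
    then have "w powi (- j * n) = 1" for n unfolding w_powi_eq_1_iff by simp
    then show ?thesis using True by simp
  next
    case False
    then have n1: "w powi (- j) \<noteq> 1" unfolding w_powi_eq_1_iff by simp
    have "(\<Sum>n\<in>{0..<int q}. w powi (- j * (n + 1))) = (\<Sum>n\<in>{0..<int q}. w powi (- j * n))"
      by (rule sum_period[of "\<lambda>n. w powi (- j * n)"]) (rule w_powi_mult_period)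
    also have "(\<Sum>n\<in>{0..<int q}. w powi (- j * (n + 1))) = w powi (- j) * (\<Sum>n\<in>{0..<int q}. w powi (- j * n))"
    proof -
      have "w powi (- j * (n + 1)) = w powi (- j) * w powi (- j * n)" for n
        using nonzero by (simp add: algebra_simps flip: power_int_add)
      then show ?thesis by (simp only: sum_distrib_left)
    qed
    finally have "(\<Sum>n\<in>{0..<int q}. w powi (- j * n)) = 0" using n1 by simp
    then show ?thesis using False by simp
  qed
  finally show ?thesis by simp
qed

text \<open>Each letter moves (i, j) by one unit, and the empty word has trace 0 unless both
  coordinates are multiples of q.\<close>

lemma word_trace_eq_0:
  assumes "\<And>A B. \<bar>i - A * int q\<bar> + \<bar>j - B * int q\<bar> > int k"
  shows "word_trace k i j = 0"
  using assms
proof (induction k arbitrary: i j)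
  case 0
  have "\<not> (int q dvd i \<and> int q dvd j)"
  proof
    assume "int q dvd i \<and> int q dvd j"
    then obtain A B where "i = A * int q" "j = B * int q" by (metis dvd_def mult.commute)
    then show False using 0[of A B] by simp
  qed
  then show ?case unfolding word_trace_0 by (rule if_not_P)
next
  case (Suc k)
  have "\<bar>i' - A * int q\<bar> + \<bar>j' - B * int q\<bar> > int k" if "\<bar>i' - i\<bar> + \<bar>j' - j\<bar> \<le> 1" for i' j' A B
    using Suc.prems[of A B] that by linarith
  then have "word_trace k (i - 1) j = 0" "word_trace k (i + 1) j = 0" "word_trace k i (j - 1) = 0" "word_trace k i (j + 1) = 0"
    by (intro Suc.IH; simp)+
  then show ?case by (simp add: word_trace_Suc)
qed

text \<open>As q = 2 m + 1, no multiple of q is nearer to a point of 0, ..., m than 0 is; for m + 1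
  at most one unit is lost.\<close>

lemma dist_lattice:
  assumes "0 \<le> x" "x \<le> int m + 1"
  shows "\<bar>x - A * int q\<bar> \<ge> x - 1" "x \<le> int m \<Longrightarrow> \<bar>x - A * int q\<bar> \<ge> x"
proof -
  have "A * int q \<le> 0 \<or> A * int q \<ge> int q"
  proof (cases "A \<le> 0")
    case False
    then have "1 * int q \<le> A * int q" by (intro mult_right_mono) auto
    then show ?thesis by simp
  qed (simp add: mult_nonpos_nonneg)
  moreover have "int q = 2 * int m + 1" using q by simp
  ultimately show "\<bar>x - A * int q\<bar> \<ge> x - 1" "x \<le> int m \<Longrightarrow> \<bar>x - A * int q\<bar> \<ge> x"
    using assms by (smt (verit))+
qed

text \<open>Up to the factor \<open>q y\<^sup>b\<close> this is a Gaussian binomial coefficient: only words in the \<open>a\<close> translations and \<open>b\<close> multiplications contribute.\<close>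

lemma word_trace_edge:
  assumes "a \<le> m" "b \<le> m"
  shows "word_trace (a + b) (int a) (int b) * (\<Prod>i=1..b. 1 - w ^ i) = of_nat q * y ^ b * (\<Prod>i=1..b. 1 - w ^ (a + i))"
  using assms
proof (induction "a + b" arbitrary: a b)
  case 0
  then show ?case by (simp add: word_trace_0)
next
  case (Suc k)
  \<comment> \<open>These neighbours are too far from the lattice to be reached by the remaining
    letters, and so are the other two when \<open>a\<close> or \<open>b\<close> is 0.\<close>
  have z1: "word_trace k (int a + 1) (int b) = 0"
  proof (rule word_trace_eq_0)
    fix A B show "int k < \<bar>int a + 1 - A * int q\<bar> + \<bar>int b - B * int q\<bar>"
      using dist_lattice(1)[of "int a + 1" A] dist_lattice(2)[of "int b" B] Suc.hyps(2) Suc.prems by simp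
  qed
  have z2: "word_trace k (int a) (int b + 1) = 0"
  proof (rule word_trace_eq_0)
    fix A B show "int k < \<bar>int a - A * int q\<bar> + \<bar>int b + 1 - B * int q\<bar>"
      using dist_lattice(2)[of "int a" A] dist_lattice(1)[of "int b + 1" B] Suc.hyps(2) Suc.prems by simp
  qed
  have z3: "word_trace k (int a - 1) (int b) = 0" if "a = 0"
  proof (rule word_trace_eq_0)
    fix A B
    have "\<bar>int a - 1 - A * int q\<bar> \<ge> \<bar>1 + A * int q\<bar>" using that by simp
    moreover have "\<bar>1 + A * int q\<bar> > 0"
    proof -
      have "1 + A * int q \<noteq> 0 \<or> q = 1" by (metis dvd_minus_iff dvd_triv_right eq_neg_iff_add_eq_0 int_dvd_int_iff nat_dvd_1_iff_1 of_nat_1)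
      moreover have "q \<noteq> 1" using Suc.hyps(2) Suc.prems q that by auto
      ultimately show ?thesis by simp
    qed
    ultimately show "int k < \<bar>int a - 1 - A * int q\<bar> + \<bar>int b - B * int q\<bar>"
      using dist_lattice(2)[of "int b" B] Suc.hyps(2) Suc.prems that by linarith
  qed
  have z4: "word_trace k (int a) (int b - 1) = 0" if "b = 0"
  proof (rule word_trace_eq_0)
    fix A B
    have "\<bar>int b - 1 - B * int q\<bar> \<ge> \<bar>1 + B * int q\<bar>" using that by simp
    moreover have "\<bar>1 + B * int q\<bar> > 0"
    proof -
      have "1 + B * int q \<noteq> 0 \<or> q = 1" by (metis dvd_minus_iff dvd_triv_right eq_neg_iff_add_eq_0 int_dvd_int_iff nat_dvd_1_iff_1 of_nat_1)
      moreover have "q \<noteq> 1" using Suc.hyps(2) Suc.prems q that by auto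
      ultimately show ?thesis by simp
    qed
    ultimately show "int k < \<bar>int a - A * int q\<bar> + \<bar>int b - 1 - B * int q\<bar>"
      using dist_lattice(2)[of "int a" A] Suc.hyps(2) Suc.prems that by linarith
  qed
  \<comment> \<open>The Pascal rule for Gaussian binomial coefficients in \<open>w\<close>, with one
    factor \<open>y\<close> per multiplication. The induction runs on the form cleared of
    denominators.\<close>
  have rec: "word_trace (a + b) (int a) (int b) = w ^ b * word_trace k (int a - 1) (int b) + y * word_trace k (int a) (int b - 1)"
    using z1 z2 unfolding Suc.hyps(2)[symmetric] word_trace_Suc by simp
  show ?case
  proof (cases "b = 0")
    case b: True
    then obtain a' where a: "a = Suc a'" using Suc.hyps(2) by (cases a) auto
    show ?thesis using Suc.hyps(1)[of a' 0] Suc.hyps(2) Suc.prems a b rec z4 by simp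
  next
    case False
    then obtain b' where b: "b = Suc b'" by (cases b) auto
    define P where "P = (\<Prod>i=1..b'. 1 - w ^ i)"
    define R where "R = (\<Prod>i=1..b'. 1 - w ^ (a + i))"
    have 2: "word_trace k (int a - 1) (int b) * (P * (1 - w ^ b)) = of_nat q * y ^ b * ((1 - w ^ a) * R)"
    proof (cases a)
      case 0
      then show ?thesis using z3 by simp
    next
      case a: (Suc a')
      have "(\<Prod>i=1..b. 1 - w ^ (a' + i)) = (1 - w ^ (a' + 1)) * (\<Prod>i=1..b'. 1 - w ^ (a' + Suc i))"
        unfolding b by (subst prod.atLeast_Suc_atMost) (simp_all add: prod.shift_bounds_cl_Suc_ivl del: prod.cl_ivl_Suc)
      moreover have "(\<Prod>i=1..b. 1 - w ^ i) = P * (1 - w ^ b)" by (simp add: P_def b)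
      ultimately show ?thesis
        using Suc.hyps(1)[of a' b] Suc.hyps(2) Suc.prems a by (simp add: R_def)
    qed
    have 3: "word_trace k (int a) (int b - 1) * P = of_nat q * y ^ b' * R"
      using Suc.hyps(1)[of a b'] Suc.hyps(2) Suc.prems b by (simp add: R_def P_def)
    have "word_trace (a + b) (int a) (int b) * (P * (1 - w ^ b))
        = w ^ b * (word_trace k (int a - 1) (int b) * (P * (1 - w ^ b)))
          + y * (1 - w ^ b) * (word_trace k (int a) (int b - 1) * P)"
      unfolding rec by (simp add: algebra_simps)
    also have "\<dots> = of_nat q * y ^ b * R * (w ^ b * (1 - w ^ a) + (1 - w ^ b))"
      unfolding 2 3 by (simp add: b algebra_simps)
    also have "w ^ b * (1 - w ^ a) + (1 - w ^ b) = 1 - w ^ (a + b)"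
      by (simp add: power_add algebra_simps)
    finally show ?thesis by (simp add: P_def R_def b)
  qed
qed

text \<open>The exponents m + i and m + 1 - i add up to q, so \<open>1 - w ^ (m + i)\<close> and
  \<open>1 - w ^ (m + 1 - i)\<close> have the same modulus: numerator and denominator of the
  Gaussian binomial agree in modulus after reversing the order.\<close>

lemma norm_word_trace_middle: "norm (word_trace (2 * m) (int m) (int m)) = real q"
proof -
  have e: "norm (1 - w ^ (m + i)) = norm (1 - w ^ (m + 1 - i))" if "i \<in> {1..m}" for i
  proof -
    have "w ^ (m + i) * w ^ (m + 1 - i) = w ^ (m + i + (m + 1 - i))" by (simp only: power_add)
    also have "m + i + (m + 1 - i) = q" using that q by simp
    finally have "w ^ (m + i) * w ^ (m + 1 - i) = 1" using w(2) by simp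
    then have "(1 - w ^ (m + i)) * w ^ (m + 1 - i) = - (1 - w ^ (m + 1 - i))"
      by (simp add: algebra_simps)
    then have "norm (1 - w ^ (m + i)) * norm (w ^ (m + 1 - i)) = norm (1 - w ^ (m + 1 - i))"
      by (metis norm_minus_cancel norm_mult)
    then show ?thesis using w(1) by (simp add: norm_power)
  qed
  have "(\<Prod>i=1..m. norm (1 - w ^ (m + i))) = (\<Prod>i=1..m. norm (1 - w ^ (m + 1 - i)))"
    by (rule prod.cong) (use e in auto)
  also have "\<dots> = (\<Prod>i=1..m. norm (1 - w ^ i))"
    by (rule prod.reindex_bij_witness[of _ "\<lambda>i. m + 1 - i" "\<lambda>i. m + 1 - i"]) auto
  finally have pr: "norm (\<Prod>i=1..m. 1 - w ^ (m + i)) = norm (\<Prod>i=1..m. 1 - w ^ i)"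
    by (simp add: prod_norm)
  have "(\<Prod>i=1..m. 1 - w ^ i) \<noteq> 0" using w(3) q by (auto simp: prod_zero_iff) 
  moreover have "norm (word_trace (m + m) (int m) (int m)) * norm (\<Prod>i=1..m. 1 - w ^ i) = real q * norm (\<Prod>i=1..m. 1 - w ^ i)"
  proof -
    have "norm (word_trace (m + m) (int m) (int m)) * norm (\<Prod>i=1..m. 1 - w ^ i)
        = norm (of_nat q * y ^ m * (\<Prod>i=1..m. 1 - w ^ (m + i)))"
      by (simp only: norm_mult[symmetric] word_trace_edge[OF order.refl order.refl])
    also have "\<dots> = real q * norm (\<Prod>i=1..m. 1 - w ^ (m + i))"
      using y by (simp add: norm_mult norm_power)
    finally show ?thesis unfolding pr .
  qed
  ultimately show ?thesis by (simp add: mult_2)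
qed

lemma poly_act_as_sum: "poly_act v f \<phi> n = (\<Sum>k\<le>degree f. coeff f k * poly_act v (monom 1 k) \<phi> n)"
proof -
  have "f = (\<Sum>k\<le>degree f. smult (coeff f k) (monom 1 k))"
    by (simp add: poly_as_sum_of_monoms smult_monom)
  then have "poly_act v f \<phi> n = poly_act v (\<Sum>k\<le>degree f. smult (coeff f k) (monom 1 k)) \<phi> n" by simp
  also have "\<dots> = (\<Sum>k\<le>degree f. coeff f k * poly_act v (monom 1 k) \<phi> n)"
    by (simp only: poly_act_sum poly_act_smult)
  finally show ?thesis .
qed

text \<open>Words with fewer than 2m letters cannot produce the displacement (m, m), so only the
  leading term contributes.\<close>

lemma norm_trace_monic:
  assumes "degree f = 2 * m" "lead_coeff f = 1"
  shows "norm (\<Sum>n\<in>{0..<int q}. w powi (- int m * n) * poly_act v f (delta (n + int m)) n) = real q"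
proof -
  have "(\<Sum>n\<in>{0..<int q}. w powi (- int m * n) * poly_act v f (delta (n + int m)) n)
     = (\<Sum>n\<in>{0..<int q}. \<Sum>k\<le>2*m. coeff f k * (w powi (- int m * n) * poly_act v (monom 1 k) (delta (n + int m)) n))"
    by (subst poly_act_as_sum) (simp add: assms(1) sum_distrib_left mult.left_commute)
  also have "\<dots> = (\<Sum>k\<le>2*m. coeff f k * word_trace k (int m) (int m))"
    by (subst sum.swap) (simp add: word_trace_def sum_distrib_left)
  also have "\<dots> = (\<Sum>k\<in>{2*m}. coeff f k * word_trace k (int m) (int m))"
  proof (rule sum.mono_neutral_right)
    show "\<forall>k\<in>{..2 * m} - {2 * m}. coeff f k * word_trace k (int m) (int m) = 0"
    proof
      fix k assume k: "k \<in> {..2 * m} - {2 * m}"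
      have "word_trace k (int m) (int m) = 0"
      proof (rule word_trace_eq_0)
        fix A B show "int k < \<bar>int m - A * int q\<bar> + \<bar>int m - B * int q\<bar>"
          using dist_lattice(2)[of "int m" A] dist_lattice(2)[of "int m" B] k by simp
      qed
      then show "coeff f k * word_trace k (int m) (int m) = 0" by simp
    qed
  qed auto
  also have "\<dots> = word_trace (2 * m) (int m) (int m)" using assms by simp
  finally show ?thesis using norm_word_trace_middle by simp
qed

end

lemma real_poly_of_infinite:
  fixes f :: "complex poly"
  assumes "infinite A" "\<And>x::real. x \<in> A \<Longrightarrow> poly f (of_real x) \<in> \<real>"
  shows "map_poly cnj f = f"
proof (rule ccontr)
  assume n: "map_poly cnj f \<noteq> f"
  have "poly (map_poly cnj f - f) (of_real x) = 0" if "x \<in> A" for x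
    using assms(2)[OF that] by (simp add: Reals_cnj_iff)
  then have "complex_of_real ` A \<subseteq> {x. poly (map_poly cnj f - f) x = 0}" by auto
  moreover have "finite {x. poly (map_poly cnj f - f) x = 0}"
    using n by (intro poly_roots_finite) simp
  ultimately have "finite (complex_of_real ` A)" by (rule finite_subset)
  then show False using assms(1) by (simp add: finite_image_iff inj_on_def)
qed

section \<open>Eigenfunctions and the derivative of the characteristic polynomial\<close>

context bloch
begin

definition trace_poly :: "complex poly" where
  "trace_poly = transfer_trace (linear_factors v 0 q)"

text \<open>On \<open>Q\<close> the translations by one period in the two directions act as
  \<open>z\<close> and \<open>inverse z\<close>. Hence this monic polynomial of degree q annihilates
  the operator there and serves as its characteristic polynomial.\<close>

definition bloch_poly :: "complex poly" where
  "bloch_poly = trace_poly - [:z + inverse z:]"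

lemma trace_poly_monic: "degree trace_poly = q" "coeff trace_poly q = 1"
proof -
  have "linear_factors v 0 q = map (\<lambda>v. [:- v, 1:]) (map (\<lambda>i. complex_of_real (v (0 + 1 + int i))) [0..<q])"
    by (simp add: linear_factors_def)
  then show "degree trace_poly = q" "coeff trace_poly q = 1"
    using transfer_trace_linear_monic[of "map (\<lambda>i. complex_of_real (v (0 + 1 + int i))) [0..<q]"] q_pos
    by (simp_all add: trace_poly_def)
qed

lemma poly_trace_poly_real: "poly trace_poly (of_real x) \<in> \<real>"
proof -
  have "poly trace_poly (of_real x) = transfer_trace (map complex_of_real (map (\<lambda>i. x - v (1 + int i)) [0..<q]))"
    by (simp add: trace_poly_def poly_transfer_trace linear_factors_def o_def)
  then show ?thesis by (metis transfer_trace_of_real Reals_of_real)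
qed

lemma z_inverse_real: "z + inverse z \<in> \<real>"
proof -
  have "inverse z = cnj z" using cnj_z by (metis inverse_unique mult.commute)
  then show ?thesis by (simp add: complex_add_cnj)
qed

lemma bloch_poly_monic: "degree bloch_poly = q" "coeff bloch_poly q = 1"
proof -
  have d: "degree (- [:z + inverse z:]) < degree trace_poly" using trace_poly_monic q_pos by simp
  have "bloch_poly = trace_poly + - [:z + inverse z:]" by (simp only: bloch_poly_def diff_conv_add_uminus)
  then show "degree bloch_poly = q" using degree_add_eq_left[OF d] trace_poly_monic by (simp only:)
  show "coeff bloch_poly q = 1" unfolding bloch_poly_def using trace_poly_monic q_pos by (simp add: coeff_pCons split: nat.split)
qed

lemma poly_act_bloch_poly: "\<phi> \<in> Q \<Longrightarrow> poly_act v bloch_poly \<phi> = (\<lambda>_. 0)"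
proof
  fix n assume a: "\<phi> \<in> Q"
  have "\<phi> (n - int q + int q) = z * \<phi> (n - int q)" "\<phi> (n + int q) = z * \<phi> n"
    using a unfolding Q_def by blast+
  then have "\<phi> (n - int q) = inverse z * \<phi> n" using nonzero by (simp add: field_simps)
  then show "poly_act v bloch_poly \<phi> n = 0"
    using \<open>\<phi> (n + int q) = z * \<phi> n\<close> poly_act_transfer_trace[of v q \<phi> n, OF v_period]
    by (simp add: bloch_poly_def trace_poly_def poly_act_diff algebra_simps)
qed

lemma norm_Q_mod: "u \<in> Q \<Longrightarrow> norm (u n) = norm (u (n mod int q))"
proof -
  assume u: "u \<in> Q"
  have "norm (u (n + int q * k)) = norm (u n)" for n k
  proof (induction k rule: int_induct[where k = 0])
    case (step1 i)
    then show ?case using u z by (simp add: Q_def distrib_left norm_mult add.assoc[symmetric])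
  next
    case (step2 i)
    have "u (n + int q * (i - 1) + int q) = z * u (n + int q * (i - 1))"
      using u by (simp add: Q_def)
    then have "norm (u (n + int q * i)) = norm (u (n + int q * (i - 1)))"
      using z by (simp add: algebra_simps norm_mult)
    then show ?case using step2 by simp
  qed simp
  then show ?thesis by (metis mod_mult_div_eq add.commute)
qed

context
  fixes E :: complex
  assumes E: "poly bloch_poly E = 0"
begin

definition cofactor :: "complex poly" where
  "cofactor = (SOME l. bloch_poly = [:- E, 1:] * l)"

lemma bloch_poly_factor: "bloch_poly = [:- E, 1:] * cofactor"
proof -
  have "[:- E, 1:] dvd bloch_poly" using E by (simp add: poly_eq_0_iff_dvd)
  then show ?thesis unfolding cofactor_def dvd_def by (rule someI_ex)
qed

lemma cofactor_monic: "degree cofactor = 2 * m" "lead_coeff cofactor = 1"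
proof -
  have "cofactor \<noteq> 0" using bloch_poly_factor bloch_poly_monic by auto
  then have "degree bloch_poly = 1 + degree cofactor"
    unfolding bloch_poly_factor by (subst degree_mult_eq) auto
  then show d: "degree cofactor = 2 * m" using bloch_poly_monic q by simp
  have "lead_coeff bloch_poly = lead_coeff cofactor" unfolding bloch_poly_factor by (subst lead_coeff_mult) simp
  then show "lead_coeff cofactor = 1" using bloch_poly_monic by simp
qed

text \<open>A trace of modulus q cannot belong to the zero operator. Any nonzero column is an
  eigenfunction, which shows that every root of \<open>bloch_poly\<close> is an eigenvalue.\<close>

lemma cofactor_nonzero: "\<exists>x. \<exists>n\<in>{0..<int q}. poly_act v cofactor (delta x) n \<noteq> 0"
proof (rule ccontr)
  assume "\<not> ?thesis"
  then have "(\<Sum>n\<in>{0..<int q}. w powi (- int m * n) * poly_act v cofactor (delta (n + int m)) n) = 0"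
    by (intro sum.neutral) auto
  then show False using norm_trace_monic[OF cofactor_monic] q_pos by simp
qed

lemma schr_poly_act_cofactor: "\<phi> \<in> Q \<Longrightarrow> schr v (poly_act v cofactor \<phi>) = (\<lambda>n. E * poly_act v cofactor \<phi> n)"
proof -
  assume "\<phi> \<in> Q"
  then have "poly_act v ([:- E, 1:] * cofactor) \<phi> = (\<lambda>_. 0)" using poly_act_bloch_poly bloch_poly_factor by simp
  then show ?thesis unfolding poly_act_mult poly_act_linear by (auto simp: fun_eq_iff)
qed

lemma eigenfunction:
  obtains u where "u \<in> Q" "schr v u = (\<lambda>n. E * u n)" "\<exists>n\<in>{0..<int q}. u n \<noteq> 0"
proof -
  obtain x where "\<exists>n\<in>{0..<int q}. poly_act v cofactor (delta x) n \<noteq> 0" using cofactor_nonzero by blast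
  then show ?thesis using that[of "poly_act v cofactor (delta x)"] poly_act_Q[OF delta_Q] schr_poly_act_cofactor[OF delta_Q] by blast
qed

lemma ip_self: "ip \<phi> \<phi> = of_real (\<Sum>n\<in>{0..<int q}. (norm (\<phi> n))\<^sup>2)"
  unfolding ip_def of_real_sum
  by (intro sum.cong refl) (metis complex_norm_square mult.commute of_real_power)

lemma eigenvalue_real: "E \<in> \<real>"
proof -
  obtain u where u: "u \<in> Q" "schr v u = (\<lambda>n. E * u n)" "\<exists>n\<in>{0..<int q}. u n \<noteq> 0"
    by (rule eigenfunction)
  have "cnj E * ip u u = ip (schr v u) u" unfolding u(2) by (simp add: ip_def sum_distrib_left mult_ac)
  also have "\<dots> = ip u (schr v u)" by (rule ip_schr) (use u in auto)
  also have "\<dots> = E * ip u u" unfolding u(2) by (simp add: ip_def sum_distrib_left mult_ac)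
  finally have "(cnj E - E) * ip u u = 0" by (simp add: algebra_simps)
  moreover have "ip u u \<noteq> 0"
  proof -
    have "(\<Sum>n\<in>{0..<int q}. (norm (u n))\<^sup>2) \<noteq> 0"
      using u(3) by (subst sum_nonneg_eq_0_iff) auto
    then show ?thesis unfolding ip_self of_real_eq_0_iff .
  qed
  ultimately show ?thesis by (simp add: Reals_cnj_iff)
qed

text \<open>The eigenvalue equation at a point where the eigenfunction has maximal modulus: two
  neighbours and a potential bounded by 2 contribute 4.\<close>

lemma norm_eigenvalue_le: "norm E \<le> 4"
proof -
  obtain u where u: "u \<in> Q" "schr v u = (\<lambda>n. E * u n)" "\<exists>n\<in>{0..<int q}. u n \<noteq> 0"
    by (rule eigenfunction)
  define B where "B = Max ((\<lambda>n. norm (u n)) ` {0..<int q})"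
  have Bn: "norm (u n) \<le> B" for n
  proof -
    have "n mod int q \<in> {0..<int q}" using q_pos by simp
    then have "norm (u (n mod int q)) \<le> B" unfolding B_def by (intro Max_ge) auto
    then show ?thesis using norm_Q_mod[OF u(1)] by simp
  qed
  have "B \<in> (\<lambda>n. norm (u n)) ` {0..<int q}"
    unfolding B_def using q_pos by (intro Max_in) auto
  then obtain n where n: "norm (u n) = B" by auto
  have B0: "B > 0"
  proof -
    obtain k where "u k \<noteq> 0" using u(3) by blast
    then show ?thesis using Bn[of k] by (metis norm_le_zero_iff not_le order.trans)
  qed
  have vn: "\<bar>v n\<bar> \<le> 2"
  proof -
    have "norm (complex_of_real (v n)) \<le> norm (w powi n * y) + norm (inverse (w powi n * y))"
      unfolding v by (rule norm_triangle_ineq)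
    also have "\<dots> = 2" using w y by (simp add: norm_mult norm_inverse norm_power_int)
    finally show ?thesis by simp
  qed
  have "norm E * B = norm (schr v u n)" unfolding u(2) by (simp add: norm_mult n)
  also have "\<dots> \<le> norm (u (n - 1)) + norm (u (n + 1)) + norm (complex_of_real (v n) * u n)"
    unfolding schr_def by (intro norm_triangle_le add_mono norm_triangle_ineq order.refl)
  also have "\<dots> \<le> B + B + 2 * B"
    using vn B0 n by (intro add_mono Bn) (auto simp: norm_mult intro!: mult_right_mono)
  finally show ?thesis using B0 by simp
qed

lemma ip_delta:
  assumes \<phi>: "\<phi> \<in> Q"
  shows "ip (delta x) \<phi> = \<phi> x"
proof -
  define r where "r = x mod int q"
  have r: "r \<in> {0..<int q}" using q_pos by (simp add: r_def)
  have d: "delta x n = (if n = r then z powi (- (x div int q)) else 0)" if n: "n \<in> {0..<int q}" for n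
  proof -
    have nx: "r = x - int q * (x div int q)" by (simp add: r_def minus_mult_div_eq_mod)
    have "int q dvd n - x \<longleftrightarrow> n = r"
    proof
      assume "int q dvd n - x"
      then have "n mod int q = x mod int q" by (simp add: mod_eq_dvd_iff)
      then show "n = r" using n by (simp add: r_def)
    next
      assume "n = r"
      then have "n - x = int q * (- (x div int q))" using nx by simp
      then show "int q dvd n - x" by (rule dvdI)
    qed
    moreover have "(n - x) div int q = - (x div int q)" if "n = r"
    proof -
      have "n - x = int q * (- (x div int q))" using nx that by simp
      then show ?thesis using q_pos by (simp only:) (rule nonzero_mult_div_cancel_left, simp)
    qed
    ultimately show ?thesis unfolding delta_def by simp
  qed
  have sh: "\<phi> (n + int q * k) = z powi k * \<phi> n" for n k
  proof (induction k rule: int_induct[where k = 0])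
    case (step1 i)
    have "\<phi> (n + int q * (i + 1)) = \<phi> (n + int q * i + int q)" by (simp add: algebra_simps)
    also have "\<dots> = z * (z powi i * \<phi> n)" using \<phi> step1 by (simp add: Q_def)
    finally show ?case using nonzero by (simp add: power_int_add)
  next
    case (step2 i)
    have "\<phi> (n + int q * (i - 1) + int q) = z * \<phi> (n + int q * (i - 1))" using \<phi> by (simp add: Q_def)
    then have "z powi i * \<phi> n = z * \<phi> (n + int q * (i - 1))" using step2 by (simp add: algebra_simps)
    then show ?case using nonzero by (simp add: power_int_diff field_simps)
  qed simp
  have c: "cnj z powi (- k) = z powi k" for k
  proof -
    have "cnj z = inverse z" using cnj_z by (metis inverse_unique mult.commute)
    then show ?thesis by (simp add: power_int_minus power_int_inverse)
  qed
  have "ip (delta x) \<phi> = (\<Sum>n\<in>{0..<int q}. if n = r then z powi (x div int q) * \<phi> r else 0)"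
    unfolding ip_def by (intro sum.cong refl) (simp add: d c)
  also have "\<dots> = z powi (x div int q) * \<phi> r" using r by simp
  also have "\<dots> = \<phi> (r + int q * (x div int q))" by (simp add: sh)
  also have "r + int q * (x div int q) = x" by (simp add: r_def)
  finally show "ip (delta x) \<phi> = \<phi> x" .
qed

text \<open>On the real line away from \<open>E\<close>, division by the real factor
  \<open>x - E\<close> expresses the values as quotients of real numbers. Real coefficients make the
  corresponding polynomial in the operator self-adjoint.\<close>

lemma cofactor_real: "map_poly cnj cofactor = cofactor"
proof (rule real_poly_of_infinite)
  show "infinite (UNIV - {Re E})" by (simp add: infinite_UNIV_char_0)
  fix x assume "x \<in> UNIV - {Re E}"
  then have x: "of_real x - E \<noteq> 0" using eigenvalue_real by (auto simp: complex_is_Real_iff complex_eq_iff)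
  have "(of_real x - E) * poly cofactor (of_real x) = poly trace_poly (of_real x) - (z + inverse z)"
    using arg_cong[OF bloch_poly_factor, of "\<lambda>f. poly f (of_real x)"] by (simp add: bloch_poly_def algebra_simps)
  then have "poly cofactor (of_real x) = (poly trace_poly (of_real x) - (z + inverse z)) / (of_real x - E)"
    using x by (simp add: field_simps)
  then show "poly cofactor (of_real x) \<in> \<real>"
    using poly_trace_poly_real z_inverse_real eigenvalue_real by (metis Reals_diff Reals_divide Reals_of_real)
qed

lemma poly_act_eigen: "schr v u = (\<lambda>n. E * u n) \<Longrightarrow> poly_act v f u = (\<lambda>n. poly f E * u n)"
proof (induction f)
  case (pCons a f)
  then show ?case by (simp only: poly_act_pCons schr_scale pCons.IH) (simp add: algebra_simps)
qed simp

text \<open>The column \<open>a\<close> is an eigenfunction, so by self-adjointness its squared norm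
  \<open>N\<close> has the value |\<open>poly cofactor E\<close>| |\<open>a x\<close>|. Since
  |\<open>a x\<close>|^2 \<le> \<open>N\<close>, first \<open>a x\<close> and then \<open>N\<close>
  are controlled by \<open>poly cofactor E\<close>.\<close>

lemma norm_poly_act_cofactor_delta: "norm (poly_act v cofactor (delta x) n) \<le> norm (poly cofactor E)"
proof -
  define a where "a = poly_act v cofactor (delta x)"
  define N where "N = (\<Sum>n\<in>{0..<int q}. (norm (a n))\<^sup>2)"
  have aQ: "a \<in> Q" unfolding a_def by (intro poly_act_Q delta_Q)
  have el: "(norm (a n))\<^sup>2 \<le> N" for n
  proof -
    have "n mod int q \<in> {0..<int q}" using q_pos by simp
    then have "(norm (a (n mod int q)))\<^sup>2 \<le> N" unfolding N_def by (intro member_le_sum) auto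
    then show ?thesis using norm_Q_mod[OF aQ] by simp
  qed
  have "of_real N = ip a a" by (simp add: N_def ip_self)
  also have "\<dots> = ip (delta x) (poly_act v cofactor a)"
    unfolding a_def by (subst ip_poly_act) (auto simp: cofactor_real intro!: poly_act_Q delta_Q)
  also have "\<dots> = poly_act v cofactor a x" by (intro ip_delta poly_act_Q aQ)
  also have "poly_act v cofactor a x = poly cofactor E * a x"
    using poly_act_eigen[OF schr_poly_act_cofactor[OF delta_Q]] by (simp add: a_def)
  finally have "norm (complex_of_real N) = norm (poly cofactor E) * norm (a x)" by (simp add: norm_mult)
  moreover have "N \<ge> 0" unfolding N_def by (intro sum_nonneg) auto
  ultimately have N: "N = norm (poly cofactor E) * norm (a x)" by simp
  have "norm (a x) \<le> norm (poly cofactor E)"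
  proof (cases "norm (a x) = 0")
    case False
    then show ?thesis using el[of x] N by (simp add: power2_eq_square)
  qed simp
  then have "N \<le> (norm (poly cofactor E))\<^sup>2" unfolding N power2_eq_square by (intro mult_left_mono) auto
  then have "(norm (a n))\<^sup>2 \<le> (norm (poly cofactor E))\<^sup>2" using el[of n] by linarith
  then show ?thesis unfolding a_def by (rule power2_le_imp_le) simp
qed

text \<open>A sum of q matrix entries with unimodular weights has modulus q, and no entry exceeds
  \<open>poly cofactor E\<close>, which is the derivative at the root.\<close>

lemma norm_pderiv_bloch_poly: "1 \<le> norm (poly (pderiv bloch_poly) E)"
proof -
  have "real q = norm (\<Sum>n\<in>{0..<int q}. w powi (- int m * n) * poly_act v cofactor (delta (n + int m)) n)"
    using norm_trace_monic[OF cofactor_monic] by simp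
  also have "\<dots> \<le> (\<Sum>n\<in>{0..<int q}. norm (poly cofactor E))"
    by (rule sum_norm_le) (use w norm_poly_act_cofactor_delta in \<open>simp add: norm_mult norm_power_int\<close>)
  also have "\<dots> = real q * norm (poly cofactor E)" by simp
  finally have "1 \<le> norm (poly cofactor E)" using q_pos by simp
  moreover have "poly (pderiv bloch_poly) E = poly cofactor E"
    unfolding bloch_poly_factor pderiv_mult by (simp add: pderiv_pCons)
  ultimately show ?thesis by simp
qed

end

end

section \<open>The discriminant as a polynomial and its level sets\<close>

definition disc_poly :: "nat \<Rightarrow> nat \<Rightarrow> complex poly" where
  "disc_poly p q = - transfer_trace (map (\<lambda>k. [: - complex_of_real (2 * cos (2 * pi * real k * real p / real q + pi / (2 * real q))), 1 :]) [1..<Suc q])"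

lemma poly_disc_poly_real: "poly (disc_poly p q) (of_real x) = of_real (discriminant p q x)"
proof -
  have "poly (disc_poly p q) (of_real x) = - transfer_trace (map complex_of_real
     (map (\<lambda>k. x - 2 * cos (2 * pi * real k * real p / real q + pi / (2 * real q))) [1..<Suc q]))"
    by (simp add: disc_poly_def poly_transfer_trace o_def del: upt_Suc)
  also have "\<dots> = - of_real (transfer_trace (map (\<lambda>k. x - 2 * cos (2 * pi * real k * real p / real q + pi / (2 * real q))) [1..<Suc q]))"
    by (simp only: transfer_trace_of_real)
  finally show ?thesis by (simp add: discriminant_eq_transfer_trace del: upt_Suc)
qed

lemma disc_poly_monic:
  assumes "q > 0"
  shows "degree (disc_poly p q) = q" "coeff (disc_poly p q) q = -1"
proof -
  have e: "disc_poly p q = - transfer_trace (map (\<lambda>v. [:- v, 1:]) (map (\<lambda>k. complex_of_real (2 * cos (2 * pi * real k * real p / real q + pi / (2 * real q)))) [1..<Suc q]))"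
    by (simp add: disc_poly_def o_def del: upt_Suc)
  show "degree (disc_poly p q) = q" "coeff (disc_poly p q) q = -1"
    unfolding e
    using transfer_trace_linear_monic[of "map (\<lambda>k. complex_of_real (2 * cos (2 * pi * real k * real p / real q + pi / (2 * real q)))) [1..<Suc q]"] assms
    by (simp_all add: o_def del: upt_Suc)
qed

lemma two_cos_cis: "complex_of_real (2 * cos a) = cis a + inverse (cis a)"
  by (simp add: complex_eq_iff)

definition unit_root :: "nat \<Rightarrow> nat \<Rightarrow> complex" where
  "unit_root p q = cis (2 * pi * real p / real q)"

lemma unit_root_power: "unit_root p q ^ k = cis (2 * pi * real k * real p / real q)"
  unfolding unit_root_def Complex.DeMoivre by (simp add: mult_ac)

lemma unit_root_root:
  assumes "q > 0" "coprime p q"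
  shows "unit_root p q ^ q = 1" "0 < i \<Longrightarrow> i < q \<Longrightarrow> unit_root p q ^ i \<noteq> 1"
proof -
  show "unit_root p q ^ q = 1"
  proof -
    have "2 * pi * real q * real p / real q = 2 * pi * real p" using assms(1) by simp
    then show ?thesis unfolding unit_root_power by (simp only:) (rule cis_multiple_2pi, simp)
  qed
  assume i: "0 < i" "i < q"
  show "unit_root p q ^ i \<noteq> 1"
  proof
    assume a: "unit_root p q ^ i = 1"
    have "unit_root p q ^ i = exp (2 * of_real pi * \<i> * of_nat (i * p) / of_nat q)"
      unfolding unit_root_power cis_conv_exp by (simp add: mult_ac)
    then have "q dvd i * p" using complex_root_unity_eq_1[of q "i * p"] a assms(1) by simp
    then have "q dvd i" using assms(2) by (simp add: coprime_commute coprime_dvd_mult_left_iff)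
    then show False using i by (simp add: nat_dvd_not_less)
  qed
qed

text \<open>The constant in the Chambers relation is found at the phase \<pi>/(2q) built into the
  discriminant: there \<open>y ^ q\<close> is the imaginary unit, so
  \<open>y ^ q + inverse (y ^ q)\<close> vanishes.\<close>

lemma transfer_trace_unit_root:
  assumes q: "odd q" and co: "coprime p q" and y: "y \<noteq> 0"
  shows "transfer_trace (map (\<lambda>k. E - (unit_root p q ^ k * y + inverse (unit_root p q ^ k * y))) [1..<Suc q])
    = - poly (disc_poly p q) E - (y ^ q + inverse (y ^ q))"
proof -
  have q0: "q > 0" using q by (cases q) auto
  obtain B where B: "\<And>y. y \<noteq> 0 \<Longrightarrow>
      transfer_trace (map (\<lambda>k. E - (unit_root p q ^ k * y + inverse (unit_root p q ^ k * y))) [1..<Suc q]) = B - (y ^ q + inverse (y ^ q))"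
    using chambers[OF q unit_root_root[OF q0 co], of E] by blast
  define y0 where "y0 = cis (pi / (2 * real q))"
  have "y0 ^ q = cis (real q * (pi / (2 * real q)))" unfolding y0_def by (rule Complex.DeMoivre)
  also have "real q * (pi / (2 * real q)) = pi / 2" using q0 by simp
  finally have y0q: "y0 ^ q = \<i>" by simp
  have "unit_root p q ^ k * y0 + inverse (unit_root p q ^ k * y0)
      = complex_of_real (2 * cos (2 * pi * real k * real p / real q + pi / (2 * real q)))" for k
    unfolding unit_root_power y0_def cis_mult two_cos_cis ..
  then have "- poly (disc_poly p q) E = transfer_trace (map (\<lambda>k. E - (unit_root p q ^ k * y0 + inverse (unit_root p q ^ k * y0))) [1..<Suc q])"
    by (simp add: disc_poly_def poly_transfer_trace o_def del: upt_Suc)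
  also have "\<dots> = B" using B[of y0] y0q by (simp add: y0_def cis_neq_zero)
  finally show ?thesis using B[OF y] by simp
qed

abbreviation potential :: "nat \<Rightarrow> nat \<Rightarrow> real \<Rightarrow> int \<Rightarrow> real" where
  "potential p q \<theta> \<equiv> (\<lambda>n. 2 * cos (2 * pi * (real p / real q * of_int n + \<theta>)))"

lemma bloch_unit_root:
  assumes q: "odd q" and co: "coprime p q" and "norm z = 1"
  shows "bloch q (q div 2) (unit_root p q) (cis (2 * pi * \<theta>)) z (potential p q \<theta>)"
proof
  have q0: "q > 0" using q by (cases q) auto
  show "q = 2 * (q div 2) + 1" using q by simp
  show "unit_root p q ^ q = 1" "\<And>i. 0 < i \<Longrightarrow> i < q \<Longrightarrow> unit_root p q ^ i \<noteq> 1" using unit_root_root[OF q0 co] by auto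
  show "cmod (unit_root p q) = 1" by (simp add: unit_root_def)
  show "complex_of_real (2 * cos (2 * pi * (real p / real q * real_of_int n + \<theta>))) =
         unit_root p q powi n * cis (2 * pi * \<theta>) + inverse (unit_root p q powi n * cis (2 * pi * \<theta>))" for n
    unfolding two_cos_cis unit_root_def cis_power_int cis_mult
    by (simp add: algebra_simps)
qed (use assms in auto)

lemma (in bloch) bloch_poly_eq_disc_poly:
  assumes "w = unit_root p q" "coprime p q"
  shows "bloch_poly = - disc_poly p q - [:y ^ q + inverse (y ^ q) + (z + inverse z):]"
proof -
  have "odd q" using q by simp
  have "poly trace_poly E = - poly (disc_poly p q) E - (y ^ q + inverse (y ^ q))" for E
  proof -
    have "poly trace_poly E = transfer_trace (map (\<lambda>i. E - complex_of_real (v (1 + int i))) [0..<q])"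
      by (simp add: trace_poly_def poly_transfer_trace linear_factors_def o_def)
    also have "map (\<lambda>i. E - complex_of_real (v (1 + int i))) [0..<q]
       = map (\<lambda>k. E - (w ^ k * y + inverse (w ^ k * y))) [1..<Suc q]"
    proof -
      have "w powi (1 + int i) = w ^ Suc i" for i by (metis of_nat_Suc power_int_of_nat)
      then show ?thesis
        unfolding v by (simp add: map_Suc_upt[symmetric] o_def del: upt_Suc map_Suc_upt power_Suc)
    qed
    also have "transfer_trace \<dots> = - poly (disc_poly p q) E - (y ^ q + inverse (y ^ q))"
      unfolding assms(1) by (rule transfer_trace_unit_root) (use \<open>odd q\<close> assms nonzero in auto)
    finally show ?thesis .
  qed
  then have "poly bloch_poly = poly (- disc_poly p q - [:y ^ q + inverse (y ^ q) + (z + inverse z):])"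
    by (auto simp: bloch_poly_def fun_eq_iff)
  then show ?thesis by (simp only: poly_eq_poly_eq_iff)
qed

text \<open>Splitting \<open>c\<close> evenly between the two quasi-momenta makes both of them real.\<close>

lemma exists_bloch:
  assumes q: "odd q" and co: "coprime p q" and c: "\<bar>c\<bar> \<le> 4" "poly (disc_poly p q) E = of_real c"
  obtains \<theta> z where "\<theta> \<in> {0<..1}" "norm z = 1" 
    "bloch q (q div 2) (unit_root p q) (cis (2 * pi * \<theta>)) z (potential p q \<theta>)"
    "- disc_poly p q - [:of_real (- c):] = bloch.bloch_poly q z (potential p q \<theta>)"
proof -
  have q0: "q > 0" using q by (cases q) auto
  \<comment> \<open>Both quasi-momenta contribute \<open>2 * cos \<kappa>\<close>, and the two
    together have to give \<open>- c\<close>. The reflection \<open>2 * pi - arccos\<close> keeps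
    \<theta> positive even when the arccosine is 0.\<close>
  define \<kappa> where "\<kappa> = 2 * pi - arccos (- c / 4)"
  have \<kappa>: "0 < \<kappa>" "\<kappa> \<le> 2 * pi" "cos \<kappa> = - c / 4"
  proof -
    have "0 \<le> arccos (- c / 4)" "arccos (- c / 4) \<le> pi"
      using c(1) by (auto intro!: arccos_lbound arccos_ubound)
    then show "0 < \<kappa>" "\<kappa> \<le> 2 * pi" using pi_gt_zero by (auto simp: \<kappa>_def simp del: pi_gt_zero)
    show "cos \<kappa> = - c / 4" unfolding \<kappa>_def using c(1) by (simp add: cos_diff)
  qed
  define \<theta> where "\<theta> = \<kappa> / (2 * pi * real q)"
  define z where "z = cis \<kappa>"
  have "2 * pi * real q \<ge> 2 * pi" using q0 by simp
  then have \<theta>: "\<theta> \<in> {0<..1}" using \<kappa> q0 unfolding \<theta>_def by (auto simp: divide_le_eq intro: order.trans)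
  have z: "norm z = 1" by (simp add: z_def)
  note B = bloch_unit_root[OF q co z, of \<theta>]
  have "cis (2 * pi * \<theta>) ^ q = z"
    unfolding Complex.DeMoivre z_def using q0 by (simp add: \<theta>_def)
  moreover have "z + inverse z = of_real (- c / 2)"
    using two_cos_cis[of \<kappa>] \<kappa>(3) by (simp add: z_def)
  ultimately have "- disc_poly p q - [:of_real (- c):] = bloch.bloch_poly q z (potential p q \<theta>)"
    using bloch.bloch_poly_eq_disc_poly[OF B refl co] by simp
  then show ?thesis using that[OF \<theta> z B] by blast
qed

text \<open>A complex root at such a level is an eigenvalue of one of the self-adjoint operators
  above, so their three properties carry over.\<close>

lemma disc_poly_level:
  assumes q: "odd q" and co: "coprime p q" and c: "\<bar>c\<bar> \<le> 4" "poly (disc_poly p q) E = of_real c"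
  shows "E \<in> \<real>" "norm E \<le> 4" "1 \<le> norm (poly (pderiv (disc_poly p q)) E)"
proof -
  obtain \<theta> z where B: "bloch q (q div 2) (unit_root p q) (cis (2 * pi * \<theta>)) z (potential p q \<theta>)"
    and bloch_poly: "- disc_poly p q - [:of_real (- c):] = bloch.bloch_poly q z (potential p q \<theta>)"
    by (rule exists_bloch[OF q co c])
  have 0: "poly (bloch.bloch_poly q z (potential p q \<theta>)) E = 0"
    unfolding bloch_poly[symmetric] using c by simp
  show "E \<in> \<real>" "norm E \<le> 4"
    using bloch.eigenvalue_real[OF B 0] bloch.norm_eigenvalue_le[OF B 0] by auto
  have "1 \<le> norm (poly (pderiv (- disc_poly p q - [:of_real (- c):])) E)"
    using bloch.norm_pderiv_bloch_poly[OF B 0] unfolding bloch_poly .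
  then show "1 \<le> norm (poly (pderiv (disc_poly p q)) E)"
    by (simp add: pderiv_diff pderiv_minus pderiv_pCons)
qed

section \<open>The spectrum on the integer lattice\<close>

text \<open>Bounding all finite sections expresses membership in \<open>l2_space\<close> together
  with a norm bound, and survives pointwise limits.\<close>

definition l2_le :: "(int \<Rightarrow> complex) \<Rightarrow> real \<Rightarrow> bool" where
  "l2_le \<phi> B \<longleftrightarrow> (\<forall>F. finite F \<longrightarrow> L2_set (\<lambda>n. norm (\<phi> n)) F \<le> B)"

lemma l2_le_nonneg: "l2_le \<phi> B \<Longrightarrow> 0 \<le> B"
  unfolding l2_le_def by (metis L2_set_empty finite.emptyI)

lemma l2_le_norm: "\<phi> \<in> l2_space \<Longrightarrow> l2_le \<phi> (l2_norm \<phi>)"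
  unfolding l2_le_def l2_norm_def L2_set_def l2_space_def
  by (auto intro!: real_sqrt_le_mono finite_sum_le_infsum)

lemma l2_le_imp:
  assumes "l2_le \<phi> B"
  shows "\<phi> \<in> l2_space" "l2_norm \<phi> \<le> B"
proof -
  have B: "0 \<le> B" using assms by (rule l2_le_nonneg)
  have s: "(\<Sum>n\<in>F. (norm (\<phi> n))\<^sup>2) \<le> B\<^sup>2" if "finite F" for F
  proof -
    have "sqrt (\<Sum>n\<in>F. (norm (\<phi> n))\<^sup>2) \<le> B" using assms that by (auto simp: l2_le_def L2_set_def)
    then show ?thesis by (simp add: sqrt_le_D)
  qed
  have sm: "(\<lambda>n. (norm (\<phi> n))\<^sup>2) summable_on UNIV"
    by (rule nonneg_bdd_above_summable_on) (use s in \<open>auto simp: bdd_above_def\<close>)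
  then show "\<phi> \<in> l2_space" by (simp add: l2_space_def)
  have "(\<Sum>\<^sub>\<infinity>n. (norm (\<phi> n))\<^sup>2) \<le> B\<^sup>2"
    by (rule infsum_le_finite_sums[OF sm]) (use s in auto)
  then show "l2_norm \<phi> \<le> B" unfolding l2_norm_def using B by (simp add: real_le_lsqrt)
qed

lemma l2_le_add: "l2_le \<phi> A \<Longrightarrow> l2_le \<psi> B \<Longrightarrow> l2_le (\<lambda>n. \<phi> n + \<psi> n) (A + B)"
  unfolding l2_le_def
proof (intro allI impI)
  fix F :: "int set" assume a: "\<forall>F. finite F \<longrightarrow> L2_set (\<lambda>n. norm (\<phi> n)) F \<le> A"
    "\<forall>F. finite F \<longrightarrow> L2_set (\<lambda>n. norm (\<psi> n)) F \<le> B" and F: "finite F"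
  have "L2_set (\<lambda>n. norm (\<phi> n + \<psi> n)) F \<le> L2_set (\<lambda>n. norm (\<phi> n) + norm (\<psi> n)) F"
    by (intro L2_set_mono norm_triangle_ineq) auto
  also have "\<dots> \<le> L2_set (\<lambda>n. norm (\<phi> n)) F + L2_set (\<lambda>n. norm (\<psi> n)) F" by (rule L2_set_triangle_ineq)
  finally show "L2_set (\<lambda>n. norm (\<phi> n + \<psi> n)) F \<le> A + B" using a F by (meson add_mono order.trans)
qed

lemma l2_le_mult:
  assumes "\<And>n. norm (b n) \<le> c" "l2_le \<phi> A"
  shows "l2_le (\<lambda>n. b n * \<phi> n) (c * A)"
  unfolding l2_le_def
proof (intro allI impI)
  fix F :: "int set" assume F: "finite F"
  have c: "0 \<le> c" using assms(1)[of 0] norm_ge_zero order.trans by blast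
  have "L2_set (\<lambda>n. norm (b n * \<phi> n)) F \<le> L2_set (\<lambda>n. c * norm (\<phi> n)) F"
    by (intro L2_set_mono) (auto simp: norm_mult intro!: mult_right_mono assms)
  also have "\<dots> = c * L2_set (\<lambda>n. norm (\<phi> n)) F" using c by (simp add: L2_set_right_distrib)
  also have "\<dots> \<le> c * A" using assms(2) F c by (intro mult_left_mono) (auto simp: l2_le_def)
  finally show "L2_set (\<lambda>n. norm (b n * \<phi> n)) F \<le> c * A" .
qed

lemma l2_le_shift: "l2_le \<phi> A \<Longrightarrow> l2_le (\<lambda>n. \<phi> (n + k)) A"
  unfolding l2_le_def
proof (intro allI impI)
  fix F :: "int set" assume a: "\<forall>F. finite F \<longrightarrow> L2_set (\<lambda>n. norm (\<phi> n)) F \<le> A" and F: "finite F"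
  have "L2_set (\<lambda>n. norm (\<phi> (n + k))) F = L2_set (\<lambda>n. norm (\<phi> n)) ((\<lambda>n. n + k) ` F)"
    unfolding L2_set_def by (subst sum.reindex) (auto simp: inj_on_def)
  then show "L2_set (\<lambda>n. norm (\<phi> (n + k))) F \<le> A" using a F by simp
qed

lemma l2_le_point: "l2_le \<phi> A \<Longrightarrow> norm (\<phi> n) \<le> A"
proof -
  assume "l2_le \<phi> A"
  then have "L2_set (\<lambda>n. norm (\<phi> n)) {n} \<le> A" unfolding l2_le_def by blast
  then show ?thesis by (simp add: L2_set_def)
qed

lemma l2_le_schr:
  assumes "\<And>n. \<bar>v n\<bar> \<le> 2" "l2_le \<phi> A"
  shows "l2_le (schr v \<phi>) (4 * A)"
proof -
  have "l2_le (\<lambda>n. \<phi> (n + (- 1)) + \<phi> (n + 1) + complex_of_real (v n) * \<phi> n) (A + A + 2 * A)"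
    using assms by (intro l2_le_add l2_le_mult l2_le_shift) auto
  then show ?thesis by (simp add: schr_def)
qed

lemma l2_le_poly_act:
  assumes v: "\<And>n. \<bar>v n\<bar> \<le> 2"
  shows "\<exists>C\<ge>0. \<forall>\<phi> A. l2_le \<phi> A \<longrightarrow> l2_le (poly_act v f \<phi>) (C * A)"
proof (induction f)
  case 0
  then show ?case by (intro exI[of _ 0]) (auto simp: l2_le_def L2_set_def)
next
  case (pCons a f)
  then obtain C where C: "C \<ge> 0" "\<And>\<phi> A. l2_le \<phi> A \<Longrightarrow> l2_le (poly_act v f \<phi>) (C * A)" by blast
  have "l2_le (poly_act v (pCons a f) \<phi>) ((norm a + 4 * C) * A)" if "l2_le \<phi> A" for \<phi> A
  proof -
    have "l2_le (\<lambda>n. a * \<phi> n + schr v (poly_act v f \<phi>) n) (norm a * A + 4 * (C * A))"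
      using that v C by (intro l2_le_add l2_le_mult l2_le_schr) auto
    then show ?thesis by (simp add: poly_act_pCons algebra_simps)
  qed
  then show ?case using C(1) by (intro exI[of _ "norm a + 4 * C"]) auto
qed

text \<open>The Neumann series for the inverse of 1 minus \<rho> times the shift by
  \<open>d\<close>.\<close>

lemma l2_le_geometric:
  fixes \<rho> :: complex and d :: int
  assumes \<rho>: "norm \<rho> < 1" and \<psi>: "l2_le \<psi> B"
  shows "\<exists>\<phi>. l2_le \<phi> (B / (1 - norm \<rho>)) \<and> (\<forall>n. \<phi> n - \<rho> * \<phi> (n - d) = \<psi> n)"
proof -
  define \<phi> where "\<phi> n = (\<Sum>k. \<rho> ^ k * \<psi> (n - d * int k))" for n
  have B: "0 \<le> B" using \<psi> by (rule l2_le_nonneg)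
  have sm: "summable (\<lambda>k. \<rho> ^ k * \<psi> (n - d * int k))" for n
  proof (rule summable_comparison_test')
    show "summable (\<lambda>k. norm \<rho> ^ k * B)" using \<rho> by (intro summable_mult2 summable_geometric) auto
    show "norm (\<rho> ^ k * \<psi> (n - d * int k)) \<le> norm \<rho> ^ k * B" if "k \<ge> 0" for k
      using l2_le_point[OF \<psi>] by (simp add: norm_mult norm_power mult_left_mono)
  qed
  have rec: "\<phi> n - \<rho> * \<phi> (n - d) = \<psi> n" for n
  proof -
    have "\<phi> n = \<psi> n + (\<Sum>k. \<rho> ^ Suc k * \<psi> (n - d * int (Suc k)))"
      unfolding \<phi>_def using suminf_split_head[OF sm[of n]] by simp
    also have "(\<Sum>k. \<rho> ^ Suc k * \<psi> (n - d * int (Suc k))) = (\<Sum>k. \<rho> * (\<rho> ^ k * \<psi> (n - d - d * int k)))"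
      by (simp add: algebra_simps)
    also have "\<dots> = \<rho> * \<phi> (n - d)" unfolding \<phi>_def by (rule suminf_mult[OF sm])
    finally show ?thesis by simp
  qed
  have "l2_le \<phi> (B / (1 - norm \<rho>))"
    unfolding l2_le_def
  proof (intro allI impI)
    fix F :: "int set" assume F: "finite F"
    define S where "S N n = (\<Sum>k<N. \<rho> ^ k * \<psi> (n - d * int k))" for N n
    have part: "l2_le (S N) (\<Sum>k<N. norm \<rho> ^ k * B)" for N
    proof (induction N)
      case 0
      then show ?case by (simp add: S_def l2_le_def L2_set_def)
    next
      case (Suc N)
      have "l2_le (\<lambda>n. S N n + \<rho> ^ N * \<psi> (n + (- d * int N))) ((\<Sum>k<N. norm \<rho> ^ k * B) + norm \<rho> ^ N * B)"
        by (intro l2_le_add Suc l2_le_mult l2_le_shift \<psi>) (simp add: norm_power)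
      then show ?case by (simp add: S_def)
    qed
    have geo: "(\<Sum>k<N. norm \<rho> ^ k * B) \<le> B / (1 - norm \<rho>)" for N
    proof -
      have "(\<Sum>k<N. norm \<rho> ^ k) \<le> (\<Sum>k. norm \<rho> ^ k)"
        using \<rho> by (intro sum_le_suminf summable_geometric) auto
      also have "\<dots> = 1 / (1 - norm \<rho>)" using \<rho> by (intro suminf_geometric) auto
      finally have "(\<Sum>k<N. norm \<rho> ^ k) * B \<le> 1 / (1 - norm \<rho>) * B" using B by (rule mult_right_mono)
      then show ?thesis by (simp add: sum_distrib_right)
    qed
    \<comment> \<open>On a finite set, pointwise convergence of the partial sums is enough to pass
      their uniform bound to the limit.\<close>
    have "(\<lambda>N. L2_set (\<lambda>n. norm (S N n)) F) \<longlonglongrightarrow> L2_set (\<lambda>n. norm (\<phi> n)) F"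
      unfolding L2_set_def S_def \<phi>_def
      by (intro tendsto_intros summable_LIMSEQ sm)
    moreover have "L2_set (\<lambda>n. norm (S N n)) F \<le> B / (1 - norm \<rho>)" for N
      using part[of N] geo[of N] F unfolding l2_le_def by (meson order.trans)
    ultimately show "L2_set (\<lambda>n. norm (\<phi> n)) F \<le> B / (1 - norm \<rho>)"
      by (intro LIMSEQ_le_const2) auto
  qed
  then show ?thesis using rec by blast
qed

text \<open>The root of \<rho> + 1/\<rho> = t inside the unit disc. For an invertible shift S, the
  operator \<rho> (t - S - 1/S) factors as (1 - \<rho> S) (1 - \<rho>/S), and both factors are
  invertible by Neumann series.\<close>

lemma joukowski:
  fixes t :: real
  assumes "\<bar>t\<bar> > 2"
  obtains \<rho> where "\<bar>\<rho>\<bar> < 1" "\<rho> \<noteq> 0" "1 + \<rho> * \<rho> = \<rho> * t"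
proof -
  have pos: "\<exists>\<rho>. \<bar>\<rho>\<bar> < 1 \<and> \<rho> \<noteq> 0 \<and> 1 + \<rho> * \<rho> = \<rho> * t" if "t > 2" for t :: real
  proof -
    define s where "s = sqrt (t\<^sup>2 - 4)"
    have "(2::real)\<^sup>2 < t\<^sup>2" using that by (intro power_strict_mono) auto
    then have s: "s * s = t\<^sup>2 - 4" "s \<ge> 0" unfolding s_def by auto
    have "s < t" unfolding s_def using that by (intro real_less_lsqrt) auto
    moreover have "t - 2 < s" unfolding s_def using that by (intro real_less_rsqrt) (simp add: power2_eq_square algebra_simps)
    ultimately show ?thesis using s
      by (intro exI[of _ "(t - s) / 2"]) (auto simp: field_simps power2_eq_square)
  qed
  show ?thesis
  proof (cases "t > 2")
    case True
    then show ?thesis using pos that by blast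
  next
    case False
    then have "- t > 2" using assms by auto
    then obtain \<rho> where "\<bar>\<rho>\<bar> < 1 \<and> \<rho> \<noteq> 0 \<and> 1 + \<rho> * \<rho> = \<rho> * (- t)" using pos by blast
    then show ?thesis using that[of "- \<rho>"] by auto
  qed
qed

text \<open>Let f be the trace polynomial minus t and f = (X - E) L. Applied to the operator H, f
  gives the sum of the two shifts by q minus t, which is invertible for |t| > 2. Composing its
  inverse with L(H) inverts H - E.\<close>

lemma l2_resolvent:
  fixes v :: "int \<Rightarrow> real"
  assumes per: "\<And>n. v (n + int q) = v n" and v: "\<And>n. \<bar>v n\<bar> \<le> 2"
    and t: "poly (transfer_trace (linear_factors v 0 q)) E = of_real t" "\<bar>t\<bar> > 2"
  shows "E \<in> l2_resolvent_set (schr v)"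
proof -
  define f where "f = transfer_trace (linear_factors v 0 q) - [:of_real t:]"
  have "poly f E = 0" using t by (simp add: f_def)
  then obtain L where L: "f = [:- E, 1:] * L" by (auto simp: poly_eq_0_iff_dvd dvd_def)
  define R where "R \<phi> = (\<lambda>n. schr v \<phi> n - E * \<phi> n)" for \<phi>
  have R: "R \<phi> = poly_act v [:- E, 1:] \<phi>" for \<phi> by (simp add: R_def poly_act_linear)
  have f: "poly_act v f \<phi> n = \<phi> (n - int q) + \<phi> (n + int q) - of_real t * \<phi> n" for \<phi> n
    using poly_act_transfer_trace[of v q \<phi> n, OF per] by (simp add: f_def poly_act_diff)
  have fRL: "poly_act v f \<phi> = R (poly_act v L \<phi>)" "poly_act v f \<phi> = poly_act v L (R \<phi>)" for \<phi>
    unfolding R by (simp_all only: L poly_act_mult[symmetric] mult.commute)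
  obtain C where C: "C \<ge> 0" "\<And>\<phi> A. l2_le \<phi> A \<Longrightarrow> l2_le (poly_act v L \<phi>) (C * A)"
    using l2_le_poly_act[of v L] v by blast
  obtain C' where C': "C' \<ge> 0" "\<And>\<phi> A. l2_le \<phi> A \<Longrightarrow> l2_le (R \<phi>) (C' * A)"
    using l2_le_poly_act[of v "[:- E, 1:]"] v unfolding R by blast
  \<comment> \<open>Here t \<phi> is the sum of both shifts of \<phi>, which preserve the norm,
    minus L(H) (H - E) \<phi>; the shifts cost 2 out of |t|.\<close>
  have lower: "l2_norm \<phi> \<le> C / (\<bar>t\<bar> - 2) * l2_norm (R \<phi>)" if \<phi>: "\<phi> \<in> l2_space" for \<phi>
  proof -
    have R2: "R \<phi> \<in> l2_space" using l2_le_imp C'(2)[OF l2_le_norm[OF \<phi>]] by blast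
    have "l2_le (\<lambda>n. \<phi> (n + - int q) + \<phi> (n + int q) + (- 1) * poly_act v f \<phi> n)
       (l2_norm \<phi> + l2_norm \<phi> + 1 * (C * l2_norm (R \<phi>)))"
      unfolding fRL(2)[of \<phi>]
      by (intro l2_le_add l2_le_mult l2_le_shift l2_le_norm C(2) \<phi> R2) auto
    also have "(\<lambda>n. \<phi> (n + - int q) + \<phi> (n + int q) + (- 1) * poly_act v f \<phi> n) = (\<lambda>n. of_real t * \<phi> n)"
      by (simp add: f)
    finally have "l2_le (\<lambda>n. of_real (1 / t) * (of_real t * \<phi> n)) (1 / \<bar>t\<bar> * (2 * l2_norm \<phi> + C * l2_norm (R \<phi>)))"
      by (intro l2_le_mult) (auto simp: norm_divide)
    moreover have "(\<lambda>n. of_real (1 / t) * (of_real t * \<phi> n)) = \<phi>" using t by (auto simp: fun_eq_iff)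
    ultimately have "l2_norm \<phi> \<le> 1 / \<bar>t\<bar> * (2 * l2_norm \<phi> + C * l2_norm (R \<phi>))"
      using l2_le_imp by simp
    then have "\<bar>t\<bar> * l2_norm \<phi> \<le> 2 * l2_norm \<phi> + C * l2_norm (R \<phi>)"
      using t by (simp add: field_simps)
    then have "l2_norm \<phi> * (\<bar>t\<bar> - 2) \<le> C * l2_norm (R \<phi>)" by (simp add: algebra_simps)
    then show ?thesis using t by (simp add: pos_le_divide_eq)
  qed
  have "bij_betw R l2_space l2_space"
  proof (rule bij_betwI')
    fix \<phi> \<psi> assume \<phi>: "\<phi> \<in> l2_space" "\<psi> \<in> l2_space"
    show "R \<phi> = R \<psi> \<longleftrightarrow> \<phi> = \<psi>"
    proof
      assume e: "R \<phi> = R \<psi>"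
      define d where "d n = \<phi> n + (- 1) * \<psi> n" for n
      have "l2_le d (l2_norm \<phi> + 1 * l2_norm \<psi>)"
        unfolding d_def by (intro l2_le_add l2_le_mult l2_le_norm \<phi>) auto
      then have d: "d \<in> l2_space" by (rule l2_le_imp)
      have "R d = (\<lambda>n. R \<phi> n - R \<psi> n)"
        by (simp add: R_def d_def schr_def fun_eq_iff algebra_simps)
      then have "R d = (\<lambda>_. 0)" using e by simp
      then have "l2_norm d \<le> 0" using lower[OF d] by (simp add: l2_norm_def)
      then have "l2_le d 0" using l2_le_norm[OF d] unfolding l2_le_def by (meson order.trans)
      then show "\<phi> = \<psi>" using l2_le_point[of d 0] by (auto simp: d_def fun_eq_iff)
    qed simp
  next
    fix \<phi> assume "\<phi> \<in> l2_space"
    then show "R \<phi> \<in> l2_space" using l2_le_imp C'(2)[OF l2_le_norm] by blast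
  next
    fix \<psi> assume \<psi>: "\<psi> \<in> l2_space"
    \<comment> \<open>For surjectivity, the two shift factors are inverted one after the other, in
      opposite directions.\<close>
    obtain \<rho> where \<rho>: "\<bar>\<rho>\<bar> < 1" "\<rho> \<noteq> 0" "1 + \<rho> * \<rho> = \<rho> * t" using joukowski[OF t(2)] by blast
    have n: "norm (complex_of_real \<rho>) < 1" using \<rho> by simp
    have "l2_le (\<lambda>n. complex_of_real (- \<rho>) * \<psi> n) (norm (complex_of_real (- \<rho>)) * l2_norm \<psi>)"
      by (intro l2_le_mult l2_le_norm \<psi>) auto
    then obtain g A where g: "l2_le g A" "\<And>n. g n - of_real \<rho> * g (n - int q) = of_real (- \<rho>) * \<psi> n"
      using l2_le_geometric[OF n] by meson
    obtain \<phi> A' where \<phi>: "l2_le \<phi> A'" "\<And>n. \<phi> n - of_real \<rho> * \<phi> (n - (- int q)) = g n"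
      using l2_le_geometric[OF n g(1)] by meson
    have "poly_act v f \<phi> n = \<psi> n" for n
    proof -
      have e1: "of_real \<rho> * of_real t = 1 + of_real \<rho> * (of_real \<rho> :: complex)"
        using \<rho>(3) by (metis of_real_1 of_real_add of_real_mult)
      have "of_real (- \<rho>) * \<psi> n = (\<phi> n - of_real \<rho> * \<phi> (n + int q)) - of_real \<rho> * (\<phi> (n - int q) - of_real \<rho> * \<phi> n)"
        using g(2)[of n] \<phi>(2)[of n] \<phi>(2)[of "n - int q"] by simp
      also have "\<dots> = (1 + of_real \<rho> * of_real \<rho>) * \<phi> n - of_real \<rho> * (\<phi> (n + int q) + \<phi> (n - int q))"
        by (simp add: algebra_simps)
      also have "\<dots> = of_real (- \<rho>) * (\<phi> (n - int q) + \<phi> (n + int q) - of_real t * \<phi> n)"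
        unfolding e1[symmetric] by (simp add: algebra_simps)
      finally show ?thesis using \<rho>(2) by (simp add: f)
    qed
    then have "\<psi> = R (poly_act v L \<phi>)" using fRL(1)[of \<phi>] by (auto simp: fun_eq_iff)
    moreover have "poly_act v L \<phi> \<in> l2_space" using l2_le_imp C(2)[OF \<phi>(1)] by blast
    ultimately show "\<exists>\<phi>\<in>l2_space. \<psi> = R \<phi>" by blast
  qed
  then show ?thesis
    unfolding l2_resolvent_set_def using lower unfolding R_def by blast
qed

lemma (in bloch) sum_norm_Q:
  assumes "u \<in> Q"
  shows "(\<Sum>n\<in>{0..<int (N * q)}. (norm (u n))\<^sup>2) = real N * (\<Sum>n\<in>{0..<int q}. (norm (u n))\<^sup>2)"
proof (induction N)
  case (Suc N)
  have e: "int (Suc N * q) = int (N * q) + int q" by simp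
  have "{0..<int (Suc N * q)} = {0..<int (N * q)} \<union> {int (N * q)..<int (N * q) + int q}"
    unfolding e by (rule ivl_disj_un_two(3)[symmetric]) simp_all
  then have "(\<Sum>n\<in>{0..<int (Suc N * q)}. (norm (u n))\<^sup>2) = (\<Sum>n\<in>{0..<int (N * q)}. (norm (u n))\<^sup>2)
      + (\<Sum>n\<in>{int (N * q)..<int (N * q) + int q}. (norm (u n))\<^sup>2)"
    by (simp only:) (rule sum.union_disjoint, auto)
  also have "(\<Sum>n\<in>{int (N * q)..<int (N * q) + int q}. (norm (u n))\<^sup>2) = (\<Sum>n\<in>{0..<int q}. (norm (u n))\<^sup>2)"
  proof (rule sum.reindex_bij_witness[of _ "\<lambda>n. n + int (N * q)" "\<lambda>n. n - int (N * q)"])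
    fix n assume "n \<in> {int (N * q)..<int (N * q) + int q}"
    have "(n - int (N * q)) mod int q = n mod int q"
      using mod_mult_self1[of n "- int N" "int q"] by simp
    then show "(cmod (u (n - int (N * q))))\<^sup>2 = (cmod (u n))\<^sup>2"
      using norm_Q_mod[OF assms, of n] norm_Q_mod[OF assms, of "n - int (N * q)"] by simp
  qed auto
  finally show ?case using Suc by (simp add: algebra_simps)
qed simp

text \<open>Cutting the eigenfunction off outside N periods produces an error on at most four sites,
  bounded independently of N, while the norm grows like the square root of N. This contradicts the
  resolvent estimate.\<close>

lemma (in bloch) spectrum_of_eigenfunction:
  assumes u: "u \<in> Q" "schr v u = (\<lambda>n. E * u n)" "\<exists>n\<in>{0..<int q}. u n \<noteq> 0"
  shows "E \<in> l2_spectrum (schr v)"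
proof -
  have False if "E \<in> l2_resolvent_set (schr v)"
  proof -
    obtain C where C: "\<And>\<phi>. \<phi> \<in> l2_space \<Longrightarrow> l2_norm \<phi> \<le> C * l2_norm (\<lambda>n. schr v \<phi> n - E * \<phi> n)"
      using \<open>E \<in> l2_resolvent_set (schr v)\<close> by (auto simp: l2_resolvent_set_def)
    define S where "S = (\<Sum>n\<in>{0..<int q}. (norm (u n))\<^sup>2)"
    have S: "S > 0"
    proof -
      obtain k where "k \<in> {0..<int q}" "u k \<noteq> 0" using u(3) by blast
      then show ?thesis unfolding S_def by (intro sum_pos2[of _ k]) auto
    qed
    define M where "M = (\<Sum>n\<in>{0..<int q}. norm (u n))"
    have M: "norm (u n) \<le> M" for n
    proof -
      have "n mod int q \<in> {0..<int q}" using q_pos by simp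
      then have "norm (u (n mod int q)) \<le> M" unfolding M_def by (intro member_le_sum) auto
      then show ?thesis using norm_Q_mod[OF u(1)] by simp
    qed
    have M0: "M \<ge> 0" using M[of 0] norm_ge_zero order.trans by blast
    have vn: "\<bar>v n\<bar> \<le> 2" for n
    proof -
      have "norm (complex_of_real (v n)) \<le> norm (w powi n * y) + norm (inverse (w powi n * y))"
        unfolding v by (rule norm_triangle_ineq)
      also have "\<dots> = 2" using w y by (simp add: norm_mult norm_inverse norm_power_int)
      finally show ?thesis by simp
    qed
    define K where "K = (4 + norm E) * M"
    have bound: "sqrt (real N * S) \<le> \<bar>C\<bar> * (2 * K)" for N
    proof -
      define \<phi> where "\<phi> n = (if n \<in> {0..<int (N * q)} then u n else 0)" for n
      have \<phi>M: "norm (\<phi> n) \<le> M" for n using M M0 by (simp add: \<phi>_def)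
      define g where "g n = schr v \<phi> n - E * \<phi> n" for n
      have gK: "norm (g n) \<le> K" for n
      proof -
        have "norm (g n) \<le> norm (\<phi> (n - 1)) + norm (\<phi> (n + 1)) + norm (complex_of_real (v n) * \<phi> n) + norm (E * \<phi> n)"
          unfolding g_def schr_def by (intro norm_triangle_le norm_triangle_le_diff add_mono order.refl norm_triangle_ineq)
        also have "\<dots> \<le> M + M + 2 * M + norm E * M"
          using vn[of n] \<phi>M M0 by (intro add_mono) (auto simp: norm_mult intro!: mult_mono)
        finally show ?thesis by (simp add: K_def algebra_simps)
      qed
      have g0: "g n = 0" if "n \<notin> {-1, 0, int (N * q) - 1, int (N * q)}" for n
      proof (cases "0 < n \<and> n < int (N * q) - 1")
        case True
        then show ?thesis using fun_cong[OF u(2), of n] by (simp add: g_def schr_def \<phi>_def)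
      next
        case False
        then have "n < -1 \<or> n > int (N * q)" using that by auto
        then show ?thesis by (auto simp: g_def schr_def \<phi>_def)
      qed
      have "l2_le g (2 * K)"
        unfolding l2_le_def
      proof (intro allI impI)
        fix F :: "int set" assume F: "finite F"
        let ?A = "{-1, 0, int (N * q) - 1, int (N * q)}"
        have "(\<Sum>n\<in>F. (norm (g n))\<^sup>2) = (\<Sum>n\<in>F \<inter> ?A. (norm (g n))\<^sup>2)"
          using F g0 by (intro sum.mono_neutral_right) auto
        also have "\<dots> \<le> (\<Sum>n\<in>F \<inter> ?A. K\<^sup>2)" by (intro sum_mono power_mono gK) auto
        also have "\<dots> = real (card (F \<inter> ?A)) * K\<^sup>2" by simp
        also have "\<dots> \<le> 4 * K\<^sup>2"
        proof -
          have "card (F \<inter> ?A) \<le> card ?A" by (intro card_mono) auto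
          also have "\<dots> \<le> 4" by (rule order.trans[OF card_insert_le_m1]) (auto intro!: card_insert_le_m1)
          finally show ?thesis by (intro mult_right_mono) auto
        qed
        finally have "sqrt (\<Sum>n\<in>F. (norm (g n))\<^sup>2) \<le> sqrt ((2 * K)\<^sup>2)"
          by (intro real_sqrt_le_mono) (simp add: power2_eq_square)
        also have "\<dots> = 2 * K"
        proof -
          have "0 \<le> K" using M0 by (simp add: K_def)
          then show ?thesis by (subst real_sqrt_abs) simp
        qed
        finally show "L2_set (\<lambda>n. norm (g n)) F \<le> 2 * K" by (simp add: L2_set_def)
      qed
      then have gn: "l2_norm g \<le> 2 * K" by (rule l2_le_imp)
      have \<phi>2: "\<phi> \<in> l2_space"
      proof -
        have "(\<lambda>n. (cmod (\<phi> n))\<^sup>2) summable_on {0..<int (N * q)}" by (rule summable_on_finite) simp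
        then have "(\<lambda>n. (cmod (\<phi> n))\<^sup>2) summable_on UNIV"
          by (rule summable_on_cong_neutral[THEN iffD1, rotated -1]) (auto simp: \<phi>_def)
        then show ?thesis by (simp add: l2_space_def)
      qed
      have "sqrt (real N * S) = L2_set (\<lambda>n. norm (\<phi> n)) {0..<int (N * q)}"
        unfolding L2_set_def S_def sum_norm_Q[OF u(1), symmetric]
        by (intro arg_cong[where f = sqrt] sum.cong) (auto simp: \<phi>_def)
      also have "\<dots> \<le> l2_norm \<phi>" using l2_le_norm[OF \<phi>2] unfolding l2_le_def by simp
      also have "\<dots> \<le> C * l2_norm g" using C[OF \<phi>2] unfolding g_def .
      also have "\<dots> \<le> \<bar>C\<bar> * (2 * K)"
      proof (rule mult_mono)
        show "0 \<le> l2_norm g" unfolding l2_norm_def by (intro real_sqrt_ge_zero infsum_nonneg) auto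
      qed (use gn in auto)
      finally show ?thesis .
    qed
    obtain N :: nat where N: "real N > (\<bar>C\<bar> * (2 * K))\<^sup>2 / S" using reals_Archimedean2 by blast
    then have "real N * S > (\<bar>C\<bar> * (2 * K))\<^sup>2" using S by (simp add: field_simps)
    then have "sqrt (real N * S) > \<bar>C\<bar> * (2 * K)" by (rule real_less_rsqrt)
    then show False using bound[of N] by simp
  qed
  then show ?thesis by (auto simp: l2_spectrum_def)
qed

lemma amo_eq_schr: "amo \<alpha> \<theta> = schr (\<lambda>n. 2 * cos (2 * pi * (\<alpha> * of_int n + \<theta>)))"
  by (simp add: amo_def schr_def fun_eq_iff)

text \<open>A discriminant of modulus at most 4 admits a phase and a multiplier with a Floquet
  eigenfunction. For a larger one, the trace over one period is minus the discriminant minus 2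
  cos(2\<pi>q\<theta>), of modulus greater than 2 whatever the phase \<theta>.\<close>

theorem spec_union_eq:
  assumes q: "odd q" and co: "coprime p q"
  shows "spec_union (real p / real q) = {E. \<bar>discriminant p q E\<bar> \<le> 4}"
proof (intro set_eqI iffI)
  fix E assume "E \<in> {E. \<bar>discriminant p q E\<bar> \<le> 4}"
  then have c: "\<bar>discriminant p q E\<bar> \<le> 4" by simp
  obtain \<theta> z where \<theta>: "\<theta> \<in> {0<..1}"
    and B: "bloch q (q div 2) (unit_root p q) (cis (2 * pi * \<theta>)) z (potential p q \<theta>)"
    and bloch_poly: "- disc_poly p q - [:of_real (- discriminant p q E):] = bloch.bloch_poly q z (potential p q \<theta>)"
    by (rule exists_bloch[OF q co c poly_disc_poly_real])
  have 0: "poly (bloch.bloch_poly q z (potential p q \<theta>)) (of_real E) = 0"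
    unfolding bloch_poly[symmetric] by (simp add: poly_disc_poly_real)
  have "of_real E \<in> l2_spectrum (schr (potential p q \<theta>))"
    by (rule bloch.eigenfunction[OF B 0], rule bloch.spectrum_of_eigenfunction[OF B])
  then show "E \<in> spec_union (real p / real q)"
    using \<theta> by (auto simp: spec_union_def amo_eq_schr)
next
  fix E assume "E \<in> spec_union (real p / real q)"
  then obtain \<theta> where E: "of_real E \<in> l2_spectrum (schr (potential p q \<theta>))"
    by (auto simp: spec_union_def amo_eq_schr)
  define v where "v = (potential p q \<theta>)"
  interpret bloch q "q div 2" "unit_root p q" "cis (2 * pi * \<theta>)" 1 v
    unfolding v_def by (rule bloch_unit_root[OF q co]) simp
  show "E \<in> {E. \<bar>discriminant p q E\<bar> \<le> 4}"
  proof (rule ccontr)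
    assume "E \<notin> {E. \<bar>discriminant p q E\<bar> \<le> 4}"
    then have d: "\<bar>discriminant p q E\<bar> > 4" by simp
    define k where "k = 2 * cos (real q * (2 * pi * \<theta>))"
    have k: "\<bar>k\<bar> \<le> 2" by (simp add: k_def abs_mult)
    have "cis (2 * pi * \<theta>) ^ q + inverse (cis (2 * pi * \<theta>) ^ q) = of_real k"
      unfolding k_def two_cos_cis Complex.DeMoivre ..
    then have "trace_poly - [:2:] = - disc_poly p q - [:of_real k + 2:]"
      using bloch_poly_eq_disc_poly[OF refl co] by (simp add: bloch_poly_def)
    then have "poly (trace_poly - [:2:]) (of_real E) = poly (- disc_poly p q - [:of_real k + 2:]) (of_real E)" by simp
    then have "poly (transfer_trace (linear_factors v 0 q)) (of_real E) = of_real (- discriminant p q E - k)"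
      by (simp add: trace_poly_def poly_disc_poly_real)
    then have "complex_of_real E \<in> l2_resolvent_set (schr v)"
      by (rule l2_resolvent[rotated 2]) (use d k v_period in \<open>auto simp: v_def abs_mult\<close>)
    then show False using E by (simp add: l2_spectrum_def v_def)
  qed
qed

section \<open>A Jacobi matrix with zero diagonal\<close>

text \<open>Characteristic polynomials of the leading blocks of the Jacobi matrix with zero diagonal
  and squared off-diagonal entries 4 sin^2(\<pi>kp/q).\<close>

fun jacobi :: "nat \<Rightarrow> nat \<Rightarrow> nat \<Rightarrow> complex poly" where
  "jacobi p q 0 = 1"
| "jacobi p q (Suc 0) = [:0, 1:]"
| "jacobi p q (Suc (Suc k)) = [:0, 1:] * jacobi p q (Suc k)
     - smult (of_real (4 * (sin (pi * real (Suc k * p) / real q))\<^sup>2)) (jacobi p q k)"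

lemma jacobi_degree: "degree (jacobi p q k) = k \<and> coeff (jacobi p q k) k = 1"
proof (induction p q k rule: jacobi.induct)
  case (3 p q k)
  let ?s = "of_real (4 * (sin (pi * real (Suc k * p) / real q))\<^sup>2) :: complex"
  have nonzero: "jacobi p q (Suc k) \<noteq> 0" using 3 by (metis coeff_0 zero_neq_one)
  have c: "coeff (jacobi p q k) (Suc (Suc k)) = 0" "coeff (jacobi p q k) (Suc k) = 0"
    by (rule coeff_eq_0, use 3 in simp)+
  have d1: "degree ([:0, 1:] * jacobi p q (Suc k)) = Suc (Suc k)"
    using nonzero 3 by (simp add: degree_mult_eq del: mult_pCons_left)
  have "degree (- smult ?s (jacobi p q k)) < degree ([:0, 1:] * jacobi p q (Suc k))"
    unfolding d1 using degree_smult_le[of ?s "jacobi p q k"] 3 by simp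
  from degree_add_eq_left[OF this] have "degree (jacobi p q (Suc (Suc k))) = Suc (Suc k)"
    unfolding d1 by (simp only: jacobi.simps diff_conv_add_uminus)
  then show ?case using c 3 by simp
qed auto

lemma one_minus_cis: "(1 - cis (- a)) * (1 - cis a) = of_real (4 * (sin (a / 2))\<^sup>2)"
proof -
  have "(1 - cis (- a)) * (1 - cis a) = 2 - (cis a + inverse (cis a))"
    by (simp add: algebra_simps cis_inverse cis_mult)
  also have "\<dots> = of_real (2 - 2 * cos a)" by (simp only: two_cos_cis[symmetric] of_real_diff of_real_numeral)
  also have "2 - 2 * cos a = 4 * (sin (a / 2))\<^sup>2"
    using cos_double_sin[of "a / 2"] by simp
  finally show ?thesis .
qed

text \<open>Conjugating by the Gaussian \<open>(-1)\<^sup>n \<eta>\<^bsup>n(n+1)\<^esup>\<close> and a finite Fourier transform turns the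
  operator at \<open>\<theta> = 0\<close> with antiperiodic boundary condition into a Jacobi matrix with zero
  diagonal, one of whose hopping amplitudes vanishes.\<close>

lemma disc_poly_root_jacobi:
  assumes q: "odd q" and co: "coprime p q" and E: "poly (disc_poly p q) E = 0"
  shows "poly (jacobi p q q) E = 0"
proof -
  have q0: "q > 0" using q by (cases q) auto
  note oddq = q
  define v :: "int \<Rightarrow> real" where "v = (\<lambda>n. 2 * cos (2 * pi * (real p / real q * of_int n + 0)))"
  interpret bloch q "q div 2" "unit_root p q" "cis (2 * pi * 0)" "-1" v
    unfolding v_def by (rule bloch_unit_root[OF q co]) simp
  have "bloch_poly = - disc_poly p q" using bloch_poly_eq_disc_poly[OF refl co] by simp
  then have "poly bloch_poly E = 0" using E by simp
  then obtain u where u: "u \<in> Q" "schr v u = (\<lambda>n. E * u n)" "\<exists>n\<in>{0..<int q}. u n \<noteq> 0"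
    by (rule eigenfunction)
  define W where "W = unit_root p q"
  define \<eta> where "\<eta> = cis (pi * real p / real q)"
  have \<eta>0: "\<eta> \<noteq> 0" by (simp add: \<eta>_def)
  have \<eta>2: "\<eta> powi 2 = W" unfolding \<eta>_def W_def unit_root_def cis_power_int by (simp add: mult_ac)
  have W0: "W \<noteq> 0" by (simp add: W_def unit_root_def)
  have \<eta>W: "\<eta> powi (2 * k) = W powi k" for k by (metis \<eta>2 power_int_mult)
  have Wq: "W powi int q = 1" using unit_root_root[OF q0 co] by (simp add: W_def)
  \<comment> \<open>The Fourier character \<open>W powi (n * k)\<close> times a Gaussian in
    \<open>n\<close>. Multiplying by \<open>W powi n\<close> and translating \<open>n\<close> both
    amount to a shift of \<open>k\<close>, up to sign and a power of \<open>W\<close> independent of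
    \<open>n\<close>.\<close>
  define \<kappa> where "\<kappa> k n = (-1) powi n * \<eta> powi (n * (n + 1) + 2 * n * k)" for k n :: int
  have \<kappa>nonzero: "\<kappa> k n \<noteq> 0" for k n using \<eta>0 by (simp add: \<kappa>_def)
  have k1: "\<kappa> (k + 1) n = W powi n * \<kappa> k n" for k n
  proof -
    have "\<eta> powi (n * (n + 1) + 2 * n * (k + 1)) = \<eta> powi (2 * n) * \<eta> powi (n * (n + 1) + 2 * n * k)"
      using \<eta>0 by (simp add: algebra_simps flip: power_int_add)
    then show ?thesis by (simp add: \<kappa>_def \<eta>W)
  qed
  have n1: "\<kappa> k (n + 1) = - (W powi (k + 1) * \<kappa> (k + 1) n)" for k n
  proof -
    have "\<eta> powi ((n + 1) * (n + 1 + 1) + 2 * (n + 1) * k) = \<eta> powi (2 * (k + 1)) * \<eta> powi (n * (n + 1) + 2 * n * (k + 1))"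
      using \<eta>0 by (simp add: algebra_simps flip: power_int_add)
    then show ?thesis unfolding \<kappa>_def \<eta>W by (simp add: power_int_add)
  qed
  have n2: "\<kappa> k (n - 1) = - (W powi (- k) * \<kappa> (k - 1) n)" for k n
  proof -
    have "\<kappa> (k - 1) n = - (W powi k * \<kappa> k (n - 1))" using n1[of "k - 1" "n - 1"] by simp
    then show ?thesis using W0 by (simp add: power_int_minus)
  qed
  \<comment> \<open>This sign cancels the antiperiodicity of \<open>u\<close>, so
    \<open>\<kappa> k n * u n\<close> has period q and can be summed by parts. Both the oddness of q
    and the evenness of n (n + 1) enter.\<close>
  have nq: "\<kappa> k (n + int q) = - \<kappa> k n" for k n
  proof -
    obtain r where r: "q = 2 * r + 1" using oddq by (elim oddE)
    have "(n + int q) * (n + int q + 1) + 2 * (n + int q) * k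
       = (n * (n + 1) + 2 * n * k) + 2 * (int q * (n + int r + 1 + k))"
      by (simp add: r algebra_simps)
    then have "\<eta> powi ((n + int q) * (n + int q + 1) + 2 * (n + int q) * k)
       = \<eta> powi (n * (n + 1) + 2 * n * k) * \<eta> powi (2 * (int q * (n + int r + 1 + k)))"
      using \<eta>0 by (simp only: power_int_add simp_thms)
    also have "\<eta> powi (2 * (int q * (n + int r + 1 + k))) = 1"
      by (simp only: \<eta>W) (simp only: power_int_mult Wq power_int_1_left)
    finally show ?thesis using oddq by (simp add: \<kappa>_def power_int_add)
  qed
  define \<psi> where "\<psi> k = (\<Sum>n\<in>{0..<int q}. \<kappa> k n * u n)" for k
  have uq: "u (n + int q) = - u n" for n using u(1) by (simp add: Q_def)
  \<comment> \<open>In each coefficient the 1 comes from the potential and the power of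
    \<open>W\<close> from a translation; no diagonal term arises. The coefficient of
    \<open>\<psi> (k - 1)\<close> vanishes at \<open>k = 0\<close>, so the recursion starts from
    \<open>\<psi> 0\<close> alone.\<close>
  have rec: "E * \<psi> k = (1 - W powi (k + 1)) * \<psi> (k + 1) + (1 - W powi (- k)) * \<psi> (k - 1)" for k
  proof -
    have vW: "complex_of_real (v n) = W powi n + W powi (- n)" for n
      using v[of n] by (simp add: W_def power_int_minus)
    have s1: "(\<Sum>n\<in>{0..<int q}. \<kappa> k n * u (n - 1)) = (\<Sum>n\<in>{0..<int q}. \<kappa> k (n + 1) * u n)"
      using sum_period'[of "\<lambda>n. \<kappa> k (n + 1) * u n"] nq[of k "_ + 1"] by (simp add: uq algebra_simps)
    have s2: "(\<Sum>n\<in>{0..<int q}. \<kappa> k n * u (n + 1)) = (\<Sum>n\<in>{0..<int q}. \<kappa> k (n - 1) * u n)"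
      using sum_period[of "\<lambda>n. \<kappa> k (n - 1) * u n"] nq[of k "_ - 1"] by (simp add: uq algebra_simps)
    have "E * \<psi> k = (\<Sum>n\<in>{0..<int q}. \<kappa> k n * schr v u n)"
      unfolding u(2) \<psi>_def by (simp add: sum_distrib_left mult_ac)
    also have "\<dots> = (\<Sum>n\<in>{0..<int q}. \<kappa> k n * u (n - 1)) + (\<Sum>n\<in>{0..<int q}. \<kappa> k n * u (n + 1))
        + (\<Sum>n\<in>{0..<int q}. \<kappa> k n * (W powi n + W powi (- n)) * u n)"
      by (simp add: schr_def vW algebra_simps sum.distrib)
    also have "\<dots> = (\<Sum>n\<in>{0..<int q}. (\<kappa> k (n + 1) + \<kappa> k (n - 1) + \<kappa> k n * (W powi n + W powi (- n))) * u n)"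
      unfolding s1 s2 by (simp add: algebra_simps sum.distrib)
    also have "\<dots> = (\<Sum>n\<in>{0..<int q}. ((1 - W powi (k + 1)) * \<kappa> (k + 1) n + (1 - W powi (- k)) * \<kappa> (k - 1) n) * u n)"
    proof -
      have "\<kappa> k n * W powi (- n) = \<kappa> (k - 1) n" for n
        using k1[of "k - 1" n] W0 by (simp add: power_int_minus)
      then have "\<kappa> k n * (W powi n + W powi (- n)) = \<kappa> (k + 1) n + \<kappa> (k - 1) n" for n
        using k1[of k n] by (simp add: distrib_left mult.commute)
      then show ?thesis unfolding n1 n2 by (simp add: algebra_simps)
    qed
    also have "\<dots> = (1 - W powi (k + 1)) * \<psi> (k + 1) + (1 - W powi (- k)) * \<psi> (k - 1)"
      by (simp add: \<psi>_def distrib_right sum.distrib sum_distrib_left mult.assoc)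
    finally show ?thesis .
  qed
  define P where "P k = (\<Prod>i=1..k. 1 - W powi int i)" for k
  have PSuc: "P (Suc k) = P k * (1 - W powi (int k + 1))" for k
    using W0 by (simp add: P_def power_int_add)
  have main: "P k * \<psi> (int k) = poly (jacobi p q k) E * \<psi> 0" for k
  proof (induction k rule: less_induct)
    case (less k)
    show ?case
    proof (cases k)
      case 0
      then show ?thesis by (simp add: P_def)
    next
      case (Suc l)
      show ?thesis
      proof (cases l)
        case 0
        then show ?thesis using rec[of 0] Suc by (simp add: P_def)
      next
        case l: (Suc j)
        have a: "(1 - W powi (- (int j + 1))) * (1 - W powi (int j + 1))
            = of_real (4 * (sin (pi * real (Suc j * p) / real q))\<^sup>2)"
        proof -
          have "W powi (int j + 1) = cis (2 * (pi * real (Suc j * p) / real q))"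
            "W powi (- (int j + 1)) = cis (- (2 * (pi * real (Suc j * p) / real q)))"
            by (simp_all add: W_def unit_root_def cis_power_int algebra_simps add_divide_distrib diff_divide_distrib)
          then show ?thesis using one_minus_cis[of "2 * (pi * real (Suc j * p) / real q)"] by simp
        qed
        have IH1: "P (Suc j) * \<psi> (int j + 1) = poly (jacobi p q (Suc j)) E * \<psi> 0"
          using less.IH[of "Suc j"] Suc l by (simp add: add.commute)
        have IH2: "P j * \<psi> (int j) = poly (jacobi p q j) E * \<psi> 0"
          using less.IH[of j] Suc l by simp
        have "P k * \<psi> (int k) = P (Suc j) * ((1 - W powi (int j + 1 + 1)) * \<psi> (int j + 1 + 1))"
        proof -
          have "P k = P (Suc j) * (1 - W powi (int j + 1 + 1))"
            using PSuc[of "Suc j"] Suc l by (simp add: add_ac)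
          moreover have "int k = int j + 1 + 1" using Suc l by simp
          ultimately show ?thesis by (simp only: mult.assoc)
        qed
        also have "(1 - W powi (int j + 1 + 1)) * \<psi> (int j + 1 + 1)
            = E * \<psi> (int j + 1) - (1 - W powi (- (int j + 1))) * \<psi> (int j)"
          using rec[of "int j + 1"] by simp
        also have "P (Suc j) * (E * \<psi> (int j + 1) - (1 - W powi (- (int j + 1))) * \<psi> (int j))
            = E * (P (Suc j) * \<psi> (int j + 1))
              - ((1 - W powi (- (int j + 1))) * (1 - W powi (int j + 1))) * (P j * \<psi> (int j))"
          unfolding PSuc by (simp add: algebra_simps)
        also have "\<dots> = poly (jacobi p q k) E * \<psi> 0"
          unfolding a IH1 IH2 using Suc l by (simp add: algebra_simps)
        finally show ?thesis .
      qed
    qed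
  qed
  \<comment> \<open>The coefficient \<open>1 - W powi int q\<close> vanishes too, which turns the
    recursion into an equation for \<open>E\<close>.\<close>
  have "P q = 0"
    unfolding P_def using q0 Wq by (auto simp: prod_zero_iff intro!: bexI[of _ q])
  then have "poly (jacobi p q q) E * \<psi> 0 = 0" using main[of q] by simp
  \<comment> \<open>Otherwise \<psi> vanishes on a whole period, and Fourier inversion at
    \<open>n'\<close> contradicts \<open>u n' \<noteq> 0\<close>.\<close>
  moreover have "\<psi> 0 \<noteq> 0"
  proof
    assume p0: "\<psi> 0 = 0"
    have Pnz: "P k \<noteq> 0" if "k < q" for k
      unfolding P_def using that unit_root_root(2)[OF q0 co] by (auto simp: prod_zero_iff W_def)
    have \<psi>0: "\<psi> (int k) = 0" if "k < q" for k
      using main[of k] Pnz[OF that] p0 by simp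
    obtain n' where n': "n' \<in> {0..<int q}" "u n' \<noteq> 0" using u(3) by blast
    have \<kappa>k: "\<kappa> k n = W powi (n * k) * \<kappa> 0 n" for k n
    proof -
      have "\<eta> powi (n * (n + 1) + 2 * n * k) = \<eta> powi (2 * (n * k)) * \<eta> powi (n * (n + 1) + 2 * n * 0)"
        using \<eta>0 by (simp add: algebra_simps flip: power_int_add)
      then show ?thesis unfolding \<kappa>_def \<eta>W by simp
    qed
    have "0 = (\<Sum>k\<in>{0..<int q}. W powi (- n' * k) * \<psi> k)"
    proof (rule sum.neutral[symmetric], rule ballI)
      fix k assume "k \<in> {0..<int q}"
      then have "\<psi> k = 0" using \<psi>0[of "nat k"] by auto
      then show "W powi (- n' * k) * \<psi> k = 0" by simp
    qed
    also have "\<dots> = (\<Sum>n\<in>{0..<int q}. \<Sum>k\<in>{0..<int q}. W powi ((n - n') * k) * (\<kappa> 0 n * u n))"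
      unfolding \<psi>_def sum_distrib_left
    proof (subst sum.swap, intro sum.cong refl)
      fix n k
      have "W powi (- n' * k) * W powi (n * k) = W powi ((n - n') * k)"
        using W0 by (simp add: algebra_simps flip: power_int_add)
      then show "W powi (- n' * k) * (\<kappa> k n * u n) = W powi ((n - n') * k) * (\<kappa> 0 n * u n)"
        unfolding \<kappa>k[of k n] by (simp only: mult.assoc[symmetric])
    qed
    also have "\<dots> = (\<Sum>n\<in>{0..<int q}. if n = n' then of_nat q * (\<kappa> 0 n' * u n') else 0)"
    proof (rule sum.cong[OF refl])
      fix n assume n: "n \<in> {0..<int q}"
      show "(\<Sum>k\<in>{0..<int q}. W powi ((n - n') * k) * (\<kappa> 0 n * u n)) = (if n = n' then of_nat q * (\<kappa> 0 n' * u n') else 0)"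
      proof (cases "n = n'")
        case False
        define s where "s = (\<Sum>k\<in>{0..<int q}. W powi ((n - n') * k))"
        have "W powi (n - n') \<noteq> 1"
          unfolding W_def w_powi_eq_1_iff
        proof
          assume "int q dvd n - n'"
          then have "n mod int q = n' mod int q" by (simp add: mod_eq_dvd_iff)
          then show False using n n' False by simp
        qed
        moreover have "W powi (n - n') * s = s"
        proof -
          have "(\<Sum>k\<in>{0..<int q}. W powi ((n - n') * (k + 1))) = s"
            unfolding s_def
          proof (rule sum_period[of "\<lambda>k. W powi ((n - n') * k)"])
            show "W powi ((n - n') * (k + int q)) = W powi ((n - n') * k)" for k
              unfolding W_def by (rule w_powi_mult_period)
          qed
          moreover have "W powi ((n - n') * (k + 1)) = W powi (n - n') * W powi ((n - n') * k)" for k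
            using W0 by (simp add: algebra_simps flip: power_int_add)
          ultimately show ?thesis by (simp add: s_def sum_distrib_left)
        qed
        ultimately have "s = 0" by (metis mult_cancel_right1)
        then show ?thesis using False by (simp add: s_def flip: sum_distrib_right)
      qed simp
    qed
    also have "\<dots> = of_nat q * (\<kappa> 0 n' * u n')" using n' by simp
    finally show False using q0 n' \<kappa>nonzero by simp
  qed
  ultimately show ?thesis by simp
qed

text \<open>All complex roots are real by self-adjointness and simple because the derivative has
  modulus at least 1 there.\<close>

lemma disc_poly_factor:
  assumes q: "odd q" and co: "coprime p q" and c: "\<bar>c\<bar> \<le> 4"
  defines "\<Lambda> \<equiv> {x::real. discriminant p q x = c}"
  shows "finite \<Lambda>" "card \<Lambda> = q" "discriminant p q x - c = - (\<Prod>\<mu>\<in>\<Lambda>. x - \<mu>)"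
    "disc_poly p q - [:of_real c:] = smult (-1) (\<Prod>\<mu>\<in>\<Lambda>. [:- of_real \<mu>, 1:])"
proof -
  have q0: "q > 0" using q by (cases q) auto
  define f where "f = disc_poly p q - [:of_real c:]"
  have deg: "degree f = q" "lead_coeff f = -1"
  proof -
    have f: "f = disc_poly p q + - [:of_real c:]" by (simp only: f_def diff_conv_add_uminus)
    have "degree (- [:complex_of_real c:]) < degree (disc_poly p q)" using disc_poly_monic[OF q0] q0 by simp
    from degree_add_eq_left[OF this] show d: "degree f = q" unfolding f using disc_poly_monic[OF q0] by simp
    show "lead_coeff f = -1" unfolding d unfolding f_def using disc_poly_monic[OF q0] q0
      by (simp add: coeff_pCons split: nat.split)
  qed
  have f0: "f \<noteq> 0" using deg by auto
  have root: "poly f E = 0 \<longleftrightarrow> poly (disc_poly p q) E = of_real c" for E by (simp add: f_def)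
  have roots: "{E. poly f E = 0} = of_real ` \<Lambda>"
  proof (intro set_eqI iffI)
    fix E assume "E \<in> {E. poly f E = 0}"
    then have r: "poly (disc_poly p q) E = of_real c" using root by simp
    then obtain x where x: "E = of_real x" using disc_poly_level(1)[OF q co c] by (auto elim: Reals_cases)
    then have "complex_of_real (discriminant p q x) = of_real c" using r by (simp add: poly_disc_poly_real)
    then show "E \<in> of_real ` \<Lambda>" using x by (auto simp: \<Lambda>_def)
  next
    fix E :: complex assume "E \<in> of_real ` \<Lambda>"
    then show "E \<in> {E. poly f E = 0}" by (auto simp: root \<Lambda>_def poly_disc_poly_real)
  qed
  have "finite (of_real ` \<Lambda> :: complex set)" using poly_roots_finite[OF f0] unfolding roots .
  then show fin: "finite \<Lambda>" by (simp add: finite_image_iff inj_on_def)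
  have rsq: "rsquarefree f"
    unfolding rsquarefree_roots
  proof (intro allI notI)
    fix E assume "poly f E = 0 \<and> poly (pderiv f) E = 0"
    moreover have "pderiv f = pderiv (disc_poly p q)" by (simp add: f_def pderiv_diff pderiv_pCons)
    ultimately show False using disc_poly_level(3)[OF q co c, of E] root by simp
  qed
  have "f = smult (lead_coeff f) (\<Prod>E | poly f E = 0. [:- E, 1:])"
    by (rule complex_poly_decompose_rsquarefree[OF rsq, symmetric])
  also have "\<dots> = smult (-1) (\<Prod>\<mu>\<in>\<Lambda>. [:- of_real \<mu>, 1:])"
    unfolding roots deg(2) by (subst prod.reindex) (auto simp: inj_on_def)
  finally have fac: "f = smult (-1) (\<Prod>\<mu>\<in>\<Lambda>. [:- of_real \<mu>, 1:])" .
  then show "disc_poly p q - [:of_real c:] = smult (-1) (\<Prod>\<mu>\<in>\<Lambda>. [:- of_real \<mu>, 1:])" by (simp add: f_def)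
  have "degree f = (\<Sum>\<mu>\<in>\<Lambda>. degree [:- complex_of_real \<mu>, 1:])"
    unfolding fac by (subst degree_smult_eq) (simp add: degree_prod_eq_sum_degree)
  then show "card \<Lambda> = q" using deg by simp
  have "complex_of_real (discriminant p q x - c) = poly f (of_real x)"
    by (simp add: f_def poly_disc_poly_real)
  also have "\<dots> = of_real (- (\<Prod>\<mu>\<in>\<Lambda>. x - \<mu>))"
    unfolding fac by (simp add: poly_prod)
  finally show "discriminant p q x - c = - (\<Prod>\<mu>\<in>\<Lambda>. x - \<mu>)" by (simp only: of_real_eq_iff)
qed

text \<open>The leading terms cancel in \<open>disc_poly p q + jacobi p q q\<close>, which therefore
  has degree below q but vanishes at the q distinct zeros of the discriminant.\<close>

lemma disc_poly_eq_jacobi: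
  assumes q: "odd q" and co: "coprime p q"
  shows "disc_poly p q = - jacobi p q q"
proof (rule ccontr)
  assume ne: "disc_poly p q \<noteq> - jacobi p q q"
  have q0: "q > 0" using q by (cases q) auto
  define \<Lambda> where "\<Lambda> = {x::real. discriminant p q x = 0}"
  have c: "finite \<Lambda>" "card \<Lambda> = q" using disc_poly_factor(1,2)[OF q co, of 0] by (simp_all add: \<Lambda>_def)
  define d where "d = disc_poly p q + jacobi p q q"
  have d0: "d \<noteq> 0" using ne by (simp add: d_def eq_neg_iff_add_eq_0)
  have "degree d < q"
  proof -
    have "degree d \<le> q" unfolding d_def using disc_poly_monic[OF q0] jacobi_degree[of p q q] by (intro degree_add_le) auto
    moreover have "coeff d q = 0" using disc_poly_monic[OF q0] jacobi_degree[of p q q] by (simp add: d_def)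
    ultimately show ?thesis using d0 by (metis le_neq_implies_less leading_coeff_0_iff)
  qed
  moreover have "card (complex_of_real ` \<Lambda>) \<le> card {E. poly d E = 0}"
  proof (rule card_mono)
    show "finite {E. poly d E = 0}" using d0 by (rule poly_roots_finite)
    have "poly (disc_poly p q) (of_real x) = 0" if "x \<in> \<Lambda>" for x
      using that by (simp add: \<Lambda>_def poly_disc_poly_real)
    then show "complex_of_real ` \<Lambda> \<subseteq> {E. poly d E = 0}"
      using disc_poly_root_jacobi[OF q co] by (auto simp: d_def)
  qed
  moreover have "card {E. poly d E = 0} \<le> degree d" by (rule card_poly_roots_bound[OF d0])
  moreover have "card (complex_of_real ` \<Lambda>) = q" using c by (simp add: card_image inj_on_def)
  ultimately show False by simp
qed

section \<open>Reciprocity for alternating sums of logarithmic sines\<close>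

lemma
  fixes e :: real
  assumes "e > 0"
  shows integrable_exp_neg_Ioi: "set_integrable lborel {0<..} (\<lambda>t. exp (- e * t))"
    and integral_exp_neg_Ioi: "(LBINT t:{0<..}. exp (- e * t)) = 1 / e"
proof -
  have "(\<integral>\<^sup>+t. ennreal (exp (- e * t)) * indicator {0..} t \<partial>lborel) = ennreal (0 - (- 1 / e * exp (- e * 0)))"
  proof (rule nn_integral_FTC_atLeast)
    show "((\<lambda>t. - 1 / e * exp (- e * t)) \<longlongrightarrow> 0) at_top"
      using assms by real_asymp
  qed (use assms in \<open>auto intro!: derivative_eq_intros\<close>)
  also have "(\<integral>\<^sup>+t. ennreal (exp (- e * t)) * indicator {0..} t \<partial>lborel)
     = (\<integral>\<^sup>+t. ennreal (indicator {0<..} t *\<^sub>R exp (- e * t)) \<partial>lborel)"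
  proof (rule nn_integral_cong_AE)
    have "AE t in lborel. t \<noteq> (0::real)" by (rule AE_lborel_singleton)
    then show "AE t in lborel. ennreal (exp (- e * t)) * indicator {0..} t = ennreal (indicator {0<..} t *\<^sub>R exp (- e * t))"
      by eventually_elim (auto simp: indicator_def)
  qed
  finally have "has_bochner_integral lborel (\<lambda>t. indicator {0<..} t *\<^sub>R exp (- e * t)) (1 / e)"
    using assms by (intro has_bochner_integral_nn_integral) auto
  then show "set_integrable lborel {0<..} (\<lambda>t. exp (- e * t))"
    and "(LBINT t:{0<..}. exp (- e * t)) = 1 / e"
    by (auto simp: set_integrable_def set_lebesgue_integral_def has_bochner_integral_iff)
qed

lemma set_integrable_dominated_exp:
  fixes f :: "real \<Rightarrow> real"
  assumes "e > 0" "f \<in> borel_measurable borel" "\<And>t. t > 0 \<Longrightarrow> \<bar>f t\<bar> \<le> B * exp (- e * t)"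
  shows "set_integrable lborel {0<..} f"
proof (rule set_integrable_bound)
  show "set_integrable lborel {0<..} (\<lambda>t. B * exp (- e * t))"
    using integrable_exp_neg_Ioi[OF assms(1)] by simp
  show "set_borel_measurable lborel {0<..} f"
    unfolding set_borel_measurable_def using assms(2) by measurable
  show "AE t in lborel. t \<in> {0<..} \<longrightarrow> norm (f t) \<le> norm (B * exp (- e * t))"
    by (intro AE_I2 impI) (metis assms(3) abs_ge_self greaterThan_iff order.trans real_norm_def)
qed

lemma borel_measurable_sinh [measurable]: "sinh \<in> borel_measurable (borel :: real measure)"
  and borel_measurable_cosh [measurable]: "cosh \<in> borel_measurable (borel :: real measure)"
  by (intro borel_measurable_continuous_onI continuous_intros)+

lemma sinh_le_mult_cosh: "0 \<le> x \<Longrightarrow> sinh x \<le> x * cosh (x::real)"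
proof -
  assume x: "0 \<le> x"
  have "0 * cosh 0 - sinh 0 \<le> x * cosh x - sinh x"
  proof (rule DERIV_nonneg_imp_nondecreasing[OF x])
    fix y :: real assume "0 \<le> y" "y \<le> x"
    then show "\<exists>d. ((\<lambda>x. x * cosh x - sinh x) has_real_derivative d) (at y) \<and> 0 \<le> d"
      by (intro exI[of _ "y * sinh y"]) (auto intro!: derivative_eq_intros simp: algebra_simps)
  qed
  then show ?thesis by simp
qed

lemma cosh_le_exp: "0 \<le> x \<Longrightarrow> cosh x \<le> exp (x::real)"
  by (simp add: cosh_field_def)

lemma exp_le_2_cosh: "exp x \<le> 2 * cosh (x::real)"
  by (simp add: cosh_field_def)

lemma abs_sinh_div_le:
  fixes a t :: real
  assumes "t > 0"
  shows "\<bar>sinh (a * t) / t\<bar> \<le> \<bar>a\<bar> * exp (\<bar>a\<bar> * t)"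
proof -
  have "\<bar>sinh (a * t)\<bar> = sinh (\<bar>a\<bar> * t)"
    using assms by (cases "a \<ge> 0") (auto simp: mult_nonpos_nonneg mult_less_0_iff sinh_minus abs_mult)
  also have "\<dots> \<le> \<bar>a\<bar> * t * cosh (\<bar>a\<bar> * t)"
    using assms by (intro sinh_le_mult_cosh) auto
  also have "\<dots> \<le> \<bar>a\<bar> * t * exp (\<bar>a\<bar> * t)"
    using assms by (intro mult_left_mono cosh_le_exp) auto
  finally show ?thesis using assms by (simp add: field_simps abs_mult)
qed

text \<open>\<open>lntan x\<close> is \<open>ln tan(\<pi>x/2)\<close>. Dividing its integrand by \<open>2 cosh(\<alpha>t/2)\<close> and recentring solves
  both functional equations for \<open>L = ltan \<alpha>\<close>, because \<open>dt/t\<close> is scale invariant.\<close>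

definition lntan :: "real \<Rightarrow> real" where
  "lntan x = (LBINT t:{0<..}. sinh ((x - 1/2) * t) / (t * cosh (t / 2)))"

definition ltan :: "real \<Rightarrow> real \<Rightarrow> real" where
  "ltan \<alpha> x = (LBINT t:{0<..}. sinh ((x - (1 + \<alpha>) / 2) * t) / (2 * t * cosh (\<alpha> * t / 2) * cosh (t / 2)))"

text \<open>The zero of sinh compensates 1/t at the origin, and at infinity the integrand decays
  like an exponential with rate b + c - |a|.\<close>

lemma integrable_ltan:
  fixes a b c :: real
  assumes "\<bar>a\<bar> < b + c"
  shows "set_integrable lborel {0<..} (\<lambda>t. sinh (a * t) / (2 * t * cosh (b * t) * cosh (c * t)))"
proof (rule set_integrable_dominated_exp[where e = "b + c - \<bar>a\<bar>" and B = "2 * \<bar>a\<bar>"])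
  fix t :: real assume t: "t > 0"
  have "\<bar>sinh (a * t) / (2 * t * cosh (b * t) * cosh (c * t))\<bar> =
      \<bar>sinh (a * t) / t\<bar> / (2 * (cosh (b * t) * cosh (c * t)))"
    by (simp add: abs_mult)
  also have "\<dots> \<le> (\<bar>a\<bar> * exp (\<bar>a\<bar> * t)) / (2 * (exp (b * t) / 2 * (exp (c * t) / 2)))"
    using t exp_le_2_cosh[of "b * t"] exp_le_2_cosh[of "c * t"]
    by (intro frac_le abs_sinh_div_le mult_left_mono mult_mono) auto
  also have "\<dots> = 2 * \<bar>a\<bar> * exp (- (b + c - \<bar>a\<bar>) * t)"
    by (simp add: exp_diff exp_minus exp_add algebra_simps divide_simps)
  finally show "\<bar>sinh (a * t) / (2 * t * cosh (b * t) * cosh (c * t))\<bar>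
    \<le> 2 * \<bar>a\<bar> * exp (- (b + c - \<bar>a\<bar>) * t)" .
qed (use assms in auto)

lemma sinh_add_sub: "sinh (x + y) + sinh (x - y) = 2 * sinh x * cosh (y::real)"
  by (simp add: sinh_add sinh_diff)

lemma set_integrable_ltan':
  fixes \<alpha> x :: real
  assumes "0 < x" "x < 1 + \<alpha>"
  shows "set_integrable lborel {0<..}
    (\<lambda>t. sinh ((x - (1 + \<alpha>) / 2) * t) / (2 * t * cosh (\<alpha> * t / 2) * cosh (t / 2)))"
  using integrable_ltan[of "x - (1 + \<alpha>) / 2" "\<alpha> / 2" "1 / 2"] assms by (simp add: abs_less_iff field_simps)

text \<open>After centring, the two arguments are \<open>x - 1/2\<close> minus and plus
  \<open>\<alpha> / 2\<close>, so the hyperbolic sines add up to one at \<open>x - 1/2\<close> times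
  \<open>2 * cosh (\<alpha> * t / 2)\<close>, which cancels in the denominator.\<close>

lemma ltan_shift_alpha:
  assumes "0 < x" "x < 1" "\<alpha> > 0"
  shows "ltan \<alpha> x + ltan \<alpha> (x + \<alpha>) = lntan x"
proof -
  have "ltan \<alpha> x + ltan \<alpha> (x + \<alpha>) = (LBINT t:{0<..}.
     sinh ((x - (1 + \<alpha>) / 2) * t) / (2 * t * cosh (\<alpha> * t / 2) * cosh (t / 2)) +
     sinh ((x + \<alpha> - (1 + \<alpha>) / 2) * t) / (2 * t * cosh (\<alpha> * t / 2) * cosh (t / 2)))"
    unfolding ltan_def using assms by (intro set_integral_add(2)[symmetric] set_integrable_ltan') auto
  also have "\<dots> = lntan x"
    unfolding lntan_def
  proof (rule set_lebesgue_integral_cong)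
    have "sinh ((x - (1 + \<alpha>) / 2) * t) + sinh ((x + \<alpha> - (1 + \<alpha>) / 2) * t)
        = 2 * sinh ((x - 1/2) * t) * cosh (\<alpha> * t / 2)" for t
      using sinh_add_sub[of "(x - 1/2) * t" "\<alpha> * t / 2"]
      by (simp add: algebra_simps diff_divide_distrib add_divide_distrib)
    then show "\<forall>t. t \<in> {0<..} \<longrightarrow>
       sinh ((x - (1 + \<alpha>) / 2) * t) / (2 * t * cosh (\<alpha> * t / 2) * cosh (t / 2)) +
       sinh ((x + \<alpha> - (1 + \<alpha>) / 2) * t) / (2 * t * cosh (\<alpha> * t / 2) * cosh (t / 2))
       = sinh ((x - 1/2) * t) / (t * cosh (t / 2))"
      by (simp flip: add_divide_distrib)
  qed auto
  finally show ?thesis .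
qed

lemma set_integral_scale_Ioi:
  fixes f :: "real \<Rightarrow> real"
  assumes "s > 0"
  shows "(LBINT t:{0<..}. f t) = s * (LBINT t:{0<..}. f (s * t))"
  unfolding set_lebesgue_integral_def
  using assms by (subst lborel_integral_real_affine[where c = s and t = 0])
     (auto simp: indicator_def zero_less_mult_iff intro!: Bochner_Integration.integral_cong)

lemma lntan_scale:
  assumes "\<alpha> > 0"
  shows "lntan (x / \<alpha>) = (LBINT t:{0<..}. sinh ((x - \<alpha> / 2) * t) / (t * cosh (\<alpha> * t / 2)))"
  unfolding lntan_def
  by (subst set_integral_scale_Ioi[OF assms])
     (use assms in \<open>auto simp: set_lebesgue_integral_def indicator_def field_simps
        simp flip: Bochner_Integration.integral_mult_right_zero intro!: Bochner_Integration.integral_cong\<close>)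

lemma ltan_shift_1:
  assumes "0 < x" "x < \<alpha>" "\<alpha> > 0"
  shows "ltan \<alpha> x + ltan \<alpha> (x + 1) = lntan (x / \<alpha>)"
proof -
  have "ltan \<alpha> x + ltan \<alpha> (x + 1) = (LBINT t:{0<..}.
     sinh ((x - (1 + \<alpha>) / 2) * t) / (2 * t * cosh (\<alpha> * t / 2) * cosh (t / 2)) +
     sinh ((x + 1 - (1 + \<alpha>) / 2) * t) / (2 * t * cosh (\<alpha> * t / 2) * cosh (t / 2)))"
    unfolding ltan_def using assms by (intro set_integral_add(2)[symmetric] set_integrable_ltan') auto
  also have "\<dots> = lntan (x / \<alpha>)"
    unfolding lntan_scale[OF assms(3)]
  proof (rule set_lebesgue_integral_cong)
    have "sinh ((x - (1 + \<alpha>) / 2) * t) + sinh ((x + 1 - (1 + \<alpha>) / 2) * t)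
        = 2 * sinh ((x - \<alpha> / 2) * t) * cosh (t / 2)" for t
      using sinh_add_sub[of "(x - \<alpha> / 2) * t" "t / 2"]
      by (simp add: algebra_simps diff_divide_distrib add_divide_distrib)
    then show "\<forall>t. t \<in> {0<..} \<longrightarrow>
       sinh ((x - (1 + \<alpha>) / 2) * t) / (2 * t * cosh (\<alpha> * t / 2) * cosh (t / 2)) +
       sinh ((x + 1 - (1 + \<alpha>) / 2) * t) / (2 * t * cosh (\<alpha> * t / 2) * cosh (t / 2))
       = sinh ((x - \<alpha> / 2) * t) / (t * cosh (\<alpha> * t / 2))"
      by (simp flip: add_divide_distrib)
  qed auto
  finally show ?thesis .
qed

lemma ltan_reflect: "ltan \<alpha> (1 + \<alpha> - x) = - ltan \<alpha> x"
proof -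
  have "(1 + \<alpha> - x - (1 + \<alpha>) / 2) * t = - ((x - (1 + \<alpha>) / 2) * t)" for t :: real
    by (simp add: field_simps)
  then show ?thesis
    unfolding ltan_def by (simp add: sinh_minus set_lebesgue_integral_def)
qed

lemma lntan_reflect: "lntan (1 - x) = - lntan x"
proof -
  have "(1 - x - 1 / 2) * t = - ((x - 1 / 2) * t)" for t :: real
    by (simp add: field_simps)
  then show ?thesis
    unfolding lntan_def by (simp add: sinh_minus set_lebesgue_integral_def)
qed

lemma ltan_mono:
  assumes "0 < x" "x \<le> y" "y < 1 + \<alpha>"
  shows "ltan \<alpha> x \<le> ltan \<alpha> y"
  unfolding ltan_def
proof (rule set_integral_mono)
  fix t :: real assume "t \<in> {0<..}"
  then show "sinh ((x - (1 + \<alpha>) / 2) * t) / (2 * t * cosh (\<alpha> * t / 2) * cosh (t / 2))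
    \<le> sinh ((y - (1 + \<alpha>) / 2) * t) / (2 * t * cosh (\<alpha> * t / 2) * cosh (t / 2))"
    using assms by (intro divide_right_mono) auto
qed (use assms in \<open>auto intro!: set_integrable_ltan'\<close>)

text \<open>By antisymmetry about (1 + \<alpha>)/2 and monotonicity only the value at 1 + \<alpha>/2
  matters. It is \<open>lntan (1 - \<alpha> / 2)\<close> minus the value at 1 - \<alpha>/2, and the
  latter is nonnegative because \<alpha> \<le> 1/2 puts that point to the right of the
  centre.\<close>

lemma abs_ltan_le:
  assumes \<alpha>: "0 < \<alpha>" "\<alpha> \<le> 1/2" and x: "\<alpha> / 2 \<le> x" "x \<le> 1 + \<alpha> / 2"
  shows "\<bar>ltan \<alpha> x\<bar> \<le> lntan (1 - \<alpha> / 2)"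
proof -
  have "0 \<le> ltan \<alpha> (1 - \<alpha> / 2)"
  proof -
    have "ltan \<alpha> ((1 + \<alpha>) / 2) = 0" using ltan_reflect[of \<alpha> "(1 + \<alpha>) / 2"] by (simp add: field_simps)
    then show ?thesis using ltan_mono[of "(1 + \<alpha>) / 2" "1 - \<alpha> / 2" \<alpha>] \<alpha> by (simp add: field_simps)
  qed
  then have b: "ltan \<alpha> (1 + \<alpha> / 2) \<le> lntan (1 - \<alpha> / 2)"
    using ltan_shift_alpha[of "1 - \<alpha> / 2" \<alpha>] \<alpha> by (simp add: field_simps)
  have "ltan \<alpha> x \<le> ltan \<alpha> (1 + \<alpha> / 2)" using ltan_mono[of x "1 + \<alpha> / 2" \<alpha>] \<alpha> x by simp
  moreover have "ltan \<alpha> (\<alpha> / 2) \<le> ltan \<alpha> x" using ltan_mono[of "\<alpha> / 2" x \<alpha>] \<alpha> x by simp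
  moreover have "ltan \<alpha> (\<alpha> / 2) = - ltan \<alpha> (1 + \<alpha> / 2)" using ltan_reflect[of \<alpha> "1 + \<alpha> / 2"] by simp
  ultimately show ?thesis using b by linarith
qed

section \<open>Integral representation of the logarithmic sine\<close>

lemma nn_integral_sinh_exp:
  fixes s c :: real
  assumes "0 \<le> s" "s < c"
  shows "(\<integral>\<^sup>+t. ennreal (sinh (s * t) * exp (- c * t)) * indicator {0..} t \<partial>lborel) = ennreal (s / (c\<^sup>2 - s\<^sup>2))"
proof -
  define H where "H t = (1/2) * (exp ((s - c) * t) / (s - c) - exp (- (s + c) * t) / (- (s + c)))" for t
  have D: "((\<lambda>t. exp (k * t) / k) has_real_derivative exp (k * t)) (at t)" if "k \<noteq> 0" for k t :: real
    using that by (auto intro!: derivative_eq_intros)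
  have "(\<integral>\<^sup>+t. ennreal (sinh (s * t) * exp (- c * t)) * indicator {0..} t \<partial>lborel) = ennreal (0 - H 0)"
  proof (rule nn_integral_FTC_atLeast)
    fix t :: real assume "0 \<le> t"
    have "(H has_real_derivative (1/2) * (exp ((s - c) * t) - exp (- (s + c) * t))) (at t)"
      unfolding H_def using assms by (intro DERIV_cmult DERIV_diff D) auto
    also have "(1/2) * (exp ((s - c) * t) - exp (- (s + c) * t)) = sinh (s * t) * exp (- c * t)"
      by (simp add: sinh_field_def algebra_simps flip: exp_add)
    finally show "DERIV H t :> sinh (s * t) * exp (- c * t)" .
    show "0 \<le> sinh (s * t) * exp (- c * t)" using assms \<open>0 \<le> t\<close> by simp
  next
    have E: "((\<lambda>t. exp (k * t) / k) \<longlongrightarrow> 0) at_top" if "k < 0" for k :: real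
    proof -
      have "((\<lambda>t. exp (k * t)) \<longlongrightarrow> 0) at_top" using that by real_asymp
      then show ?thesis using tendsto_divide_0[OF _ ] tendsto_mult_left_zero[of _ _ "1 / k"] by fastforce
    qed
    have "((\<lambda>t. exp ((s - c) * t) / (s - c) - exp (- (s + c) * t) / (- (s + c))) \<longlongrightarrow> 0 - 0) at_top"
      using assms by (intro tendsto_diff E) auto
    then have "((\<lambda>t. (1/2) * (exp ((s - c) * t) / (s - c) - exp (- (s + c) * t) / (- (s + c)))) \<longlongrightarrow> (1/2) * (0 - 0)) at_top"
      by (rule tendsto_mult_left)
    then show "(H \<longlongrightarrow> 0) at_top" unfolding H_def by simp
  qed measurable
  also have "0 - H 0 = s / (c\<^sup>2 - s\<^sup>2)"
  proof -
    have "c\<^sup>2 - s\<^sup>2 = (c - s) * (c + s)" by (simp add: power2_eq_square algebra_simps)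
    then show ?thesis using assms by (simp add: H_def divide_simps) (simp add: algebra_simps)
  qed
  finally show ?thesis .
qed

text \<open>Writing \<open>(cosh (a * t) - 1) / t\<close> as the integral of
  \<open>sinh (s * t)\<close> over s from 0 to a, Fubini reduces this to the Laplace transform of
  sinh.\<close>

lemma nn_integral_cosh_exp:
  fixes a c :: real
  assumes "0 \<le> a" "a < c"
  shows "(\<integral>\<^sup>+t. ennreal ((cosh (a * t) - 1) / t * exp (- c * t)) * indicator {0<..} t \<partial>lborel)
     = ennreal (- ln (1 - (a / c)\<^sup>2) / 2)"
proof -
  have sq: "s\<^sup>2 < c\<^sup>2" if "0 \<le> s" "s \<le> a" for s
    using that assms by (intro power_strict_mono) auto
  have "(\<integral>\<^sup>+t. ennreal ((cosh (a * t) - 1) / t * exp (- c * t)) * indicator {0<..} t \<partial>lborel)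
     = (\<integral>\<^sup>+t. (\<integral>\<^sup>+s. ennreal (sinh (s * t) * exp (- c * t)) * indicator {0<..} t * indicator {0..a} s \<partial>lborel) \<partial>lborel)"
  proof (rule nn_integral_cong)
    fix t :: real
    show "ennreal ((cosh (a * t) - 1) / t * exp (- c * t)) * indicator {0<..} t =
      (\<integral>\<^sup>+s. ennreal (sinh (s * t) * exp (- c * t)) * indicator {0<..} t * indicator {0..a} s \<partial>lborel)"
    proof (cases "t > 0")
      case True
      have "(\<integral>\<^sup>+s. ennreal (sinh (s * t) * exp (- c * t)) * indicator {0..a} s \<partial>lborel)
         = ennreal (cosh (a * t) / t * exp (- c * t) - cosh (0 * t) / t * exp (- c * t))"
        by (rule nn_integral_FTC_Icc[where F = "\<lambda>s. cosh (s * t) / t * exp (- c * t)"])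
           (use True assms in \<open>auto intro!: derivative_eq_intros\<close>)
      also have "cosh (a * t) / t * exp (- c * t) - cosh (0 * t) / t * exp (- c * t)
         = (cosh (a * t) - 1) / t * exp (- c * t)" by (simp add: diff_divide_distrib left_diff_distrib)
      finally show ?thesis using True by simp
    qed simp
  qed
  also have "\<dots> = (\<integral>\<^sup>+s. (\<integral>\<^sup>+t. ennreal (sinh (s * t) * exp (- c * t)) * indicator {0<..} t * indicator {0..a} s \<partial>lborel) \<partial>lborel)"
    by (rule lborel_pair.Fubini'[of "\<lambda>s t. ennreal (sinh (s * t) * exp (- c * t)) * indicator {0<..} t * indicator {0..a} s"])
       measurable
  also have "\<dots> = (\<integral>\<^sup>+s. ennreal (s / (c\<^sup>2 - s\<^sup>2)) * indicator {0..a} s \<partial>lborel)"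
  proof (rule nn_integral_cong)
    fix s :: real
    show "(\<integral>\<^sup>+t. ennreal (sinh (s * t) * exp (- c * t)) * indicator {0<..} t * indicator {0..a} s \<partial>lborel)
       = ennreal (s / (c\<^sup>2 - s\<^sup>2)) * indicator {0..a} s"
    proof (cases "s \<in> {0..a}")
      case True
      have "(\<integral>\<^sup>+t. ennreal (sinh (s * t) * exp (- c * t)) * indicator {0<..} t * indicator {0..a} s \<partial>lborel)
         = (\<integral>\<^sup>+t. ennreal (sinh (s * t) * exp (- c * t)) * indicator {0..} t \<partial>lborel)"
        using True by (intro nn_integral_cong) (auto simp: indicator_def)
      also have "\<dots> = ennreal (s / (c\<^sup>2 - s\<^sup>2))"
        using True assms by (intro nn_integral_sinh_exp) auto
      finally show ?thesis using True by simp
    qed simp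
  qed
  also have "\<dots> = ennreal (- ln (c\<^sup>2 - a\<^sup>2) / 2 - - ln (c\<^sup>2 - 0\<^sup>2) / 2)"
  proof (rule nn_integral_FTC_Icc)
    fix s assume "s \<in> {0..a}"
    then have s: "0 \<le> s" "s \<le> a" by auto
    show "((\<lambda>s. - ln (c\<^sup>2 - s\<^sup>2) / 2) has_real_derivative s / (c\<^sup>2 - s\<^sup>2)) (at s)"
      using sq[OF s] by (auto intro!: derivative_eq_intros simp: field_simps)
    show "0 \<le> s / (c\<^sup>2 - s\<^sup>2)" using sq[OF s] s by simp
  qed (use assms in auto)
  also have "- ln (c\<^sup>2 - a\<^sup>2) / 2 - - ln (c\<^sup>2 - 0\<^sup>2) / 2 = - ln (1 - (a / c)\<^sup>2) / 2"
  proof -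
    have "1 - (a / c)\<^sup>2 = (c\<^sup>2 - a\<^sup>2) / c\<^sup>2"
      using assms by (simp add: power_divide field_simps)
    then show ?thesis using sq[of a] assms by (simp add: ln_div)
  qed
  finally show ?thesis .
qed

lemma inverse_sinh_series:
  fixes t :: real
  assumes "t > 0"
  shows "(\<lambda>k. 2 * exp (- (real k + 1/2) * t)) sums (1 / sinh (t / 2))"
proof -
  have "(\<lambda>k. exp (- t) ^ k) sums (1 / (1 - exp (- t)))"
    using assms by (intro geometric_sums) auto
  then have "(\<lambda>k. (2 * exp (- t / 2)) * exp (- t) ^ k) sums ((2 * exp (- t / 2)) * (1 / (1 - exp (- t))))"
    by (rule sums_mult)
  also have "(\<lambda>k. (2 * exp (- t / 2)) * exp (- t) ^ k) = (\<lambda>k. 2 * exp (- (real k + 1/2) * t))"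
    by (simp add: exp_of_nat_mult[symmetric] algebra_simps flip: exp_add)
  also have "(2 * exp (- t / 2)) * (1 / (1 - exp (- t))) = 1 / sinh (t / 2)"
  proof -
    define e where "e = exp (- t / 2)"
    have e: "0 < e" "e < 1" using assms by (auto simp: e_def)
    have "e * e < 1" using e mult_strict_mono[of e 1 e 1] by simp
    moreover have "exp (- t) = e * e" "exp (t / 2) = 1 / e" "exp (- (t / 2)) = e"
      by (simp_all add: e_def exp_minus divide_simps flip: exp_add)
    ultimately have "sinh (t / 2) = (1 - e * e) / (2 * e)" "1 - e * e \<noteq> 0"
      using e by (simp_all add: sinh_field_def diff_divide_distrib)
    then show ?thesis
      using \<open>exp (- t) = e * e\<close> \<open>exp (- (t / 2)) = e\<close> by simp
  qed
  finally show ?thesis .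
qed

text \<open>Since cos(\<pi>a) is sin(2\<pi>a) / (2 sin(\<pi>a)), it is a quotient of two sine
  products. The even factors of the first cancel the second, and the odd ones remain.\<close>

lemma cos_product_limit:
  fixes a :: real
  assumes "\<bar>a\<bar> < 1/2"
  shows "(\<lambda>n. \<Prod>k<n. 1 - (a / (real k + 1/2))\<^sup>2) \<longlonglongrightarrow> cos (pi * a)"
proof (cases "a = 0")
  case False
  define f where "f x k = 1 - x\<^sup>2 / (real k)\<^sup>2" for x :: real and k :: nat
  have s2: "sin (pi * (2 * a)) \<noteq> 0" "sin (pi * a) \<noteq> 0"
    using assms False sin_zero_iff_int2 by (auto simp: sin_zero_iff_int2 abs_less_iff)
      (smt (verit, best) of_int_less_iff of_int_1 of_int_minus of_int_0 of_int_eq_iff)+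
  have A: "(\<lambda>n. \<Prod>k=1..n. f x k) \<longlonglongrightarrow> sin (pi * x) / (pi * x)" if "x \<noteq> 0" for x
    using sin_product_formula_real'[OF that] by (simp add: f_def)
  have "(\<lambda>n. (\<Prod>k=1..2*n. f (2 * a) k) / (\<Prod>k=1..n. f a k)) \<longlonglongrightarrow>
     (sin (pi * (2 * a)) / (pi * (2 * a))) / (sin (pi * a) / (pi * a))"
  proof (rule tendsto_divide)
    show "(\<lambda>n. \<Prod>k=1..2*n. f (2 * a) k) \<longlonglongrightarrow> sin (pi * (2 * a)) / (pi * (2 * a))"
      using LIMSEQ_subseq_LIMSEQ[OF A[of "2 * a"], of "\<lambda>n. 2 * n"] False
      by (simp add: strict_mono_def o_def)
  qed (use A[of a] False s2 in auto)
  also have "(sin (pi * (2 * a)) / (pi * (2 * a))) / (sin (pi * a) / (pi * a)) = cos (pi * a)"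
    using s2 False sin_double[of "pi * a"] by (simp add: field_simps mult.left_commute)
  also have "(\<lambda>n. (\<Prod>k=1..2*n. f (2 * a) k) / (\<Prod>k=1..n. f a k))
      = (\<lambda>n. \<Prod>k<n. 1 - (a / (real k + 1/2))\<^sup>2)"
  proof
    fix n
    have nz: "(\<Prod>k=1..n. f a k) \<noteq> 0"
    proof -
      have "f a k \<noteq> 0" if "k \<in> {1..n}" for k
      proof -
        have "\<bar>a\<bar> < real k" using that assms by auto
        then have "a\<^sup>2 < (real k)\<^sup>2" by (metis abs_of_nat power2_strict_mono)
        then show ?thesis by (auto simp: f_def field_simps)
      qed
      then show ?thesis by simp
    qed
    have "(\<Prod>k=1..2*n. f (2 * a) k) = (\<Prod>k=1..n. f a k) * (\<Prod>k<n. 1 - (a / (real k + 1/2))\<^sup>2)"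
    proof (induction n)
      case (Suc n)
      have "2 * a / real (2 * n + 2) = a / real (n + 1)"
        "2 * a / real (2 * n + 1) = a / (real n + 1/2)" by (simp_all add: divide_simps)
      then have "f (2 * a) (2 * n + 2) = f a (n + 1)"
        "f (2 * a) (2 * n + 1) = 1 - (a / (real n + 1/2))\<^sup>2"
        unfolding f_def by (metis power_divide)+
      moreover have "(\<Prod>k=1..2 * Suc n. f (2 * a) k)
         = (\<Prod>k=1..2*n. f (2 * a) k) * f (2 * a) (2 * n + 1) * f (2 * a) (2 * n + 2)"
        by (simp add: numeral_2_eq_2)
      ultimately show ?case using Suc.IH by simp
    qed simp
    then show "(\<Prod>k=1..2*n. f (2 * a) k) / (\<Prod>k=1..n. f a k) = (\<Prod>k<n. 1 - (a / (real k + 1/2))\<^sup>2)"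
      using nz by simp
  qed
  finally show ?thesis .
qed simp

text \<open>Expanding \<open>1 / sinh (t / 2)\<close> into exponentials turns the integral term by
  term into minus the logarithm of the product for the cosine; all terms are nonnegative.\<close>

lemma nn_integral_cosh_sinh:
  fixes a :: real
  assumes "0 \<le> a" "a < 1/2"
  shows "(\<integral>\<^sup>+t. ennreal ((cosh (a * t) - 1) / (t * sinh (t / 2))) * indicator {0<..} t \<partial>lborel)
     = ennreal (- ln (cos (pi * a)))"
proof -
  define h where "h k t = (cosh (a * t) - 1) / t * exp (- (real k + 1/2) * t)" for k t
  have h0: "0 \<le> h k t" if "t > 0" for k t
    using that cosh_real_ge_1[of "a * t"] by (simp add: h_def)
  have "(\<integral>\<^sup>+t. ennreal ((cosh (a * t) - 1) / (t * sinh (t / 2))) * indicator {0<..} t \<partial>lborel)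
     = (\<integral>\<^sup>+t. (\<Sum>k. 2 * (ennreal (h k t) * indicator {0<..} t)) \<partial>lborel)"
  proof (rule nn_integral_cong)
    fix t :: real
    show "ennreal ((cosh (a * t) - 1) / (t * sinh (t / 2))) * indicator {0<..} t
      = (\<Sum>k. 2 * (ennreal (h k t) * indicator {0<..} t))"
    proof (cases "t > 0")
      case True
      have "(\<lambda>k. (cosh (a * t) - 1) / t * (2 * exp (- (real k + 1/2) * t))) sums
          ((cosh (a * t) - 1) / t * (1 / sinh (t / 2)))"
        by (intro sums_mult inverse_sinh_series True)
      then have "(\<lambda>k. 2 * h k t) sums ((cosh (a * t) - 1) / (t * sinh (t / 2)))"
        by (simp add: h_def mult_ac)
      then have "(\<Sum>k. ennreal (2 * h k t)) = ennreal ((cosh (a * t) - 1) / (t * sinh (t / 2)))"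
        using h0[OF True] by (subst suminf_ennreal2) (auto simp: sums_iff)
      then show ?thesis using True h0[OF True] by (simp add: ennreal_mult)
    qed simp
  qed
  also have "\<dots> = (\<Sum>k. \<integral>\<^sup>+t. 2 * (ennreal (h k t) * indicator {0<..} t) \<partial>lborel)"
    unfolding h_def by (rule nn_integral_suminf) measurable
  also have "\<dots> = (\<Sum>k. ennreal (- ln (1 - (a / (real k + 1/2))\<^sup>2)))"
  proof (rule suminf_cong)
    fix k :: nat
    have "(\<integral>\<^sup>+t. 2 * (ennreal (h k t) * indicator {0<..} t) \<partial>lborel)
       = 2 * (\<integral>\<^sup>+t. ennreal (h k t) * indicator {0<..} t \<partial>lborel)"
      unfolding h_def by (rule nn_integral_cmult) measurable
    also have "\<dots> = 2 * ennreal (- ln (1 - (a / (real k + 1/2))\<^sup>2) / 2)"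
      unfolding h_def using assms by (subst nn_integral_cosh_exp) auto
    also have "\<dots> = ennreal (- ln (1 - (a / (real k + 1/2))\<^sup>2))"
      by (subst ennreal_numeral[symmetric], subst ennreal_mult'[symmetric]) auto
    finally show "(\<integral>\<^sup>+t. 2 * (ennreal (h k t) * indicator {0<..} t) \<partial>lborel) = \<dots>" .
  qed
  also have "\<dots> = ennreal (- ln (cos (pi * a)))"
  proof -
    have b: "0 < 1 - (a / (real k + 1/2))\<^sup>2 \<and> 1 - (a / (real k + 1/2))\<^sup>2 \<le> 1" for k
    proof -
      have "a / (real k + 1/2) < 1" "0 \<le> a / (real k + 1/2)" using assms by auto
      then have "(a / (real k + 1/2))\<^sup>2 < 1" by (simp add: power_less_one_iff)
      then show ?thesis by simp
    qed
    have c: "cos (pi * a) > 0" using assms by (intro cos_gt_zero_pi) (auto simp: field_simps, smt (verit) mult_nonneg_nonneg pi_gt_zero)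
    have "(\<lambda>n. ln (\<Prod>k<n. 1 - (a / (real k + 1/2))\<^sup>2)) \<longlonglongrightarrow> ln (cos (pi * a))"
      using assms c by (intro tendsto_ln cos_product_limit) auto
    moreover have "ln (\<Prod>k<n. 1 - (a / (real k + 1/2))\<^sup>2) = (\<Sum>k<n. ln (1 - (a / (real k + 1/2))\<^sup>2))" for n
      by (intro ln_prod) (use b in \<open>auto, metis less_irrefl\<close>)
    ultimately have "(\<lambda>k. ln (1 - (a / (real k + 1/2))\<^sup>2)) sums ln (cos (pi * a))"
      by (simp add: sums_def)
    then have "(\<lambda>k. - ln (1 - (a / (real k + 1/2))\<^sup>2)) sums (- ln (cos (pi * a)))"
      by (rule sums_minus)
    moreover have "0 \<le> - ln (1 - (a / (real k + 1/2))\<^sup>2)" for k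
      using b[of k] by simp
    ultimately show ?thesis
      by (subst suminf_ennreal2) (auto simp: sums_iff)
  qed
  finally show ?thesis .
qed

text \<open>Jordan's inequality, from concavity of the sine between 0 and \<pi>/2.\<close>

lemma sin_ge_two_div_pi:
  assumes "0 \<le> x" "x \<le> 1"
  shows "x \<le> sin (pi * x / 2)"
proof -
  have "convex_on {0..pi} (\<lambda>x. - sin x)"
    by (rule f''_ge0_imp_convex[where f' = "\<lambda>x. - cos x" and f'' = sin])
       (auto intro!: derivative_eq_intros sin_ge_zero)
  then have "- sin ((1 - x) *\<^sub>R 0 + x *\<^sub>R (pi / 2)) \<le> (1 - x) * (- sin 0) + x * (- sin (pi / 2))"
    by (rule convex_onD) (use assms pi_ge_zero in \<open>auto simp del: pi_ge_zero\<close>)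
  then show ?thesis by (simp add: mult.commute)
qed

lemma
  assumes "0 < x" "x < 1"
  shows integrable_ln_sin: "set_integrable lborel {0<..} (\<lambda>t. (1 - cosh ((x - 1/2) * t)) / (t * sinh (t / 2)))"
    and integral_ln_sin: "(LBINT t:{0<..}. (1 - cosh ((x - 1/2) * t)) / (t * sinh (t / 2))) = ln (sin (pi * x))"
proof -
  define a where "a = \<bar>x - 1/2\<bar>"
  have a: "0 \<le> a" "a < 1/2" using assms by (auto simp: a_def abs_if)
  have ca: "cosh ((x - 1/2) * t) = cosh (a * t)" for t
    by (metis a_def abs_mult abs_idempotent cosh_real_abs)
  have "pi * a = \<bar>pi * (x - 1/2)\<bar>" by (simp add: a_def abs_mult)
  then have "cos (pi * a) = cos (pi * (x - 1/2))" by (simp only: cos_abs_real)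
  also have "\<dots> = sin (pi * x)" by (simp add: right_diff_distrib cos_diff)
  finally have c: "cos (pi * a) = sin (pi * x)" .
  have pos: "0 \<le> (cosh (a * t) - 1) / (t * sinh (t / 2))" if "t > 0" for t
    using that cosh_real_ge_1[of "a * t"] by simp
  have s: "0 < sin (pi * x)" "sin (pi * x) \<le> 1" using assms by (auto intro: sin_gt_zero)
  have "(\<integral>\<^sup>+t. ennreal (indicator {0<..} t *\<^sub>R ((cosh (a * t) - 1) / (t * sinh (t / 2)))) \<partial>lborel)
     = (\<integral>\<^sup>+t. ennreal ((cosh (a * t) - 1) / (t * sinh (t / 2))) * indicator {0<..} t \<partial>lborel)"
    by (intro nn_integral_cong) (auto simp: indicator_def)
  also have "\<dots> = ennreal (- ln (sin (pi * x)))"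
    using nn_integral_cosh_sinh[OF a] by (simp add: c)
  finally have "has_bochner_integral lborel
      (\<lambda>t. indicator {0<..} t *\<^sub>R ((cosh (a * t) - 1) / (t * sinh (t / 2)))) (- ln (sin (pi * x)))"
    using s pos by (intro has_bochner_integral_nn_integral) (auto intro!: AE_I2 simp: indicator_def)
  then have "has_bochner_integral lborel
      (\<lambda>t. - (indicator {0<..} t *\<^sub>R ((cosh (a * t) - 1) / (t * sinh (t / 2))))) (- (- ln (sin (pi * x))))"
    by (rule has_bochner_integral_minus)
  also have "(\<lambda>t. - (indicator {0<..} t *\<^sub>R ((cosh (a * t) - 1) / (t * sinh (t / 2)))))
     = (\<lambda>t. indicator {0<..} t *\<^sub>R ((1 - cosh ((x - 1/2) * t)) / (t * sinh (t / 2))))"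
    by (simp add: ca fun_eq_iff minus_divide_left flip: mult_minus_right)
  finally show "set_integrable lborel {0<..} (\<lambda>t. (1 - cosh ((x - 1/2) * t)) / (t * sinh (t / 2)))"
    and "(LBINT t:{0<..}. (1 - cosh ((x - 1/2) * t)) / (t * sinh (t / 2))) = ln (sin (pi * x))"
    by (auto simp: set_integrable_def set_lebesgue_integral_def has_bochner_integral_iff)
qed

lemma cosh_diff_cosh: "cosh x - cosh y = 2 * sinh ((x + y) / 2) * sinh ((x - y) / (2::real))"
proof -
  have "cosh x = cosh ((x + y) / 2 + (x - y) / 2)" "cosh y = cosh ((x + y) / 2 - (x - y) / 2)"
    by (simp_all add: field_simps)
  then show ?thesis by (simp only: cosh_add cosh_diff)
qed

text \<open>The second sine is the cosine of \<pi>x/2, so the right side is ln tan(\<pi>x/2). The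
  difference of the two integrals for ln sin has a product of hyperbolic sines as numerator; the
  double angle formula for \<open>sinh (t / 2)\<close> leaves the integrand of \<open>lntan\<close>
  at \<open>t / 2\<close>.\<close>

lemma lntan_eq:
  assumes "0 < x" "x < 1"
  shows "lntan x = ln (sin (pi * (x / 2))) - ln (sin (pi * ((x + 1) / 2)))"
proof -
  have "ln (sin (pi * (x / 2))) - ln (sin (pi * ((x + 1) / 2))) = (LBINT t:{0<..}.
     (1 - cosh ((x / 2 - 1/2) * t)) / (t * sinh (t / 2)) - (1 - cosh (((x + 1) / 2 - 1/2) * t)) / (t * sinh (t / 2)))"
    using assms integral_ln_sin[of "x / 2"] integral_ln_sin[of "(x + 1) / 2"]
    by (subst set_integral_diff(2)) (auto intro!: integrable_ln_sin)
  also have "\<dots> = (LBINT t:{0<..}. (1/2) * (sinh ((x - 1/2) * (1/2 * t)) / ((1/2 * t) * cosh ((1/2 * t) / 2))))"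
  proof (rule set_lebesgue_integral_cong)
    have "(1 - cosh ((x / 2 - 1/2) * t)) / (t * sinh (t / 2)) - (1 - cosh (((x + 1) / 2 - 1/2) * t)) / (t * sinh (t / 2))
        = (1/2) * (sinh ((x - 1/2) * (1/2 * t)) / ((1/2 * t) * cosh ((1/2 * t) / 2)))" if "t > 0" for t
    proof -
      have "(1 - cosh ((x / 2 - 1/2) * t)) / (t * sinh (t / 2)) - (1 - cosh (((x + 1) / 2 - 1/2) * t)) / (t * sinh (t / 2))
        = (cosh (x / 2 * t) - cosh ((x / 2 - 1/2) * t)) / (t * sinh (t / 2))"
        by (simp add: add_divide_distrib flip: diff_divide_distrib)
      also have "cosh (x / 2 * t) - cosh ((x / 2 - 1/2) * t) = 2 * sinh ((x - 1/2) * (1/2 * t)) * sinh (t / 4)"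
        unfolding cosh_diff_cosh by (simp add: field_simps)
      also have "2 * sinh ((x - 1/2) * (1/2 * t)) * sinh (t / 4) / (t * sinh (t / 2))
          = (1/2) * (sinh ((x - 1/2) * (1/2 * t)) / ((1/2 * t) * cosh ((1/2 * t) / 2)))"
      proof -
        have s: "sinh (t / 2) = 2 * sinh (t / 4) * cosh (t / 4)"
          using sinh_double[of "t / 4"] by simp
        show ?thesis using that unfolding s by simp
      qed
      finally show ?thesis .
    qed
    then show "\<forall>t. t \<in> {0<..} \<longrightarrow> (1 - cosh ((x / 2 - 1/2) * t)) / (t * sinh (t / 2)) - (1 - cosh (((x + 1) / 2 - 1/2) * t)) / (t * sinh (t / 2))
        = (1/2) * (sinh ((x - 1/2) * (1/2 * t)) / ((1/2 * t) * cosh ((1/2 * t) / 2)))" by simp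
  qed auto
  also have "\<dots> = (1/2) * (LBINT t:{0<..}. (sinh ((x - 1/2) * (1/2 * t)) / ((1/2 * t) * cosh ((1/2 * t) / 2))))"
    by (simp only: set_lebesgue_integral_def Bochner_Integration.integral_mult_right_zero
        scaleR_conv_of_real of_real_eq_id id_apply mult.left_commute[of _ "1/2"])
  also have "\<dots> = lntan x"
    unfolding lntan_def by (rule set_integral_scale_Ioi[symmetric]) simp
  finally show ?thesis by simp
qed

text \<open>The tangent is a cotangent at the complementary angle, at most 1 / sin(\<pi>\<alpha>/4),
  and Jordan's inequality bounds that by 2/\<alpha>.\<close>

lemma lntan_one_minus_le:
  assumes "0 < \<alpha>" "\<alpha> < 2"
  shows "lntan (1 - \<alpha> / 2) \<le> ln (2 / \<alpha>)"
proof -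
  have j: "\<alpha> / 2 \<le> sin (pi * (\<alpha> / 2) / 2)" by (rule sin_ge_two_div_pi) (use assms in auto)
  have "sin (pi * ((1 - \<alpha> / 2 + 1) / 2)) = sin (pi * (\<alpha> / 2) / 2)"
  proof -
    have "pi * ((1 - \<alpha> / 2 + 1) / 2) = pi - pi * (\<alpha> / 2) / 2" by (simp add: field_simps)
    then show ?thesis by (simp only: sin_pi_minus)
  qed
  moreover have "ln (sin (pi * ((1 - \<alpha> / 2) / 2))) \<le> 0"
  proof (rule ln_le_zero_iff[THEN iffD2])
    show "0 < sin (pi * ((1 - \<alpha> / 2) / 2))"
      using assms by (intro sin_gt_zero) auto
  qed simp
  moreover have "- ln (sin (pi * (\<alpha> / 2) / 2)) \<le> - ln (\<alpha> / 2)"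
    using j assms by simp
  ultimately have "lntan (1 - \<alpha> / 2) \<le> - ln (\<alpha> / 2)"
    using lntan_eq[of "1 - \<alpha> / 2"] assms by simp
  then show ?thesis using assms by (simp add: ln_div)
qed

text \<open>The analogue of \<open>ltan \<alpha>\<close> for \<open>ln sin(\<pi>x)\<close>. Subtracting 1 from the hyperbolic cosine makes the integral
  converge at 0, at the cost of the constant \<open>lsin_defect \<alpha>\<close> in the functional equation.\<close>

definition lsin :: "real \<Rightarrow> real \<Rightarrow> real" where
  "lsin \<alpha> x = (LBINT t:{0<..}. (1 - cosh ((x - (1 + \<alpha>) / 2) * t)) / (2 * t * sinh (t / 2) * cosh (\<alpha> * t / 2)))"

definition lsin_defect :: "real \<Rightarrow> real" where
  "lsin_defect \<alpha> = (LBINT t:{0<..}. (1 - 1 / cosh (\<alpha> * t / 2)) / (t * sinh (t / 2)))"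

lemma cosh_minus_1_le:
  assumes "0 \<le> x"
  shows "cosh x - 1 \<le> x * sinh x / (2::real)"
proof -
  have "cosh x - 1 = 2 * sinh (x / 2) * sinh (x / 2)"
    using cosh_diff_cosh[of x 0] by simp
  also have "\<dots> \<le> 2 * sinh (x / 2) * (x / 2 * cosh (x / 2))"
    using assms by (intro mult_left_mono sinh_le_mult_cosh) auto
  also have "\<dots> = x * sinh x / 2" using sinh_double[of "x / 2"] by simp
  finally show ?thesis .
qed

lemma sinh_le_exp_mult_sinh:
  assumes "a \<le> c" "0 \<le> (t::real)"
  shows "sinh (a * t) \<le> exp (- (c - a) * t) * sinh (c * t)"
proof -
  have "exp (- (c - a) * t) * sinh (c * t) = (exp (a * t) - exp (a * t - 2 * c * t)) / 2"
    by (simp add: sinh_field_def algebra_simps flip: exp_add)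
  moreover have "a * t - 2 * c * t \<le> - (a * t)"
    using mult_right_mono[OF assms] by simp
  ultimately show ?thesis by (simp add: sinh_field_def)
qed

text \<open>For \<alpha> \<le> 1, the product-to-sum formula bounds
  \<open>2 * sinh (t / 2) * cosh (\<alpha> * t / 2)\<close> below by \<open>sinh (c * t)\<close>,
  and c = (1 + \<alpha>)/2 exceeds the distance of \<open>x\<close> from the centre c.\<close>

lemma integrable_lsin:
  fixes \<alpha> x :: real
  assumes x: "0 < x" "x < 1 + \<alpha>" and \<alpha>: "0 < \<alpha>" "\<alpha> \<le> 1"
  shows "set_integrable lborel {0<..}
    (\<lambda>t. (1 - cosh ((x - (1 + \<alpha>) / 2) * t)) / (2 * t * sinh (t / 2) * cosh (\<alpha> * t / 2)))"
proof -
  define c where "c = (1 + \<alpha>) / 2"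
  define a where "a = \<bar>x - c\<bar>"
  have a: "0 \<le> a" "a < c" using x by (auto simp: a_def c_def abs_if field_simps)
  show ?thesis
  proof (rule set_integrable_dominated_exp[where e = "c - a" and B = "a / 2"])
    fix t :: real assume t: "t > 0"
    have ca: "cosh ((x - c) * t) = cosh (a * t)"
      by (metis a_def abs_mult abs_idempotent cosh_real_abs)
    have "\<bar>(1 - cosh ((x - c) * t)) / (2 * t * sinh (t / 2) * cosh (\<alpha> * t / 2))\<bar>
       = (cosh (a * t) - 1) / (2 * t * sinh (t / 2) * cosh (\<alpha> * t / 2))"
      unfolding ca using t cosh_real_ge_1[of "a * t"] by (simp add: abs_mult)
    also have "\<dots> \<le> (a * t * (exp (- (c - a) * t) * sinh (c * t)) / 2) / (t * sinh (c * t))"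
    proof (rule frac_le)
      have "cosh (a * t) - 1 \<le> a * t * sinh (a * t) / 2"
        using a t by (intro cosh_minus_1_le) auto
      also have "\<dots> \<le> a * t * (exp (- (c - a) * t) * sinh (c * t)) / 2"
        using a t by (intro divide_right_mono mult_left_mono sinh_le_exp_mult_sinh) auto
      finally show "cosh (a * t) - 1 \<le> a * t * (exp (- (c - a) * t) * sinh (c * t)) / 2" .
      have "t / 2 + \<alpha> * t / 2 = c * t" "t / 2 - \<alpha> * t / 2 = (1 - \<alpha>) * t / 2"
        by (simp_all add: c_def field_simps)
      then have "2 * sinh (t / 2) * cosh (\<alpha> * t / 2) = sinh (c * t) + sinh ((1 - \<alpha>) * t / 2)"
        using sinh_add_sub[of "t / 2" "\<alpha> * t / 2"] by (simp only:)
      moreover have "0 \<le> sinh ((1 - \<alpha>) * t / 2)" using \<alpha> t by simp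
      ultimately have "t * sinh (c * t) \<le> t * (2 * sinh (t / 2) * cosh (\<alpha> * t / 2))"
        using t by (intro mult_left_mono) auto
      then show "t * sinh (c * t) \<le> 2 * t * sinh (t / 2) * cosh (\<alpha> * t / 2)" by (simp add: mult_ac)
      show "0 < t * sinh (c * t)" "0 \<le> a * t * (exp (- (c - a) * t) * sinh (c * t)) / 2"
        using t a by auto
    qed
    also have "\<dots> = a / 2 * exp (- (c - a) * t)"
      using t a by simp
    finally show "\<bar>(1 - cosh ((x - (1 + \<alpha>) / 2) * t)) / (2 * t * sinh (t / 2) * cosh (\<alpha> * t / 2))\<bar> \<le> a / 2 * exp (- (c - a) * t)"
      by (simp add: c_def)
  qed (use a in auto)
qed

text \<open>The integrand is dominated by \<open>a * exp (- a * t)\<close> with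
  \<open>a = \<alpha> / 2\<close>, whose integral is 1 for every \<alpha>.\<close>

lemma
  assumes \<alpha>: "0 < \<alpha>" "\<alpha> \<le> 1"
  shows integrable_lsin_defect: "set_integrable lborel {0<..} (\<lambda>t. (1 - 1 / cosh (\<alpha> * t / 2)) / (t * sinh (t / 2)))"
    and lsin_defect_bounds: "0 \<le> lsin_defect \<alpha>" "lsin_defect \<alpha> \<le> 1"
proof -
  define a where "a = \<alpha> / 2"
  have b: "0 \<le> (1 - 1 / cosh (\<alpha> * t / 2)) / (t * sinh (t / 2))"
     "(1 - 1 / cosh (\<alpha> * t / 2)) / (t * sinh (t / 2)) \<le> a * exp (- a * t)" if t: "t > 0" for t
  proof -
    have at: "\<alpha> * t / 2 = a * t" by (simp add: a_def)
    have 1: "1 - 1 / cosh (a * t) = (cosh (a * t) - 1) / cosh (a * t)"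
      by (simp add: diff_divide_distrib)
    show "0 \<le> (1 - 1 / cosh (\<alpha> * t / 2)) / (t * sinh (t / 2))"
      unfolding at 1 using t cosh_real_ge_1[of "a * t"] by simp
    have "cosh (a * t) - 1 \<le> a * t * sinh (a * t) / 2"
      using \<alpha> t by (intro cosh_minus_1_le) (auto simp: a_def)
    also have "\<dots> \<le> a * t * sinh (t / 2) / 2"
      using \<alpha> t by (intro divide_right_mono mult_left_mono) (auto simp: a_def)
    finally have "(cosh (a * t) - 1) / (t * sinh (t / 2)) \<le> a / 2"
      using t by (simp add: field_simps)
    then have "(cosh (a * t) - 1) / (t * sinh (t / 2)) / cosh (a * t) \<le> (a / 2) / (exp (a * t) / 2)"
      by (rule frac_le[rotated 1]) (use exp_le_2_cosh[of "a * t"] \<alpha> in \<open>auto simp: a_def\<close>)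
    then show "(1 - 1 / cosh (\<alpha> * t / 2)) / (t * sinh (t / 2)) \<le> a * exp (- a * t)"
      unfolding at 1 by (simp add: exp_minus divide_simps mult_ac)
  qed
  show i: "set_integrable lborel {0<..} (\<lambda>t. (1 - 1 / cosh (\<alpha> * t / 2)) / (t * sinh (t / 2)))"
  proof (rule set_integrable_dominated_exp[where e = a and B = a])
    show "\<bar>(1 - 1 / cosh (\<alpha> * t / 2)) / (t * sinh (t / 2))\<bar> \<le> a * exp (- a * t)" if "t > 0" for t
      using b[OF that] by (simp only: abs_of_nonneg)
  qed (use \<alpha> in \<open>auto simp: a_def\<close>)
  show "0 \<le> lsin_defect \<alpha>"
    unfolding lsin_defect_def set_lebesgue_integral_def using b by (intro integral_nonneg_AE) (auto simp: indicator_def)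
  have "lsin_defect \<alpha> \<le> (LBINT t:{0<..}. a * exp (- a * t))"
    unfolding lsin_defect_def using b \<alpha> i integrable_exp_neg_Ioi[of a] by (intro set_integral_mono) (auto simp: a_def)
  also have "\<dots> = a * (LBINT t:{0<..}. exp (- a * t))" by (rule set_integral_mult_right)
  also have "\<dots> = 1" using integral_exp_neg_Ioi[of a] \<alpha> by (simp add: a_def)
  finally show "lsin_defect \<alpha> \<le> 1" .
qed

lemma lsin_shift_alpha:
  assumes x: "0 < x" "x < 1" and \<alpha>: "0 < \<alpha>" "\<alpha> \<le> 1"
  shows "lsin \<alpha> x + lsin \<alpha> (x + \<alpha>) = ln (sin (pi * x)) - lsin_defect \<alpha>"
proof -
  have "lsin \<alpha> x + lsin \<alpha> (x + \<alpha>) = (LBINT t:{0<..}.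
     (1 - cosh ((x - (1 + \<alpha>) / 2) * t)) / (2 * t * sinh (t / 2) * cosh (\<alpha> * t / 2)) +
     (1 - cosh ((x + \<alpha> - (1 + \<alpha>) / 2) * t)) / (2 * t * sinh (t / 2) * cosh (\<alpha> * t / 2)))"
    unfolding lsin_def using assms by (intro set_integral_add(2)[symmetric] integrable_lsin) auto
  also have "\<dots> = (LBINT t:{0<..}. (1 - cosh ((x - 1/2) * t)) / (t * sinh (t / 2))
     - (1 - 1 / cosh (\<alpha> * t / 2)) / (t * sinh (t / 2)))"
  proof (rule set_lebesgue_integral_cong)
    have "(1 - cosh ((x - (1 + \<alpha>) / 2) * t)) / (2 * t * sinh (t / 2) * cosh (\<alpha> * t / 2)) +
       (1 - cosh ((x + \<alpha> - (1 + \<alpha>) / 2) * t)) / (2 * t * sinh (t / 2) * cosh (\<alpha> * t / 2))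
       = (1 - cosh ((x - 1/2) * t)) / (t * sinh (t / 2)) - (1 - 1 / cosh (\<alpha> * t / 2)) / (t * sinh (t / 2))" for t
    proof -
      have e: "(x - (1 + \<alpha>) / 2) * t = (x - 1/2) * t - \<alpha> * t / 2"
        "(x + \<alpha> - (1 + \<alpha>) / 2) * t = (x - 1/2) * t + \<alpha> * t / 2" by (simp_all add: field_simps)
      have "(1 - cosh ((x - (1 + \<alpha>) / 2) * t)) / (2 * t * sinh (t / 2) * cosh (\<alpha> * t / 2)) +
       (1 - cosh ((x + \<alpha> - (1 + \<alpha>) / 2) * t)) / (2 * t * sinh (t / 2) * cosh (\<alpha> * t / 2))
        = (2 - 2 * cosh ((x - 1/2) * t) * cosh (\<alpha> * t / 2)) / (2 * t * sinh (t / 2) * cosh (\<alpha> * t / 2))"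
        unfolding e cosh_add cosh_diff by (simp flip: add_divide_distrib)
      also have "\<dots> = (1 / cosh (\<alpha> * t / 2) - cosh ((x - 1/2) * t)) / (t * sinh (t / 2))"
        by (simp add: diff_divide_distrib)
      also have "\<dots> = (1 - cosh ((x - 1/2) * t)) / (t * sinh (t / 2)) - (1 - 1 / cosh (\<alpha> * t / 2)) / (t * sinh (t / 2))"
        by (simp flip: diff_divide_distrib)
      finally show ?thesis .
    qed
    then show "\<forall>t. t \<in> {0<..} \<longrightarrow> (1 - cosh ((x - (1 + \<alpha>) / 2) * t)) / (2 * t * sinh (t / 2) * cosh (\<alpha> * t / 2)) +
       (1 - cosh ((x + \<alpha> - (1 + \<alpha>) / 2) * t)) / (2 * t * sinh (t / 2) * cosh (\<alpha> * t / 2))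
       = (1 - cosh ((x - 1/2) * t)) / (t * sinh (t / 2)) - (1 - 1 / cosh (\<alpha> * t / 2)) / (t * sinh (t / 2))" by blast
  qed auto
  also have "\<dots> = ln (sin (pi * x)) - lsin_defect \<alpha>"
    unfolding lsin_defect_def using integral_ln_sin[OF x]
    by (subst set_integral_diff(2)) (use assms in \<open>auto intro!: integrable_ln_sin integrable_lsin_defect\<close>)
  finally show ?thesis .
qed

text \<open>With sinh in the denominator it is the difference of the two values that simplifies. The
  constants 1 cancel in it, so \<open>lsin_defect\<close> does not appear.\<close>

lemma lsin_shift_1:
  assumes "0 < x" "x < \<alpha>" "0 < \<alpha>" "\<alpha> \<le> 1"
  shows "lsin \<alpha> x - lsin \<alpha> (x + 1) = lntan (x / \<alpha>)"
proof -
  have "lsin \<alpha> x - lsin \<alpha> (x + 1) = (LBINT t:{0<..}.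
     (1 - cosh ((x - (1 + \<alpha>) / 2) * t)) / (2 * t * sinh (t / 2) * cosh (\<alpha> * t / 2)) -
     (1 - cosh ((x + 1 - (1 + \<alpha>) / 2) * t)) / (2 * t * sinh (t / 2) * cosh (\<alpha> * t / 2)))"
    unfolding lsin_def using assms by (intro set_integral_diff(2)[symmetric] integrable_lsin) auto
  also have "\<dots> = lntan (x / \<alpha>)"
    unfolding lntan_scale[OF assms(3)]
  proof (rule set_lebesgue_integral_cong)
    have "(1 - cosh ((x - (1 + \<alpha>) / 2) * t)) / (2 * t * sinh (t / 2) * cosh (\<alpha> * t / 2)) -
       (1 - cosh ((x + 1 - (1 + \<alpha>) / 2) * t)) / (2 * t * sinh (t / 2) * cosh (\<alpha> * t / 2))
       = sinh ((x - \<alpha> / 2) * t) / (t * cosh (\<alpha> * t / 2))" if "t > 0" for t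
    proof -
      have "((x + 1 - (1 + \<alpha>) / 2) * t + (x - (1 + \<alpha>) / 2) * t) / 2 = (x - \<alpha> / 2) * t"
        "((x + 1 - (1 + \<alpha>) / 2) * t - (x - (1 + \<alpha>) / 2) * t) / 2 = t / 2" by (simp_all add: field_simps)
      then have "cosh ((x + 1 - (1 + \<alpha>) / 2) * t) - cosh ((x - (1 + \<alpha>) / 2) * t)
         = 2 * sinh ((x - \<alpha> / 2) * t) * sinh (t / 2)"
        by (simp only: cosh_diff_cosh)
      then have "(1 - cosh ((x - (1 + \<alpha>) / 2) * t)) / (2 * t * sinh (t / 2) * cosh (\<alpha> * t / 2)) -
       (1 - cosh ((x + 1 - (1 + \<alpha>) / 2) * t)) / (2 * t * sinh (t / 2) * cosh (\<alpha> * t / 2))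
        = (2 * sinh ((x - \<alpha> / 2) * t) * sinh (t / 2)) / (2 * t * sinh (t / 2) * cosh (\<alpha> * t / 2))"
        by (simp flip: diff_divide_distrib)
      then show ?thesis using that by simp
    qed
    then show "\<forall>t. t \<in> {0<..} \<longrightarrow> (1 - cosh ((x - (1 + \<alpha>) / 2) * t)) / (2 * t * sinh (t / 2) * cosh (\<alpha> * t / 2)) -
       (1 - cosh ((x + 1 - (1 + \<alpha>) / 2) * t)) / (2 * t * sinh (t / 2) * cosh (\<alpha> * t / 2))
       = sinh ((x - \<alpha> / 2) * t) / (t * cosh (\<alpha> * t / 2))" by simp
  qed auto
  finally show ?thesis .
qed

text \<open>All values are nonpositive, and in this range lowest at the ends. At \<alpha>/2 the
  functional equation applies; dropping the nonpositive value at 3\<alpha>/2 leaves at least ln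
  sin(\<pi>\<alpha>/2) minus the defect, hence at least ln \<alpha> - 1.\<close>

lemma abs_lsin_le:
  assumes \<alpha>: "0 < \<alpha>" "\<alpha> \<le> 1" and x: "\<alpha> / 2 \<le> x" "x \<le> 1 + \<alpha> / 2"
  shows "\<bar>lsin \<alpha> x\<bar> \<le> 1 - ln \<alpha>"
proof -
  have nonpos: "lsin \<alpha> z \<le> 0" for z
  proof -
    have "0 \<le> (LBINT t:{0<..}. - ((1 - cosh ((z - (1 + \<alpha>) / 2) * t)) / (2 * t * sinh (t / 2) * cosh (\<alpha> * t / 2))))"
      unfolding set_lebesgue_integral_def
      by (intro integral_nonneg_AE AE_I2)
         (auto simp: indicator_def cosh_real_ge_1 intro!: divide_nonpos_pos)
    then show ?thesis unfolding lsin_def by (simp add: set_lebesgue_integral_def)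
  qed
  have "lsin \<alpha> (\<alpha> / 2) \<le> lsin \<alpha> x"
    unfolding lsin_def
  proof (rule set_integral_mono)
    fix t :: real assume t: "t \<in> {0<..}"
    have "\<bar>x - (1 + \<alpha>) / 2\<bar> \<le> 1 / 2" using x by (auto simp: abs_if field_simps)
    moreover have "\<bar>\<alpha> / 2 - (1 + \<alpha>) / 2\<bar> = 1 / 2" by (simp add: abs_if field_simps)
    ultimately have "\<bar>(x - (1 + \<alpha>) / 2) * t\<bar> \<le> \<bar>(\<alpha> / 2 - (1 + \<alpha>) / 2) * t\<bar>"
      using t by (simp only: abs_mult) (simp add: mult_right_mono)
    then have "cosh ((x - (1 + \<alpha>) / 2) * t) \<le> cosh ((\<alpha> / 2 - (1 + \<alpha>) / 2) * t)"
      by (metis abs_ge_zero cosh_real_abs cosh_real_nonneg_le_iff)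
    then show "(1 - cosh ((\<alpha> / 2 - (1 + \<alpha>) / 2) * t)) / (2 * t * sinh (t / 2) * cosh (\<alpha> * t / 2))
      \<le> (1 - cosh ((x - (1 + \<alpha>) / 2) * t)) / (2 * t * sinh (t / 2) * cosh (\<alpha> * t / 2))"
      using t by (intro divide_right_mono) auto
  qed (use assms in \<open>auto intro!: integrable_lsin\<close>)
  moreover have "ln (sin (pi * (\<alpha> / 2))) - lsin_defect \<alpha> \<le> lsin \<alpha> (\<alpha> / 2)"
    using lsin_shift_alpha[of "\<alpha> / 2" \<alpha>] nonpos[of "\<alpha> / 2 + \<alpha>"] \<alpha> by simp
  moreover have "ln \<alpha> \<le> ln (sin (pi * (\<alpha> / 2)))"
    using sin_ge_two_div_pi[of \<alpha>] \<alpha> by simp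
  ultimately show ?thesis using nonpos[of x] lsin_defect_bounds[OF \<alpha>] by linarith
qed

text \<open>The terms \<open>\<epsilon> U(y)\<close> telescope inside each lap of the rotation, and each crossing of an integer leaves
  one term of \<open>g\<close>. If the last orbit point is close to 1, the sum is cut one crossing later, which
  keeps \<open>U\<close> away from its singularities.\<close>

lemma telescope_bound:
  fixes p q N :: nat and \<alpha> B :: real and U :: "real \<Rightarrow> real" and \<epsilon> t g :: "nat \<Rightarrow> real"
  defines "\<alpha> \<equiv> real p / real q"
  defines "y \<equiv> \<lambda>n. real (n * p mod q) / real q"
  assumes pq: "0 < p" "p < q" and N: "1 \<le> N" "N < q"
    and \<epsilon>: "\<And>n. \<bar>\<epsilon> n\<bar> = 1"
    and t: "\<And>n. 1 \<le> n \<Longrightarrow> n < q \<Longrightarrow> t n = \<epsilon> n * U (y n) + \<epsilon> n * U (y n + \<alpha>)"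
    and nowrap: "\<And>n. 1 \<le> n \<Longrightarrow> n + 1 < q \<Longrightarrow> n * p mod q + p < q \<Longrightarrow> \<epsilon> (n + 1) = - \<epsilon> n"
    and wrap: "\<And>n. 1 \<le> n \<Longrightarrow> n + 1 < q \<Longrightarrow> n * p mod q + p \<ge> q \<Longrightarrow>
      \<epsilon> n * U (y (n + 1) + 1) = - \<epsilon> (n + 1) * U (y (n + 1)) + g ((n + 1) * p div q)"
    and U: "\<And>x. \<alpha> / 2 \<le> x \<Longrightarrow> x \<le> 1 + \<alpha> / 2 \<Longrightarrow> \<bar>U x\<bar> \<le> B"
  shows "\<exists>K<p. \<bar>\<Sum>n=1..N. t n\<bar> \<le> 2 * B + \<bar>\<Sum>k=1..K. g k\<bar>"
proof -
  have \<alpha>: "0 < \<alpha>" "\<alpha> < 1" using pq by (auto simp: \<alpha>_def)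
  have modlt: "n * p mod q < q" for n using pq by simp
  have step: "((n + 1) * p) div q = n * p div q \<and> ((n + 1) * p) mod q = n * p mod q + p"
    if "n * p mod q + p < q" for n
  proof -
    have "(n + 1) * p = q * (n * p div q) + (n * p mod q + p)" by simp
    then show ?thesis using that by (metis div_mult_self4 mod_mult_self4 add.right_neutral div_less mod_less less_nat_zero_code)
  qed
  have step': "((n + 1) * p) div q = n * p div q + 1 \<and> ((n + 1) * p) mod q + q = n * p mod q + p"
    if "n * p mod q + p \<ge> q" for n
  proof -
    define s where "s = n * p mod q + p - q"
    have s: "s < q" using modlt[of n] pq unfolding s_def by linarith
    have "(n + 1) * p = q * (n * p div q + 1) + s" using that by (simp add: s_def)
    then have "((n + 1) * p) div q = n * p div q + 1" "((n + 1) * p) mod q = s"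
      using s by (metis div_mult_self4 add.right_neutral div_less less_nat_zero_code, metis mod_mult_self4 mod_less)
    then show ?thesis using that by (simp add: s_def)
  qed
  have y_step: "y n + \<alpha> = y (n + 1)" if "n * p mod q + p < q" for n
    using step[OF that] by (simp add: y_def \<alpha>_def add_divide_distrib)
  have y_step': "y n + \<alpha> = y (n + 1) + 1" if "n * p mod q + p \<ge> q" for n
  proof -
    have "real (n * p mod q) + real p = real ((n + 1) * p mod q) + real q"
      using step'[OF that] by (metis of_nat_add)
    then have "(real (n * p mod q) + real p) / real q = (real ((n + 1) * p mod q) + real q) / real q" by simp
    then show ?thesis using pq by (simp add: y_def \<alpha>_def add_divide_distrib)
  qed
  \<comment> \<open>The second half of term n meets the first half of term n + 1. Writing the
    outcome as a difference of sums of \<open>g\<close> covers both cases, since the upper limit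
    grows by one exactly at a crossing.\<close>
  have trans: "\<epsilon> n * U (y n + \<alpha>) + \<epsilon> (n + 1) * U (y (n + 1))
      = (\<Sum>k=1..(n + 1) * p div q. g k) - (\<Sum>k=1..n * p div q. g k)" if n: "1 \<le> n" "n + 1 < q" for n
  proof (cases "n * p mod q + p < q")
    case True
    then show ?thesis using nowrap[OF n True] y_step[OF True] step[OF True] by simp
  next
    case False
    then have F: "n * p mod q + p \<ge> q" by simp
    show ?thesis using wrap[OF n F] y_step'[OF F] step'[OF F] by simp
  qed
  have id: "(\<Sum>n=1..M. t n) = \<epsilon> 1 * U (y 1) + (\<Sum>k=1..M * p div q. g k) + \<epsilon> M * U (y M + \<alpha>)"
    if "1 \<le> M" "M < q" for M
    using that
  proof (induction M rule: nat_induct_at_least)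
    case base
    then show ?case using t[of 1] pq by simp
  next
    case (Suc M)
    then have "(\<Sum>n=1..Suc M. t n) = (\<Sum>n=1..M. t n) + t (M + 1)" by simp
    also have "\<dots> = \<epsilon> 1 * U (y 1) + (\<Sum>k=1..M * p div q. g k) + \<epsilon> M * U (y M + \<alpha>)
        + (\<epsilon> (M + 1) * U (y (M + 1)) + \<epsilon> (M + 1) * U (y (M + 1) + \<alpha>))"
      using Suc t[of "M + 1"] by simp
    also have "\<dots> = \<epsilon> 1 * U (y 1) + (\<Sum>k=1..(M + 1) * p div q. g k) + \<epsilon> (M + 1) * U (y (M + 1) + \<alpha>)"
      using trans[of M] Suc by linarith
    finally show ?case by simp
  qed
  have divlt: "M * p div q < p" if "M < q" for M
    using that pq by (simp add: less_mult_imp_div_less mult.commute)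
  have y1: "y 1 = \<alpha>" using pq by (simp add: y_def \<alpha>_def)
  have b1: "\<bar>\<epsilon> 1 * U (y 1)\<bar> \<le> B"
    unfolding y1 abs_mult \<epsilon> using U[of \<alpha>] \<alpha> by simp
  have ynn: "y n \<ge> 0" for n by (simp add: y_def)
  show ?thesis
  proof (cases "y N + \<alpha> \<le> 1 + \<alpha> / 2")
    case True
    then have "\<bar>\<epsilon> N * U (y N + \<alpha>)\<bar> \<le> B"
      unfolding abs_mult \<epsilon> using U[of "y N + \<alpha>"] \<alpha> ynn[of N] by simp
    then have "\<bar>\<Sum>n=1..N. t n\<bar> \<le> 2 * B + \<bar>\<Sum>k=1..N * p div q. g k\<bar>"
      using id[OF N] b1 by linarith
    then show ?thesis using divlt[OF N(2)] by blast
  next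
    case False
    have F: "n * p mod q + p \<ge> q" if "y n + \<alpha> > 1" for n
    proof -
      have "(real (n * p mod q) + real p) / real q > 1" using that by (simp add: y_def \<alpha>_def add_divide_distrib)
      then have "real (n * p mod q + p) > real q" using pq by (simp add: field_simps)
      then show ?thesis by linarith
    qed
    have FN: "N * p mod q + p \<ge> q" using F[of N] False \<alpha> by simp
    have y': "y (N + 1) > \<alpha> / 2" using y_step'[OF FN] False by simp
    \<comment> \<open>At \<open>N + 1 = q\<close> the orbit would be back at 0, below
      \<open>\<alpha> / 2\<close>; so one more transition is available.\<close>
    have "N + 1 \<noteq> q"
    proof
      assume "N + 1 = q"
      then have "y (N + 1) = 0" by (simp add: y_def)
      then show False using y' \<alpha> by simp
    qed
    then have N1: "N + 1 < q" using N by simp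
    have "y (N + 1) \<le> 1" using modlt[of "N + 1"] pq by (simp add: y_def)
    then have b2: "\<bar>\<epsilon> (N + 1) * U (y (N + 1))\<bar> \<le> B"
      unfolding abs_mult \<epsilon> using U[of "y (N + 1)"] \<alpha> y' by simp
    have "(\<Sum>n=1..N. t n) = \<epsilon> 1 * U (y 1) + (\<Sum>k=1..(N + 1) * p div q. g k) - \<epsilon> (N + 1) * U (y (N + 1))"
      using id[OF N] trans[OF N(1) N1] by linarith
    then have "\<bar>\<Sum>n=1..N. t n\<bar> \<le> 2 * B + \<bar>\<Sum>k=1..(N + 1) * p div q. g k\<bar>"
      using b1 b2 by linarith
    then show ?thesis using divlt[OF N1] by blast
  qed
qed

text \<open>The sign counts the steps and the integers crossed. In this form the sum reproduces
  itself under the Gauss map when the partial quotient is even, and it arises from the plain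
  alternating sum when the partial quotient is odd.\<close>

definition alternating_lntan :: "nat \<Rightarrow> nat \<Rightarrow> nat \<Rightarrow> real" where
  "alternating_lntan p q n = (-1) ^ (n + n * p div q) * lntan (real (n * p mod q) / real q)"

text \<open>At the K-th crossing \<open>K * q = n * p + (p - s)\<close>. Read as a division by
  \<open>p\<close>, this makes n the integer part and 1 - s/p the fractional part of K q / p, so the
  crossing is a point of the orbit for the fraction \<open>(q mod p) / p\<close>.\<close>

lemma wrap_term:
  fixes p q n :: nat
  defines "K \<equiv> (n + 1) * p div q" and "s \<equiv> (n + 1) * p mod q"
  assumes pq: "0 < p" "p < q" and s: "0 < s" "s < p"
  shows "lntan (real s / real p) = - lntan (real (K * (q mod p) mod p) / real p)"
    and "n = K * (q div p) + K * (q mod p) div p"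
proof -
  have e: "K * q + s = (n + 1) * p" by (simp add: K_def s_def)
  then have Kq: "K * q = n * p + (p - s)" using s by simp
  have m: "K * q mod p = p - s" "K * q div p = n"
    using Kq s pq by (metis mod_mult_self3 mod_less diff_less, metis div_mult_self3 add.right_neutral div_less diff_less less_nat_zero_code)
  have "K * q = K * (q div p) * p + K * (q mod p)" by (metis distrib_left div_mult_mod_eq mult.assoc)
  then have m': "K * (q mod p) mod p = p - s" "n = K * (q div p) + K * (q mod p) div p"
    using m pq by (metis mod_mult_self3, metis div_mult_self3 add.commute less_nat_zero_code)
  then have "real (K * (q mod p) mod p) / real p = 1 - real s / real p"
    using s pq by (simp add: of_nat_diff field_simps)
  then show "lntan (real s / real p) = - lntan (real (K * (q mod p) mod p) / real p)"
    using lntan_reflect[of "real s / real p"] by simp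
  show "n = K * (q div p) + K * (q mod p) div p" by (rule m'(2))
qed

lemma wrap_residue:
  fixes p q n :: nat
  assumes pq: "0 < p" "p < q" "coprime p q" and n: "n + 1 < q" and wr: "n * p mod q + p \<ge> q"
  shows "0 < (n + 1) * p mod q" "(n + 1) * p mod q < p" "(n + 1) * p div q = n * p div q + 1"
proof -
  have "\<not> q dvd (n + 1) * p"
    using pq n by (metis coprime_commute coprime_dvd_mult_left_iff nat_dvd_not_less zero_less_Suc Suc_eq_plus1)
  then show "0 < (n + 1) * p mod q" by (simp add: dvd_eq_mod_eq_0)
  define s where "s = n * p mod q + p - q"
  have s: "s < p" using pq by (simp add: s_def) (metis add.commute add_less_cancel_left diff_less_mono2 less_diff_conv2 mod_less_divisor order.strict_trans wr)
  have "(n + 1) * p = q * (n * p div q + 1) + s" using wr by (simp add: s_def)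
  then have "((n + 1) * p) div q = n * p div q + 1" "((n + 1) * p) mod q = s"
    using s pq by (metis div_mult_self4 add.right_neutral div_less less_nat_zero_code less_trans, metis mod_mult_self4 mod_less less_trans)
  then show "(n + 1) * p mod q < p" "(n + 1) * p div q = n * p div q + 1" using s by auto
qed

section \<open>Euclidean steps and bounds for the alternating sums\<close>

lemma cfrac_even_bounds:
  assumes "\<forall>a\<in>set as. a > 0 \<and> even a"
  shows "0 \<le> cfrac as \<and> cfrac as \<le> 1/2"
  using assms
proof (induction as)
  case (Cons a as)
  then have "0 \<le> cfrac as" "a > 0" "even a" by auto
  moreover from this have "a \<ge> 2" by presburger
  ultimately show ?case by (simp add: field_simps)
qed simp

lemma cfrac_Cons_division:
  fixes p q a :: nat
  assumes e: "real p / real q = cfrac (a # as)" and c: "0 \<le> cfrac as" "cfrac as < 1"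
    and a: "a > 0" and co: "coprime p q" and q: "q > 0"
  shows "p > 0" "q div p = a" "real (q mod p) / real p = cfrac as" "coprime (q mod p) p"
proof -
  have pos: "real a + cfrac as > 0" using a c by simp
  show p: "p > 0"
  proof (rule ccontr)
    assume "\<not> p > 0"
    then have "1 / (real a + cfrac as) = 0" using e by simp
    then show False using pos by simp
  qed
  have "real p * (real a + cfrac as) = real q"
    using e pos q by (simp add: field_simps)
  then have r: "real q - real (p * a) = real p * cfrac as" by (simp add: algebra_simps)
  then have ge: "q \<ge> p * a" using c p by (metis diff_ge_0_iff_ge mult_nonneg_nonneg of_nat_0_le_iff of_nat_le_iff)
  define s where "s = q - p * a"
  have s: "real s = real p * cfrac as" using r ge by (simp add: s_def of_nat_diff)
  have "real s < real p" unfolding s using c p by simp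
  then have "s < p" by simp
  moreover have "q = p * a + s" using ge by (simp add: s_def)
  ultimately have d: "q div p = a" "q mod p = s" using p by auto
  then show "q div p = a" by simp
  show "real (q mod p) / real p = cfrac as" using d s p by simp
  show "coprime (q mod p) p" using co by (metis coprime_commute coprime_mod_left_iff less_numeral_extra(3) p)
qed

text \<open>Each step adds two boundary values of at most ln(2/\<alpha>), in total at most 4
  ln(q/p), and passes from denominator q to denominator p; the bounds telescope to 4 ln q.\<close>

lemma alternating_lntan_sum_bound:
  assumes "\<forall>a\<in>set as. a > 0 \<and> even a" "real p / real q = cfrac as" "coprime p q" "N < q"
  shows "\<bar>\<Sum>n=1..N. alternating_lntan p q n\<bar> \<le> 4 * ln (real q)"
  using assms
proof (induction as arbitrary: p q N)
  case Nil
  then have "p = 0" by auto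
  then have "q = 1" using Nil by simp
  then show ?case using Nil by simp
next
  case (Cons a as)
  have c: "0 \<le> cfrac as" "cfrac as \<le> 1/2" using cfrac_even_bounds[of as] Cons.prems by auto
  have a: "a > 0" "even a" using Cons.prems by auto
  then have a2: "a \<ge> 2" by presburger
  have q: "q > 0" using Cons.prems by simp
  note D = cfrac_Cons_division[OF Cons.prems(2) c(1) _ a(1) Cons.prems(3) q]
  have p: "p > 0" "q div p = a" "real (q mod p) / real p = cfrac as" "coprime (q mod p) p"
    using D c by auto
  define \<alpha> where "\<alpha> = real p / real q"
  have \<alpha>: "0 < \<alpha>" "\<alpha> \<le> 1/2"
  proof -
    show "0 < \<alpha>" using p q by (simp add: \<alpha>_def)
    have "\<alpha> = 1 / (real a + cfrac as)" using Cons.prems by (simp add: \<alpha>_def)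
    also have "\<dots> \<le> 1 / 2" using a2 c by (intro divide_left_mono) auto
    finally show "\<alpha> \<le> 1/2" .
  qed
  have pq: "p < q" using \<alpha> q by (simp add: \<alpha>_def field_simps)
  show ?case
  proof (cases "N = 0")
    case False
    have "\<exists>K<p. \<bar>\<Sum>n=1..N. alternating_lntan p q n\<bar> \<le> 2 * ln (2 / \<alpha>) + \<bar>\<Sum>k=1..K. alternating_lntan (q mod p) p k\<bar>"
    proof (rule telescope_bound[where p = p and q = q and \<epsilon> = "\<lambda>n. (-1) ^ (n + n * p div q)" and U = "ltan \<alpha>", folded \<alpha>_def])
      fix n assume n: "1 \<le> n" "n < q"
      have "\<not> q dvd n * p" using n Cons.prems(3)
        by (metis coprime_commute coprime_dvd_mult_left_iff nat_dvd_not_less One_nat_def less_eq_Suc_le)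
      then have "0 < n * p mod q" by (simp add: dvd_eq_mod_eq_0)
      moreover have "n * p mod q < q" using q by simp
      ultimately have "lntan (real (n * p mod q) / real q) = ltan \<alpha> (real (n * p mod q) / real q) + ltan \<alpha> (real (n * p mod q) / real q + \<alpha>)"
        using ltan_shift_alpha[of "real (n * p mod q) / real q" \<alpha>] \<alpha> q by simp
      then show "alternating_lntan p q n = (- 1) ^ (n + n * p div q) * ltan \<alpha> (real (n * p mod q) / real q)
         + (- 1) ^ (n + n * p div q) * ltan \<alpha> (real (n * p mod q) / real q + \<alpha>)"
        by (simp add: alternating_lntan_def algebra_simps)
    next
      fix n assume n: "1 \<le> n" "n + 1 < q" "n * p mod q + p < q"
      have "(n + 1) * p = q * (n * p div q) + (n * p mod q + p)" by simp
      then have "((n + 1) * p) div q = n * p div q"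
        using n(3) by (metis div_mult_self4 add.right_neutral div_less less_nat_zero_code)
      then show "(- 1) ^ (n + 1 + (n + 1) * p div q) = - ((- 1) ^ (n + n * p div q) :: real)"
        by simp
    next
      fix n assume n: "1 \<le> n" "n + 1 < q" "n * p mod q + p \<ge> q"
      note W = wrap_residue[OF p(1) pq Cons.prems(3) n(2,3)]
      note V = wrap_term[OF p(1) pq W(1,2)]
      define K where "K = (n + 1) * p div q"
      define s where "s = (n + 1) * p mod q"
      have "ltan \<alpha> (real s / real q) + ltan \<alpha> (real s / real q + 1) = lntan (real s / real q / \<alpha>)"
        using W \<alpha> pq by (intro ltan_shift_1) (auto simp: s_def \<alpha>_def divide_strict_right_mono)
      also have "real s / real q / \<alpha> = real s / real p" using q by (simp add: \<alpha>_def)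
      also have "lntan \<dots> = - lntan (real (K * (q mod p) mod p) / real p)" using V by (simp add: s_def K_def)
      finally have L: "ltan \<alpha> (real s / real q + 1) = - lntan (real (K * (q mod p) mod p) / real p) - ltan \<alpha> (real s / real q)"
        by simp
      have K: "K = n * p div q + 1" using W by (simp add: K_def)
      \<comment> \<open>In \<open>n = K * a + K * (q mod p) div p\<close> the first summand is even.
        The crossing count, one more than \<open>n * p div q\<close>, supplies the missing power of
        -1.\<close>
      have "(-1 :: real) ^ n = (-1) ^ (K * (q mod p) div p)"
        using V(2) a(2) unfolding p(2) K_def[symmetric] by (metis dvd_mult even_add minus_one_power_iff)
      then show "(- 1) ^ (n + n * p div q) * ltan \<alpha> (real ((n + 1) * p mod q) / real q + 1) =
         - ((- 1) ^ (n + 1 + (n + 1) * p div q)) * ltan \<alpha> (real ((n + 1) * p mod q) / real q)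
         + alternating_lntan (q mod p) p ((n + 1) * p div q)"
        unfolding alternating_lntan_def s_def[symmetric] K_def[symmetric] L
        by (simp add: K power_add algebra_simps)
    next
      fix x assume "\<alpha> / 2 \<le> x" "x \<le> 1 + \<alpha> / 2"
      then show "\<bar>ltan \<alpha> x\<bar> \<le> ln (2 / \<alpha>)"
        using abs_ltan_le[OF \<alpha>] lntan_one_minus_le[of \<alpha>] \<alpha> by force
    qed (use p pq False Cons.prems in \<open>auto simp: power_abs\<close>)
    then obtain K where K: "K < p" "\<bar>\<Sum>n=1..N. alternating_lntan p q n\<bar> \<le> 2 * ln (2 / \<alpha>) + \<bar>\<Sum>k=1..K. alternating_lntan (q mod p) p k\<bar>"
      by blast
    have "\<bar>\<Sum>k=1..K. alternating_lntan (q mod p) p k\<bar> \<le> 4 * ln (real p)"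
      using Cons.IH[of "q mod p" p K] Cons.prems(1) p K by auto
    \<comment> \<open>The bound \<alpha> \<le> 1/2 absorbs the constant 2 into a second factor
      1/\<alpha>, so no error accumulates with the number of steps.\<close>
    moreover have "ln (2 / \<alpha>) \<le> 2 * ln (real q / real p)"
    proof -
      have "2 / \<alpha> \<le> (real q / real p) * (real q / real p)"
      proof -
        have "2 \<le> real q / real p" using \<alpha> p q by (simp add: \<alpha>_def field_simps)
        then have "2 * (real q / real p) \<le> (real q / real p) * (real q / real p)"
          by (intro mult_right_mono) auto
        then show ?thesis by (simp add: \<alpha>_def)
      qed
      then have "ln (2 / \<alpha>) \<le> ln ((real q / real p) * (real q / real p))"
        using \<alpha> by (intro ln_mono) auto
      also have "\<dots> = ln (real q / real p) + ln (real q / real p)"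
        using p q by (intro ln_mult_pos) auto
      also have "\<dots> = 2 * ln (real q / real p)" by simp
      finally show ?thesis .
    qed
    moreover have "ln (real q / real p) = ln (real q) - ln (real p)" using p q by (simp add: ln_div)
    ultimately show ?thesis using K by linarith
  qed (use q in simp)
qed

lemma alternating_ones: "(\<Sum>n=1..N. (-1 :: real) ^ n) = (if even N then 0 else -1)"
  by (induction N) auto

text \<open>The first renormalisation step: an odd \<open>a\<close> turns the sign (-1)^n into that
  of \<open>alternating_lntan\<close>. The constant 3 is 2 from the two boundary values 1 - ln
  \<alpha> and 1 from \<open>lsin_defect\<close>, whose alternating multiples leave at most one
  term. The logarithms combine to 2 ln q + 2 ln p \<le> 4 ln q.\<close>

lemma alternating_ln_sin_bound:
  assumes as: "\<forall>a\<in>set as. a > 0 \<and> even a" and a: "odd a"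
    and e: "real p / real q = cfrac (a # as)" and co: "coprime p q" and N: "N < q"
  shows "\<bar>\<Sum>n=1..N. (-1) ^ n * ln \<bar>sin (pi * real (n * p) / real q)\<bar>\<bar> \<le> 3 + 4 * ln (real q)"
proof (cases "N = 0")
  case True
  have "ln (real q) \<ge> 0" using N by simp
  then show ?thesis using True by simp
next
  case False
  have q: "q > 0" "q \<noteq> 1" using N False by auto
  have c: "0 \<le> cfrac as" "cfrac as \<le> 1/2" using cfrac_even_bounds[of as] as by auto
  have a0: "a > 0" using a by (cases a) auto
  note D = cfrac_Cons_division[OF e c(1) _ a0 co q(1)]
  have p: "p > 0" "q div p = a" "real (q mod p) / real p = cfrac as" "coprime (q mod p) p"
    using D c by auto
  define \<alpha> where "\<alpha> = real p / real q"
  have \<alpha>: "0 < \<alpha>" "\<alpha> \<le> 1"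
  proof -
    show "0 < \<alpha>" using p q by (simp add: \<alpha>_def)
    have "\<alpha> = 1 / (real a + cfrac as)" using e by (simp add: \<alpha>_def)
    also have "\<dots> \<le> 1 / 1" using a0 c by (intro divide_left_mono) auto
    finally show "\<alpha> \<le> 1" by simp
  qed
  have "p \<le> q" using \<alpha> q by (simp add: \<alpha>_def field_simps)
  moreover have "p \<noteq> q" using co q by auto
  ultimately have pq: "p < q" by simp
  define f where "f n = (-1) ^ n * (ln (sin (pi * (real (n * p mod q) / real q))) - lsin_defect \<alpha>)" for n
  have "\<exists>K<p. \<bar>\<Sum>n=1..N. f n\<bar> \<le> 2 * (1 - ln \<alpha>) + \<bar>\<Sum>k=1..K. alternating_lntan (q mod p) p k\<bar>"
  proof (rule telescope_bound[where p = p and q = q and \<epsilon> = "\<lambda>n. (-1) ^ n" and U = "lsin \<alpha>", folded \<alpha>_def])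
    fix n assume n: "1 \<le> n" "n < q"
    have "\<not> q dvd n * p" using n co
      by (metis coprime_commute coprime_dvd_mult_left_iff nat_dvd_not_less One_nat_def less_eq_Suc_le)
    then have "0 < n * p mod q" by (simp add: dvd_eq_mod_eq_0)
    moreover have "n * p mod q < q" using q by simp
    ultimately have "lsin \<alpha> (real (n * p mod q) / real q) + lsin \<alpha> (real (n * p mod q) / real q + \<alpha>)
        = ln (sin (pi * (real (n * p mod q) / real q))) - lsin_defect \<alpha>"
      using \<alpha> q by (intro lsin_shift_alpha) auto
    then show "f n = (- 1) ^ n * lsin \<alpha> (real (n * p mod q) / real q)
       + (- 1) ^ n * lsin \<alpha> (real (n * p mod q) / real q + \<alpha>)"
      by (simp add: f_def flip: distrib_left)
  next
    fix n assume n: "1 \<le> n" "n + 1 < q" "n * p mod q + p \<ge> q"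
    note W = wrap_residue[OF p(1) pq co n(2,3)]
    note V = wrap_term[OF p(1) pq W(1,2)]
    define K where "K = (n + 1) * p div q"
    define s where "s = (n + 1) * p mod q"
    have "lsin \<alpha> (real s / real q) - lsin \<alpha> (real s / real q + 1) = lntan (real s / real q / \<alpha>)"
      using W \<alpha> pq by (intro lsin_shift_1) (auto simp: s_def \<alpha>_def divide_strict_right_mono)
    also have "real s / real q / \<alpha> = real s / real p" using q by (simp add: \<alpha>_def)
    also have "lntan \<dots> = - lntan (real (K * (q mod p) mod p) / real p)" using V by (simp add: s_def K_def)
    finally have L: "lsin \<alpha> (real s / real q + 1) = lntan (real (K * (q mod p) mod p) / real p) + lsin \<alpha> (real s / real q)"
      by simp
    have "even n \<longleftrightarrow> even (K + K * (q mod p) div p)"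
      using V(2) a unfolding p(2) K_def[symmetric] by (metis even_add even_mult_iff)
    then have "(-1 :: real) ^ n = (-1) ^ (K + K * (q mod p) div p)"
      by (simp add: minus_one_power_iff)
    then show "(- 1) ^ n * lsin \<alpha> (real ((n + 1) * p mod q) / real q + 1) =
       - ((- 1) ^ (n + 1)) * lsin \<alpha> (real ((n + 1) * p mod q) / real q)
       + alternating_lntan (q mod p) p ((n + 1) * p div q)"
      unfolding alternating_lntan_def s_def[symmetric] K_def[symmetric] L
      by (simp add: algebra_simps)
  next
    fix x assume "\<alpha> / 2 \<le> x" "x \<le> 1 + \<alpha> / 2"
    then show "\<bar>lsin \<alpha> x\<bar> \<le> 1 - ln \<alpha>" by (rule abs_lsin_le[OF \<alpha>])
  qed (use p pq False N in \<open>auto simp: power_abs\<close>)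
  then obtain K where K: "K < p" "\<bar>\<Sum>n=1..N. f n\<bar> \<le> 2 * (1 - ln \<alpha>) + \<bar>\<Sum>k=1..K. alternating_lntan (q mod p) p k\<bar>"
    by blast
  have T: "\<bar>\<Sum>k=1..K. alternating_lntan (q mod p) p k\<bar> \<le> 4 * ln (real p)"
    using alternating_lntan_sum_bound[OF as p(3,4) K(1)] .
  have "\<bar>sin (pi * real (n * p) / real q)\<bar> = sin (pi * (real (n * p mod q) / real q))" for n
  proof -
    have "real (n * p) = real q * real (n * p div q) + real (n * p mod q)"
      by (metis mult_div_mod_eq of_nat_add of_nat_mult)
    then have "pi * real (n * p) / real q = pi * (real (n * p mod q) / real q) + real (n * p div q) * pi"
      using q by (simp add: field_simps)
    then have "\<bar>sin (pi * real (n * p) / real q)\<bar> = \<bar>sin (pi * (real (n * p mod q) / real q))\<bar>"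
      by (simp add: sin_add abs_mult power_abs)
    also have "\<dots> = sin (pi * (real (n * p mod q) / real q))"
    proof (rule abs_of_nonneg, rule sin_ge_zero)
      have "real (n * p mod q) / real q \<le> 1" using q mod_less_divisor[OF q(1), of "n * p"] by simp
      then have "pi * (real (n * p mod q) / real q) \<le> pi * 1" by (intro mult_left_mono) auto
      then show "pi * (real (n * p mod q) / real q) \<le> pi" by simp
    qed simp
    finally show ?thesis .
  qed
  then have "(\<Sum>n=1..N. (-1) ^ n * ln \<bar>sin (pi * real (n * p) / real q)\<bar>)
      = (\<Sum>n=1..N. f n) + lsin_defect \<alpha> * (\<Sum>n=1..N. (-1) ^ n)"
    by (simp add: f_def algebra_simps sum_subtractf sum_distrib_left)
  moreover have "\<bar>lsin_defect \<alpha> * (\<Sum>n=1..N. (-1) ^ n)\<bar> \<le> 1"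
    using lsin_defect_bounds[OF \<alpha>] unfolding alternating_ones by simp
  ultimately have "\<bar>\<Sum>n=1..N. (-1) ^ n * ln \<bar>sin (pi * real (n * p) / real q)\<bar>\<bar> \<le> \<bar>\<Sum>n=1..N. f n\<bar> + 1"
    by (smt (verit) abs_triangle_ineq)
  moreover have "\<bar>\<Sum>n=1..N. f n\<bar> \<le> 2 * (1 - ln \<alpha>) + 4 * ln (real p)" using K T by simp
  moreover have "ln \<alpha> = ln (real p) - ln (real q)" using p q by (simp add: \<alpha>_def ln_div)
  moreover have "ln (real p) \<le> ln (real q)" using p pq by simp
  ultimately show ?thesis by argo
qed

section \<open>The derivative of the discriminant at the origin\<close>

lemma discriminant_derivative:
  "(discriminant p q has_real_derivative Re (poly (pderiv (disc_poly p q)) (of_real x))) (at x)"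
  "Im (poly (pderiv (disc_poly p q)) (of_real x)) = 0"
proof -
  have "((\<lambda>x. poly (disc_poly p q) (of_real x)) has_vector_derivative poly (pderiv (disc_poly p q)) (of_real x)) (at x)"
    by (rule has_vector_derivative_real_field) (rule poly_DERIV)
  then have "((\<lambda>x. Re (poly (disc_poly p q) (of_real x))) has_real_derivative Re (poly (pderiv (disc_poly p q)) (of_real x))) (at x)
    \<and> ((\<lambda>x. Im (poly (disc_poly p q) (of_real x))) has_real_derivative Im (poly (pderiv (disc_poly p q)) (of_real x))) (at x)"
    by (simp add: has_vector_derivative_complex_iff)
  then have d: "((\<lambda>x. discriminant p q x) has_real_derivative Re (poly (pderiv (disc_poly p q)) (of_real x))) (at x)"
    "((\<lambda>x. 0) has_real_derivative Im (poly (pderiv (disc_poly p q)) (of_real x))) (at x)"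
    by (simp_all add: poly_disc_poly_real)
  show "(discriminant p q has_real_derivative Re (poly (pderiv (disc_poly p q)) (of_real x))) (at x)"
    using d(1) .
  show "Im (poly (pderiv (disc_poly p q)) (of_real x)) = 0" using DERIV_unique[OF d(2) DERIV_const] by simp
qed

lemma of_real_deriv_discriminant:
  "of_real (deriv (discriminant p q) x) = poly (pderiv (disc_poly p q)) (of_real x)"
  using DERIV_imp_deriv[OF discriminant_derivative(1)] discriminant_derivative(2) by (simp add: complex_eq_iff)

definition hopping :: "nat \<Rightarrow> nat \<Rightarrow> nat \<Rightarrow> real" where
  "hopping p q k = 4 * (sin (pi * real (k * p) / real q))\<^sup>2"

lemma jacobi_at_0:
  "poly (jacobi p q (2 * k)) 0 = of_real ((-1) ^ k * (\<Prod>i=1..k. hopping p q (2 * i - 1))) \<and> poly (jacobi p q (2 * k + 1)) 0 = 0"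
proof (induction k)
  case (Suc k)
  have "poly (jacobi p q (2 * Suc k)) 0 = - of_real (hopping p q (2 * k + 1)) * poly (jacobi p q (2 * k)) 0"
    by (simp add: hopping_def)
  moreover have "poly (jacobi p q (2 * Suc k + 1)) 0 = - of_real (hopping p q (2 * k + 2)) * poly (jacobi p q (2 * k + 1)) 0"
    by (simp add: hopping_def)
  ultimately show ?case using Suc by (simp add: algebra_simps)
qed simp

text \<open>The derivative of a characteristic polynomial sums over deleted sites. With zero
  diagonal only the deletion of site 2j + 1 leaves two blocks of even size, and these contribute the
  odd bonds to its left and the even bonds to its right. The induction differentiates the recursion
  instead.\<close>

lemma pderiv_jacobi_at_0:
  "poly (pderiv (jacobi p q (2 * k + 1))) 0
    = of_real ((-1) ^ k * (\<Sum>j\<le>k. (\<Prod>i=1..j. hopping p q (2 * i - 1)) * (\<Prod>i=Suc j..k. hopping p q (2 * i))))"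
proof (induction k)
  case 0
  then show ?case by (simp add: pderiv_pCons)
next
  case (Suc k)
  define O' where "O' j = (\<Prod>i=1..j. hopping p q (2 * i - 1))" for j
  define B where "B = (\<Sum>j\<le>k. O' j * (\<Prod>i=Suc j..k. hopping p q (2 * i)))"
  have IH: "poly (pderiv (jacobi p q (2 * k + 1))) 0 = of_real ((-1) ^ k * B)"
    using Suc unfolding O'_def[symmetric] B_def[symmetric] .
  have "poly (pderiv (jacobi p q (2 * Suc k + 1))) 0
     = poly (jacobi p q (2 * Suc k)) 0 - of_real (hopping p q (2 * Suc k)) * poly (pderiv (jacobi p q (2 * k + 1))) 0"
    by (simp add: hopping_def pderiv_diff pderiv_smult pderiv_pCons)
  also have "poly (jacobi p q (2 * Suc k)) 0 = of_real ((-1) ^ Suc k * O' (Suc k))"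
    unfolding O'_def using jacobi_at_0[of p q "Suc k"] by blast
  also have "of_real ((-1) ^ Suc k * O' (Suc k)) - complex_of_real (hopping p q (2 * Suc k)) * poly (pderiv (jacobi p q (2 * k + 1))) 0
     = of_real ((-1) ^ Suc k * (O' (Suc k) + B * hopping p q (2 * Suc k)))"
    unfolding IH by (simp add: algebra_simps)
  also have "B * hopping p q (2 * Suc k) = (\<Sum>j\<le>k. O' j * (\<Prod>i=Suc j..Suc k. hopping p q (2 * i)))"
    unfolding B_def sum_distrib_right by (intro sum.cong refl) (simp add: prod.cl_ivl_Suc)
  also have "O' (Suc k) + (\<Sum>j\<le>k. O' j * (\<Prod>i=Suc j..Suc k. hopping p q (2 * i)))
     = (\<Sum>j\<le>Suc k. O' j * (\<Prod>i=Suc j..Suc k. hopping p q (2 * i)))"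
    by simp
  finally show ?case unfolding O'_def .
qed

text \<open>The derivative of X^q - 1 at 1, computed directly and from the factorisation into linear
  factors.\<close>

lemma prod_one_minus_roots:
  assumes "q > 0" "coprime p q"
  shows "(\<Prod>k=1..<q. 1 - unit_root p q ^ k) = of_nat q"
proof -
  define w where "w = unit_root p q"
  note r = unit_root_root[OF assms, folded w_def]
  define f where "f = monom 1 q - (1 :: complex poly)"
  have d: "degree f = q" "lead_coeff f = 1"
  proof -
    have f: "f = monom 1 q + - 1" by (simp add: f_def)
    have "degree (- 1 :: complex poly) < degree (monom (1::complex) q)" using assms by (simp add: degree_monom_eq)
    from degree_add_eq_left[OF this] show d: "degree f = q" unfolding f by (simp add: degree_monom_eq)
    show "lead_coeff f = 1" unfolding d unfolding f_def using assms by simp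
  qed
  have f0: "f \<noteq> 0" using d assms by auto
  have pd: "pderiv f = monom (of_nat q) (q - 1)" by (simp add: f_def pderiv_diff pderiv_monom)
  have rsq: "rsquarefree f"
    unfolding rsquarefree_roots
  proof (intro allI notI)
    fix x assume x: "poly f x = 0 \<and> poly (pderiv f) x = 0"
    have "x ^ q = 1" using x by (simp add: f_def poly_monom)
    moreover have "x ^ (q - 1) = 0" using x assms unfolding pd by (simp add: poly_monom)
    ultimately show False using assms by (metis power_minus_mult mult_zero_left zero_neq_one)
  qed
  have inj: "inj_on (\<lambda>k. w ^ k) {..<q}"
  proof (rule linorder_inj_onI)
    fix i j assume ij: "i < j" "i \<in> {..<q}" "j \<in> {..<q}"
    have w0: "w \<noteq> 0" using r(1) assms by (metis power_0_left zero_neq_one less_not_refl)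
    have "w ^ j = w ^ i * w ^ (j - i)" using ij by (simp flip: power_add)
    then show "w ^ i \<noteq> w ^ j" using r(2)[of "j - i"] ij w0 by auto
  qed auto
  have roots: "{x. poly f x = 0} = (\<lambda>k. w ^ k) ` {..<q}"
  proof (rule sym, rule card_subset_eq)
    show "finite {x. poly f x = 0}" by (rule poly_roots_finite[OF f0])
    show sub: "(\<lambda>k. w ^ k) ` {..<q} \<subseteq> {x. poly f x = 0}"
    proof
      fix x assume "x \<in> (\<lambda>k. w ^ k) ` {..<q}"
      then obtain k where "x = w ^ k" by auto
      then have "x ^ q = (w ^ q) ^ k" by (simp add: power_mult[symmetric] mult.commute)
      then show "x \<in> {x. poly f x = 0}" using r(1) by (simp add: f_def poly_monom)
    qed
    have "card {x. poly f x = 0} \<le> q" using card_poly_roots_bound[OF f0] d by simp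
    moreover have "card ((\<lambda>k. w ^ k) ` {..<q}) = q" using card_image[OF inj] by simp
    moreover have "card ((\<lambda>k. w ^ k) ` {..<q}) \<le> card {x. poly f x = 0}"
      by (rule card_mono[OF poly_roots_finite[OF f0] sub])
    ultimately show "card ((\<lambda>k. w ^ k) ` {..<q}) = card {x. poly f x = 0}" by simp
  qed
  have "f = smult (lead_coeff f) (\<Prod>x | poly f x = 0. [:- x, 1:])"
    by (rule complex_poly_decompose_rsquarefree[OF rsq, symmetric])
  also have "\<dots> = (\<Prod>k<q. [:- (w ^ k), 1:])"
    unfolding roots d(2) by (subst prod.reindex[OF inj]) simp
  also have "{..<q} = insert 0 {1..<q}" using assms by auto
  also have "(\<Prod>k\<in>insert 0 {1..<q}. [:- (w ^ k), 1:]) = [:- 1, 1:] * (\<Prod>k=1..<q. [:- (w ^ k), 1:])"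
    by (subst prod.insert) auto
  finally have "poly (pderiv f) 1 = poly (pderiv ([:- 1, 1:] * (\<Prod>k=1..<q. [:- (w ^ k), 1:]))) 1" by simp
  also have "\<dots> = (\<Prod>k=1..<q. 1 - w ^ k)"
    unfolding pderiv_mult by (simp add: pderiv_pCons poly_prod)
  finally show ?thesis by (simp add: pd poly_monom w_def)
qed

lemma norm_one_minus_unit_root: "norm (1 - unit_root p q ^ k) = 2 * \<bar>sin (pi * real (k * p) / real q)\<bar>"
proof -
  define a where "a = 2 * pi * real k * real p / real q"
  have "cnj (1 - cis a) = 1 - cis (- a)" by (simp add: cis_cnj)
  then have "(norm (1 - cis a))\<^sup>2 = 4 * (sin (a / 2))\<^sup>2"
    using one_minus_cis[of a] complex_norm_square[of "1 - cis a"]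
    by (metis mult.commute of_real_eq_iff)
  then have "norm (1 - cis a) = sqrt ((2 * sin (a / 2))\<^sup>2)" by (simp add: power_mult_distrib real_sqrt_unique)
  also have "\<dots> = 2 * \<bar>sin (a / 2)\<bar>" by (simp only: real_sqrt_abs abs_mult abs_numeral)
  also have "a / 2 = pi * real (k * p) / real q" by (simp add: a_def)
  finally show ?thesis unfolding unit_root_power a_def .
qed

text \<open>The numbers below q are the even 2i and the odd q - 2i, and both give the same sine in
  modulus. So the product of the squares over i is the product of |1 - w^k| over all k.\<close>

lemma prod_hopping_even:
  assumes q: "q = 2 * m + 1" and co: "coprime p q"
  shows "(\<Prod>i=1..m. hopping p q (2 * i)) = real q"
proof -
  define s where "s k = 2 * \<bar>sin (pi * real (k * p) / real q)\<bar>" for k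
  have "real q = norm (\<Prod>k=1..<q. 1 - unit_root p q ^ k)"
  proof -
    have "norm (\<Prod>k=1..<q. 1 - unit_root p q ^ k) = norm (of_nat q :: complex)"
      by (subst prod_one_minus_roots) (use q co in auto)
    then show ?thesis by (simp only: norm_of_nat)
  qed
  also have "\<dots> = (\<Prod>k=1..<q. s k)" unfolding prod_norm[symmetric] norm_one_minus_unit_root s_def ..
  also have "{1..<q} = (\<lambda>i. 2 * i) ` {1..m} \<union> (\<lambda>i. q - 2 * i) ` {1..m}"
  proof (intro set_eqI iffI)
    fix k assume k: "k \<in> {1..<q}"
    show "k \<in> (\<lambda>i. 2 * i) ` {1..m} \<union> (\<lambda>i. q - 2 * i) ` {1..m}"
    proof (cases "even k")
      case True
      then obtain i where "k = 2 * i" by (elim evenE)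
      then show ?thesis using k q by auto
    next
      case False
      then obtain i where "k = 2 * i + 1" by (elim oddE)
      then have "k = q - 2 * (m - i)" "m - i \<in> {1..m}" using k q by auto
      then show ?thesis by blast
    qed
  qed (use q in auto)
  also have "prod s \<dots> = (\<Prod>i=1..m. s (2 * i)) * (\<Prod>i=1..m. s (q - 2 * i))"
  proof (subst prod.union_disjoint)
    show "(\<lambda>i. 2 * i) ` {1..m} \<inter> (\<lambda>i. q - 2 * i) ` {1..m} = {}"
    proof -
      have "2 * i \<noteq> q - 2 * j" if "j \<in> {1..m}" for i j using that q by presburger
      then show ?thesis by auto
    qed
    show "prod s ((\<lambda>i. 2 * i) ` {1..m}) * prod s ((\<lambda>i. q - 2 * i) ` {1..m}) = (\<Prod>i=1..m. s (2 * i)) * (\<Prod>i=1..m. s (q - 2 * i))"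
      by (subst (1 2) prod.reindex) (use q in \<open>auto simp: inj_on_def\<close>)
  qed auto
  also have "(\<Prod>i=1..m. s (q - 2 * i)) = (\<Prod>i=1..m. s (2 * i))"
  proof (rule prod.cong[OF refl])
    fix i assume i: "i \<in> {1..m}"
    have "pi * real ((q - 2 * i) * p) / real q = real p * pi - pi * real (2 * i * p) / real q"
      using i q by (simp add: of_nat_diff field_simps)
    then show "s (q - 2 * i) = s (2 * i)" by (simp add: s_def sin_diff abs_mult power_abs)
  qed
  also have "(\<Prod>i=1..m. s (2 * i)) * (\<Prod>i=1..m. s (2 * i)) = (\<Prod>i=1..m. hopping p q (2 * i))"
    by (simp add: prod.distrib[symmetric] s_def hopping_def power2_eq_square)
  finally show ?thesis by simp
qed

lemma hopping_nonzero:
  assumes "coprime p q" "0 < k" "k < q"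
  shows "sin (pi * real (k * p) / real q) \<noteq> 0" "hopping p q k > 0"
proof -
  have "1 - unit_root p q ^ k \<noteq> 0" using unit_root_root(2)[of q p k] assms by auto
  then show "sin (pi * real (k * p) / real q) \<noteq> 0"
    using norm_one_minus_unit_root[of p q k] by auto
  then show "hopping p q k > 0" by (simp add: hopping_def)
qed

lemma ratio_hopping:
  assumes co: "coprime p q" and k: "2 * k < q"
  shows "(\<Prod>i=1..k. hopping p q (2 * i - 1)) =
    (\<Prod>i=1..k. hopping p q (2 * i)) * exp (- 2 * (\<Sum>n=1..2*k. (-1) ^ n * ln \<bar>sin (pi * real (n * p) / real q)\<bar>))"
  using k
proof (induction k)
  case (Suc k)
  define l where "l n = ln \<bar>sin (pi * real (n * p) / real q)\<bar>" for n
  have h: "hopping p q n = 4 * exp (2 * l n)" if "0 < n" "n < q" for n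
  proof -
    have "exp (2 * l n) = exp (l n) * exp (l n)" by (simp flip: exp_add)
    also have "\<dots> = (sin (pi * real (n * p) / real q))\<^sup>2"
      using hopping_nonzero(1)[OF co that] by (simp add: l_def power2_eq_square)
    finally show ?thesis by (simp add: hopping_def)
  qed
  have "(\<Sum>n=1..2 * Suc k. (-1) ^ n * l n) = (\<Sum>n=1..2*k. (-1) ^ n * l n) - l (2 * k + 1) + l (2 * k + 2)"
    by simp
  then have "exp (- 2 * (\<Sum>n=1..2 * Suc k. (-1) ^ n * l n))
     = exp (- 2 * (\<Sum>n=1..2*k. (-1) ^ n * l n)) * exp (2 * l (2 * k + 1)) * exp (- (2 * l (2 * k + 2)))"
    by (simp flip: exp_add)
  then show ?case
    using Suc h[of "2 * k + 1"] h[of "2 * k + 2"]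
    unfolding l_def[symmetric] by (simp add: exp_minus mult_ac)
qed simp

text \<open>An even partial quotient preserves the parity of numerator plus denominator, starting
  from 0/1. The odd first quotient then converts this into the parity of q.\<close>

lemma odd_denominator_aux:
  assumes "\<forall>a\<in>set as. a > 0 \<and> even a" "real p / real q = cfrac as" "coprime p q" "q > 0"
  shows "odd (p + q)"
  using assms
proof (induction as arbitrary: p q)
  case Nil
  then have "p = 0" "q = 1" by auto
  then show ?case by simp
next
  case (Cons a as)
  have c: "0 \<le> cfrac as" "cfrac as \<le> 1/2" using cfrac_even_bounds[of as] Cons.prems by auto
  have a: "a > 0" "even a" using Cons.prems by auto
  have "cfrac as < 1" using c by simp
  note D = cfrac_Cons_division[OF Cons.prems(2) c(1) this a(1) Cons.prems(3,4)]
  have "odd (q mod p + p)"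
    by (rule Cons.IH[OF _ D(3,4,1)]) (use Cons.prems(1) in simp)
  moreover have "q = a * p + q mod p" using div_mult_mod_eq[of q p] D(2) by simp
  ultimately show ?case using a(2) by (metis even_add even_mult_iff)
qed

lemma odd_even_cfracE:
  assumes "odd_even_cfrac p q as"
  obtains a bs where "as = a # bs" "odd a" "\<forall>a\<in>set bs. a > 0 \<and> even a"
    "real p / real q = cfrac (a # bs)" "coprime p q" "q > 0" "odd q"
proof -
  obtain a bs where as: "as = a # bs" using assms by (cases as) (auto simp: odd_even_cfrac_def)
  have h: "odd a" "\<forall>a\<in>set bs. a > 0 \<and> even a" "real p / real q = cfrac (a # bs)" "coprime p q" "q > 0" "a > 0"
    using assms unfolding odd_even_cfrac_def as by auto
  have c: "0 \<le> cfrac bs" "cfrac bs < 1" using cfrac_even_bounds[OF h(2)] by auto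
  note D = cfrac_Cons_division[OF h(3) c h(6,4,5)]
  have "odd (q mod p + p)" by (rule odd_denominator_aux[OF h(2) D(3,4,1)])
  moreover have "q = a * p + q mod p" using div_mult_mod_eq[of q p] D(2) by simp
  ultimately have "odd q" using h(1) by (metis even_add even_mult_iff)
  then show ?thesis using that as h by blast
qed

text \<open>Trading odd bonds for even ones in a summand costs the square of
  \<open>exp (3 + 4 * ln (real q))\<close>, and the even bonds multiply to q. There are m + 1 \<le>
  q summands, all nonnegative.\<close>

lemma deriv_discriminant_0:
  assumes "odd_even_cfrac p q as"
  shows "\<bar>deriv (discriminant p q) 0\<bar> \<le> exp 6 * real q ^ 10"
proof -
  obtain a bs where as: "odd a" "\<forall>a\<in>set bs. a > 0 \<and> even a"
    "real p / real q = cfrac (a # bs)" "coprime p q" "q > 0" "odd q"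
    using odd_even_cfracE[OF assms] by metis
  obtain m where m: "q = 2 * m + 1" using as by (elim oddE)
  define S where "S k = (\<Sum>n=1..2*k. (-1) ^ n * ln \<bar>sin (pi * real (n * p) / real q)\<bar>)" for k
  have summand: "(\<Prod>i=1..k. hopping p q (2 * i - 1)) * (\<Prod>i=Suc k..m. hopping p q (2 * i)) \<le> exp 6 * real q ^ 9"
    if k: "k \<le> m" for k
  proof -
    have "(\<Prod>i=1..k. hopping p q (2 * i - 1)) * (\<Prod>i=Suc k..m. hopping p q (2 * i))
       = ((\<Prod>i=1..k. hopping p q (2 * i)) * (\<Prod>i=Suc k..m. hopping p q (2 * i))) * exp (- 2 * S k)"
      using ratio_hopping[OF as(4), of k] k m by (simp add: S_def)
    also have "(\<Prod>i=1..k. hopping p q (2 * i)) * (\<Prod>i=Suc k..m. hopping p q (2 * i)) = (\<Prod>i=1..m. hopping p q (2 * i))"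
      using prod.ub_add_nat[of 1 k "\<lambda>i. hopping p q (2 * i)" "m - k"] k by simp
    also have "\<dots> = real q" by (rule prod_hopping_even[OF m as(4)])
    also have "exp (- 2 * S k) \<le> exp (2 * (3 + 4 * ln (real q)))"
    proof -
      have "\<bar>S k\<bar> \<le> 3 + 4 * ln (real q)"
        unfolding S_def by (rule alternating_ln_sin_bound[OF as(2,1,3,4)]) (use k m in simp)
      then have "- S k \<le> 3 + 4 * ln (real q)" by (rule abs_le_D2)
      then have "- 2 * S k \<le> 2 * (3 + 4 * ln (real q))" by simp
      then show ?thesis by (simp only: exp_le_cancel_iff)
    qed
    also have "exp (2 * (3 + 4 * ln (real q))) = exp 6 * real q ^ 8"
    proof -
      have "2 * (3 + 4 * ln (real q)) = 6 + real 8 * ln (real q)" by simp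
      then have "exp (2 * (3 + 4 * ln (real q))) = exp 6 * exp (real 8 * ln (real q))"
        by (simp only: exp_add)
      then show ?thesis using as(5) by (simp only: exp_of_nat_mult) simp
    qed
    finally show ?thesis using as(5) by (simp add: mult_left_mono power_numeral_reduce algebra_simps)
  qed
  have "complex_of_real (deriv (discriminant p q) 0) = poly (pderiv (- jacobi p q (2 * m + 1))) 0"
    using of_real_deriv_discriminant[of p q 0] disc_poly_eq_jacobi[OF as(6,4)] m by simp
  then have "\<bar>deriv (discriminant p q) 0\<bar> = norm (poly (pderiv (jacobi p q (2 * m + 1))) 0)"
    by (metis norm_minus_cancel norm_of_real pderiv_minus poly_minus)
  also have "\<dots> = (\<Sum>j\<le>m. (\<Prod>i=1..j. hopping p q (2 * i - 1)) * (\<Prod>i=Suc j..m. hopping p q (2 * i)))"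
    unfolding pderiv_jacobi_at_0 norm_of_real abs_mult
    by (simp add: power_abs, intro abs_of_nonneg sum_nonneg mult_nonneg_nonneg prod_nonneg) (auto simp: hopping_def)
  also have "\<dots> \<le> (\<Sum>j\<le>m. exp 6 * real q ^ 9)" by (intro sum_mono summand) simp
  also have "\<dots> = real (m + 1) * (exp 6 * real q ^ 9)" by simp
  also have "\<dots> \<le> real q * (exp 6 * real q ^ 9)" using m by (intro mult_right_mono) auto
  also have "\<dots> = exp 6 * real q ^ 10" by (simp add: power_numeral_reduce algebra_simps)
  finally show ?thesis .
qed

section \<open>Bands and gaps\<close>

text \<open>What the geometry of bands and gaps uses of the discriminant: full sets of real
  solutions at every level, oddness, and the derivative bound on the spectrum.\<close>

locale band_function =
  fixes f f' :: "real \<Rightarrow> real" and m :: nat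
  assumes fin: "\<And>c. \<bar>c\<bar> \<le> 4 \<Longrightarrow> finite {x. f x = c}"
    and card: "\<And>c. \<bar>c\<bar> \<le> 4 \<Longrightarrow> card {x. f x = c} = 2 * m + 1"
    and factor: "\<And>c x. \<bar>c\<bar> \<le> 4 \<Longrightarrow> f x - c = - (\<Prod>\<mu> | f \<mu> = c. x - \<mu>)"
    and odd: "\<And>x. f (- x) = - f x"
    and deriv: "\<And>x. (f has_real_derivative f' x) (at x)"
    and deriv_ge: "\<And>x. \<bar>f x\<bar> \<le> 4 \<Longrightarrow> 1 \<le> \<bar>f' x\<bar>"
    and le_4: "\<And>x. \<bar>f x\<bar> \<le> 4 \<Longrightarrow> \<bar>x\<bar> \<le> 4"
begin

definition S :: "real set" where "S = {x. \<bar>f x\<bar> \<le> 4}"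
definition Z :: "real set" where "Z = {x. f x = 0}"
definition C :: "real \<Rightarrow> real set" where "C \<zeta> = connected_component_set S \<zeta>"
definition L :: "real \<Rightarrow> real" where "L \<zeta> = Inf (C \<zeta>)"
definition R :: "real \<Rightarrow> real" where "R \<zeta> = Sup (C \<zeta>)"

section \<open>Bands as components, each around one zero\<close>

lemma isCont_f: "isCont f x"
  using deriv by (rule DERIV_isCont)

lemma continuous_f: "continuous_on A f"
  by (simp add: isCont_f continuous_at_imp_continuous_on)

lemma f_0: "f 0 = 0"
  using odd[of 0] by simp

lemma compact_S: "compact S"
proof -
  have "S = f -` {-4..4}" by (auto simp: S_def abs_le_iff)
  moreover have "closed (f -` {-4..4})"
    by (rule continuous_closed_vimage) (auto simp: isCont_f)
  moreover have "S \<subseteq> {-4..4}"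
  proof
    fix x assume "x \<in> S"
    then have "\<bar>x\<bar> \<le> 4" using le_4[of x] by (simp add: S_def)
    then show "x \<in> {-4..4}" by auto
  qed
  then have "bounded S" by (rule bounded_subset[OF bounded_closed_interval])
  ultimately show ?thesis by (simp add: compact_eq_bounded_closed)
qed

text \<open>By Rolle, as the derivative does not vanish on \<open>S\<close>.\<close>

lemma inj_on_interval:
  assumes "{a..b} \<subseteq> S"
  shows "inj_on f {a..b}"
proof (rule linorder_inj_onI)
  fix x y assume xy: "x < y" "x \<in> {a..b}" "y \<in> {a..b}"
  show "f x \<noteq> f y"
  proof
    assume "f x = f y"
    have "\<exists>u. x < u \<and> u < y \<and> DERIV f u :> 0"
    proof (rule Rolle[OF xy(1) \<open>f x = f y\<close> continuous_f])
      show "f differentiable (at u)" for u using deriv[of u] by (auto simp: real_differentiable_def)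
    qed
    then obtain u where u: "x < u" "u < y" "DERIV f u :> 0" by blast
    then have "f' u = 0" using deriv DERIV_unique by blast
    moreover have "u \<in> S" using u xy assms by auto
    ultimately show False using deriv_ge[of u] by (simp add: S_def)
  qed
qed auto

lemma Z_subset_S: "Z \<subseteq> S"
  by (auto simp: Z_def S_def)

lemma C_subset_S: "C \<zeta> \<subseteq> S"
  unfolding C_def by (rule connected_component_subset)

lemma mem_C: "\<zeta> \<in> S \<Longrightarrow> \<zeta> \<in> C \<zeta>"
  unfolding C_def by (simp add: connected_component_refl)

lemma subset_C: "connected A \<Longrightarrow> A \<subseteq> S \<Longrightarrow> \<zeta> \<in> A \<Longrightarrow> A \<subseteq> C \<zeta>"
  unfolding C_def by (rule connected_component_maximal)

lemma C_interval:
  assumes "\<zeta> \<in> S"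
  shows "C \<zeta> = {L \<zeta>..R \<zeta>}" "L \<zeta> \<le> \<zeta>" "\<zeta> \<le> R \<zeta>"
proof -
  have "closed (C \<zeta>)"
    unfolding C_def using compact_S by (intro closed_connected_component compact_imp_closed)
  moreover have "bounded (C \<zeta>)"
    using C_subset_S compact_S by (meson bounded_subset compact_imp_bounded)
  ultimately have "connected (C \<zeta>) \<and> compact (C \<zeta>)"
    unfolding compact_eq_bounded_closed by (simp add: C_def)
  then obtain a b where ab: "C \<zeta> = {a..b}" using connected_compact_interval_1 by metis
  have z: "\<zeta> \<in> {a..b}" using mem_C[OF assms] ab by simp
  then have "L \<zeta> = a" "R \<zeta> = b" unfolding L_def R_def ab by auto
  then show "C \<zeta> = {L \<zeta>..R \<zeta>}" "L \<zeta> \<le> \<zeta>" "\<zeta> \<le> R \<zeta>" using ab z by auto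
qed

lemma f_endpoints:
  assumes "\<zeta> \<in> S"
  shows "\<bar>f (L \<zeta>)\<bar> = 4" "\<bar>f (R \<zeta>)\<bar> = 4"
proof -
  note I = C_interval[OF assms]
  have nb: "\<exists>e>0. {x - e..x + e} \<subseteq> S" if "\<bar>f x\<bar> < 4" for x
  proof -
    have "open (f -` {-4<..<4})" by (rule continuous_open_vimage) (auto simp: isCont_f)
    moreover have "x \<in> f -` {-4<..<4}" using that by (simp add: abs_less_iff)
    ultimately obtain e where e: "e > 0" "cball x e \<subseteq> f -` {-4<..<4}"
      using open_contains_cball[of "f -` {-4<..<4}"] by blast
    then have "{x - e..x + e} \<subseteq> S" by (auto simp: S_def cball_eq_atLeastAtMost abs_le_iff less_imp_le subset_iff)
    then show ?thesis using e by blast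
  qed
  have S: "L \<zeta> \<in> S" "R \<zeta> \<in> S" "{L \<zeta>..R \<zeta>} \<subseteq> S" using I C_subset_S[of \<zeta>] by auto
  show "\<bar>f (L \<zeta>)\<bar> = 4"
  proof (rule ccontr)
    assume "\<bar>f (L \<zeta>)\<bar> \<noteq> 4"
    then have "\<bar>f (L \<zeta>)\<bar> < 4" using S by (auto simp: S_def)
    then obtain e where e: "e > 0" "{L \<zeta> - e..L \<zeta> + e} \<subseteq> S" using nb by blast
    have "{L \<zeta> - e..R \<zeta>} \<subseteq> S"
    proof
      fix x assume "x \<in> {L \<zeta> - e..R \<zeta>}"
      then have "x \<in> {L \<zeta> - e..L \<zeta> + e} \<or> x \<in> {L \<zeta>..R \<zeta>}" using e(1) by auto
      then show "x \<in> S" using e(2) S(3) by blast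
    qed
    then have "{L \<zeta> - e..R \<zeta>} \<subseteq> C \<zeta>" using I e(1) by (intro subset_C) auto
    then have "L \<zeta> - e \<in> {L \<zeta>..R \<zeta>}" using I e(1) by auto
    then show False using e(1) by simp
  qed
  show "\<bar>f (R \<zeta>)\<bar> = 4"
  proof (rule ccontr)
    assume "\<bar>f (R \<zeta>)\<bar> \<noteq> 4"
    then have "\<bar>f (R \<zeta>)\<bar> < 4" using S by (auto simp: S_def)
    then obtain e where e: "e > 0" "{R \<zeta> - e..R \<zeta> + e} \<subseteq> S" using nb by blast
    have "{L \<zeta>..R \<zeta> + e} \<subseteq> S"
    proof
      fix x assume "x \<in> {L \<zeta>..R \<zeta> + e}"
      then have "x \<in> {R \<zeta> - e..R \<zeta> + e} \<or> x \<in> {L \<zeta>..R \<zeta>}" using e(1) by auto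
      then show "x \<in> S" using e(2) S(3) by blast
    qed
    then have "{L \<zeta>..R \<zeta> + e} \<subseteq> C \<zeta>" using I e(1) by (intro subset_C) auto
    then have "R \<zeta> + e \<in> {L \<zeta>..R \<zeta>}" using I e(1) by auto
    then show False using e(1) by simp
  qed
qed

lemma zero_band:
  assumes "\<zeta> \<in> Z"
  shows "C \<zeta> = {L \<zeta>..R \<zeta>}" "L \<zeta> < \<zeta>" "\<zeta> < R \<zeta>" "inj_on f {L \<zeta>..R \<zeta>}"
    "\<bar>f (L \<zeta>)\<bar> = 4" "\<bar>f (R \<zeta>)\<bar> = 4" "f (R \<zeta>) = - f (L \<zeta>)"
proof -
  have s: "\<zeta> \<in> S" using assms Z_subset_S by auto
  note I = C_interval[OF s] and E = f_endpoints[OF s]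
  have z: "f \<zeta> = 0" using assms by (simp add: Z_def)
  show "C \<zeta> = {L \<zeta>..R \<zeta>}" by (rule I(1))
  show "L \<zeta> < \<zeta>" "\<zeta> < R \<zeta>" using I E z by (auto simp: less_le)
  then have "L \<zeta> \<noteq> R \<zeta>" by simp
  show inj: "inj_on f {L \<zeta>..R \<zeta>}" using inj_on_interval C_subset_S I by metis
  show "\<bar>f (L \<zeta>)\<bar> = 4" "\<bar>f (R \<zeta>)\<bar> = 4" using E .
  have "f (L \<zeta>) \<noteq> f (R \<zeta>)" using inj \<open>L \<zeta> \<noteq> R \<zeta>\<close> I by (auto simp: inj_on_def)
  then show "f (R \<zeta>) = - f (L \<zeta>)" using E by (auto simp: abs_if split: if_splits)
qed

text \<open>Bands that meet would make the interval between the two zeros part of \<open>S\<close>,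
  where the function is injective.\<close>

lemma disjoint_bands:
  assumes "\<zeta> \<in> Z" "\<zeta>' \<in> Z" "\<zeta> < \<zeta>'"
  shows "R \<zeta> < L \<zeta>'"
proof (rule ccontr)
  assume "\<not> R \<zeta> < L \<zeta>'"
  note A = zero_band[OF assms(1)] and B = zero_band[OF assms(2)]
  have "{\<zeta>..\<zeta>'} \<subseteq> S"
  proof
    fix x assume "x \<in> {\<zeta>..\<zeta>'}"
    then have "x \<in> C \<zeta> \<or> x \<in> C \<zeta>'" using A B \<open>\<not> R \<zeta> < L \<zeta>'\<close> by auto
    then show "x \<in> S" using C_subset_S by blast
  qed
  then have "inj_on f {\<zeta>..\<zeta>'}" by (rule inj_on_interval)
  then show False using inj_onD[of f "{\<zeta>..\<zeta>'}" \<zeta> \<zeta>'] assms by (simp add: Z_def)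
qed

lemma finite_Z: "finite Z" and card_Z: "card Z = 2 * m + 1"
  using fin[of 0] card[of 0] by (simp_all add: Z_def)

lemma level_in_band:
  assumes "\<zeta> \<in> Z" "\<bar>c\<bar> \<le> 4"
  shows "\<exists>x\<in>{L \<zeta>..R \<zeta>}. f x = c"
proof -
  note A = zero_band[OF assms(1)]
  have "(f (L \<zeta>) \<le> c \<and> c \<le> f (R \<zeta>)) \<or> (f (R \<zeta>) \<le> c \<and> c \<le> f (L \<zeta>))"
    using A assms(2) by (auto simp: abs_if split: if_splits)
  then show ?thesis
  proof
    assume "f (L \<zeta>) \<le> c \<and> c \<le> f (R \<zeta>)"
    then show ?thesis using IVT'[of f "L \<zeta>" c "R \<zeta>"] A continuous_f by force
  next
    assume "f (R \<zeta>) \<le> c \<and> c \<le> f (L \<zeta>)"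
    then show ?thesis using IVT2'[of f "R \<zeta>" c "L \<zeta>"] A continuous_f by force
  qed
qed

text \<open>The intermediate value theorem gives one solution in the band of each zero. There are as
  many zeros as solutions, so none is left over.\<close>

lemma level_bij:
  assumes c: "\<bar>c\<bar> \<le> 4"
  shows "\<exists>\<rho>. bij_betw \<rho> Z {x. f x = c} \<and> (\<forall>\<zeta>\<in>Z. \<rho> \<zeta> \<in> {L \<zeta>..R \<zeta>})"
proof -
  obtain \<rho> where \<rho>: "\<And>\<zeta>. \<zeta> \<in> Z \<Longrightarrow> \<rho> \<zeta> \<in> {L \<zeta>..R \<zeta>} \<and> f (\<rho> \<zeta>) = c"
    using level_in_band[OF _ c] by metis
  have inj: "inj_on \<rho> Z"
  proof (rule linorder_inj_onI)
    fix x y assume xy: "x < y" "x \<in> Z" "y \<in> Z"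
    have "\<rho> x \<le> R x" "R x < L y" "L y \<le> \<rho> y" using \<rho> xy disjoint_bands by auto
    then show "\<rho> x \<noteq> \<rho> y" by simp
  qed auto
  have "\<rho> ` Z = {x. f x = c}"
  proof (rule card_subset_eq)
    show "card (\<rho> ` Z) = card {x. f x = c}" using card_image[OF inj] card_Z card[OF c] by simp
  qed (use \<rho> fin[OF c] in auto)
  then show ?thesis using inj \<rho> by (auto simp: bij_betw_def)
qed

text \<open>Every point of \<open>S\<close> is a solution at its own level, hence lies in the band
  of some zero by \<open>level_bij\<close>.\<close>

lemma components_S: "components S = C ` Z"
proof
  show "C ` Z \<subseteq> components S" using Z_subset_S by (auto simp: components_def C_def)
  show "components S \<subseteq> C ` Z"
  proof
    fix B assume "B \<in> components S"
    then obtain x where x: "x \<in> S" "B = C x" by (auto simp: components_def C_def)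
    then have "\<bar>f x\<bar> \<le> 4" by (simp add: S_def)
    then obtain \<rho> where \<rho>: "bij_betw \<rho> Z {y. f y = f x}" "\<forall>\<zeta>\<in>Z. \<rho> \<zeta> \<in> {L \<zeta>..R \<zeta>}"
      using level_bij by blast
    then obtain \<zeta> where \<zeta>: "\<zeta> \<in> Z" "x = \<rho> \<zeta>" by (auto simp: bij_betw_def)
    then have "x \<in> C \<zeta>" using \<rho>(2) zero_band(1) by auto
    then have "C x = C \<zeta>" unfolding C_def using connected_component_eq by metis
    then show "B \<in> C ` Z" using x \<zeta> by auto
  qed
qed

lemma minus_Z: "\<zeta> \<in> Z \<Longrightarrow> - \<zeta> \<in> Z"
  by (simp add: Z_def odd)

lemma reflect:
  assumes "\<zeta> \<in> Z"
  shows "L (- \<zeta>) = - R \<zeta>"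
proof -
  have le: "L (- \<xi>) \<le> - R \<xi> \<and> - L \<xi> \<le> R (- \<xi>)" if "\<xi> \<in> Z" for \<xi>
  proof -
    note A = zero_band[OF that] and B = zero_band[OF minus_Z[OF that]]
    have "x \<in> S" if "x \<in> {- R \<xi>..- L \<xi>}" for x
    proof -
      have "- x \<in> {L \<xi>..R \<xi>}" using that by auto
      then have "- x \<in> S" using A C_subset_S by blast
      then show ?thesis using odd[of x] by (simp add: S_def)
    qed
    then have "{- R \<xi>..- L \<xi>} \<subseteq> C (- \<xi>)" using A by (intro subset_C) auto
    then show ?thesis using B A by auto
  qed
  show ?thesis using le[OF assms] le[OF minus_Z[OF assms]] by auto
qed

text \<open>\<open>e (-m) < \<dots> < e m\<close> are the zeros of \<open>f\<close>, and \<open>{l i..r i}\<close> below is the band around \<open>e i\<close>.\<close>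

definition e :: "int \<Rightarrow> real" where
  "e i = sorted_list_of_set Z ! nat (i + int m)"

abbreviation I :: "int set" where "I \<equiv> {- int m..int m}"

lemma e_strict_mono: "i \<in> I \<Longrightarrow> j \<in> I \<Longrightarrow> i < j \<Longrightarrow> e i < e j"
  unfolding e_def using card_Z
  by (intro sorted_wrt_nth_less[OF strict_sorted_list_of_set]) auto

lemma e_bij: "bij_betw e I Z"
proof -
  have inj: "inj_on e I"
  proof (rule linorder_inj_onI)
    fix i j assume "i < j" "i \<in> I" "j \<in> I"
    then have "e i < e j" by (intro e_strict_mono)
    then show "e i \<noteq> e j" by simp
  qed auto
  have "e ` I = Z"
  proof (rule card_subset_eq[OF finite_Z])
    show "e ` I \<subseteq> Z"
    proof
      fix x assume "x \<in> e ` I"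
      then obtain i where i: "i \<in> I" "x = e i" by blast
      have "nat (i + int m) < length (sorted_list_of_set Z)" using i card_Z by auto
      then have "x \<in> set (sorted_list_of_set Z)" unfolding i e_def by (rule nth_mem)
      then show "x \<in> Z" using finite_Z by simp
    qed
    show "card (e ` I) = card Z" using card_image[OF inj] card_Z by simp
  qed
  then show ?thesis using inj by (simp add: bij_betw_def)
qed

lemma e_Z: "i \<in> I \<Longrightarrow> e i \<in> Z"
  using e_bij by (auto simp: bij_betw_def)

lemma e_image: "e ` I = Z"
  using e_bij by (simp add: bij_betw_def)

lemma Z_cases: "\<zeta> \<in> Z \<Longrightarrow> (\<And>i. i \<in> I \<Longrightarrow> \<zeta> = e i \<Longrightarrow> P) \<Longrightarrow> P"
  using e_image by (metis imageE)

lemma e_less_iff: "i \<in> I \<Longrightarrow> j \<in> I \<Longrightarrow> e i < e j \<longleftrightarrow> i < j"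
  using e_strict_mono by (metis less_asym linorder_neqE)

lemma card_below: "i \<in> I \<Longrightarrow> int (card {\<zeta>\<in>Z. \<zeta> < e i}) = i + int m"
proof -
  assume i: "i \<in> I"
  have "{\<zeta>\<in>Z. \<zeta> < e i} = e ` {- int m..<i}"
  proof (intro set_eqI iffI)
    fix x assume x: "x \<in> {\<zeta>\<in>Z. \<zeta> < e i}"
    then obtain k where "k \<in> I" "x = e k" using Z_cases[of x] by blast
    then show "x \<in> e ` {- int m..<i}" using x i e_less_iff[of k i] by auto
  next
    fix x assume "x \<in> e ` {- int m..<i}"
    then obtain k where "k \<in> {- int m..<i}" "x = e k" by blast
    then show "x \<in> {\<zeta>\<in>Z. \<zeta> < e i}" using i e_less_iff[of k i] e_Z[of k] by auto
  qed
  moreover have "inj_on e {- int m..<i}"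
    using e_bij i by (auto simp: bij_betw_def intro: inj_on_subset)
  ultimately show ?thesis using i by (simp add: card_image)
qed

text \<open>Reflection reverses the order, so the rank of \<open>- e i\<close> from the left is the
  rank of \<open>e i\<close> from the right.\<close>

lemma e_minus: "i \<in> I \<Longrightarrow> e (- i) = - e i"
proof -
  assume i: "i \<in> I"
  have "- e i \<in> Z" by (intro minus_Z e_Z i)
  then obtain k where k: "k \<in> I" "- e i = e k" using Z_cases[of "- e i"] by blast
  have "card Z = card {\<zeta>\<in>Z. \<zeta> < e i} + card {\<zeta>\<in>Z. e i < \<zeta>} + 1"
  proof -
    have "Z = insert (e i) ({\<zeta>\<in>Z. \<zeta> < e i} \<union> {\<zeta>\<in>Z. e i < \<zeta>})" using e_Z[OF i] by auto
    moreover have "card (insert (e i) ({\<zeta>\<in>Z. \<zeta> < e i} \<union> {\<zeta>\<in>Z. e i < \<zeta>}))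
       = Suc (card ({\<zeta>\<in>Z. \<zeta> < e i} \<union> {\<zeta>\<in>Z. e i < \<zeta>}))"
      by (rule card_insert_disjoint) (use finite_Z in auto)
    moreover have "card ({\<zeta>\<in>Z. \<zeta> < e i} \<union> {\<zeta>\<in>Z. e i < \<zeta>}) = card {\<zeta>\<in>Z. \<zeta> < e i} + card {\<zeta>\<in>Z. e i < \<zeta>}"
      by (rule card_Un_disjoint) (use finite_Z in auto)
    ultimately show ?thesis by simp
  qed
  moreover have "card {\<zeta>\<in>Z. e i < \<zeta>} = card {\<zeta>\<in>Z. \<zeta> < - e i}"
  proof -
    have "{\<zeta>\<in>Z. \<zeta> < - e i} = uminus ` {\<zeta>\<in>Z. e i < \<zeta>}"
    proof (intro set_eqI iffI)
      fix x assume "x \<in> {\<zeta>\<in>Z. \<zeta> < - e i}"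
      then have "- x \<in> {\<zeta>\<in>Z. e i < \<zeta>}" using minus_Z by auto
      then show "x \<in> uminus ` {\<zeta>\<in>Z. e i < \<zeta>}" by (metis image_eqI minus_minus)
    qed (use minus_Z in auto)
    then show ?thesis by (simp add: card_image)
  qed
  ultimately have "int (card {\<zeta>\<in>Z. \<zeta> < e k}) = int (2 * m) - int (card {\<zeta>\<in>Z. \<zeta> < e i})"
    using card_Z k(2) by simp
  then have "k = - i" using card_below[OF i] card_below[OF k(1)] by simp
  then show ?thesis using k by simp
qed

definition l :: "int \<Rightarrow> real" where "l i = L (e i)"
definition r :: "int \<Rightarrow> real" where "r i = R (e i)"

lemma band_edges: "i \<in> I \<Longrightarrow> l i < e i" "i \<in> I \<Longrightarrow> e i < r i"
  and inj_on_band: "i \<in> I \<Longrightarrow> inj_on f {l i..r i}"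
  and f_band_edges: "i \<in> I \<Longrightarrow> \<bar>f (l i)\<bar> = 4" "i \<in> I \<Longrightarrow> \<bar>f (r i)\<bar> = 4" "i \<in> I \<Longrightarrow> f (r i) = - f (l i)"
  unfolding l_def r_def using zero_band[OF e_Z] by auto

lemma r_less_l: "i \<in> I \<Longrightarrow> j \<in> I \<Longrightarrow> i < j \<Longrightarrow> r i < l j"
  unfolding l_def r_def by (intro disjoint_bands e_Z e_strict_mono)

lemma l_minus: "i \<in> I \<Longrightarrow> l (- i) = - r i"
  unfolding l_def r_def by (simp add: e_minus reflect e_Z)

lemma C_e: "i \<in> I \<Longrightarrow> C (e i) = {l i..r i}"
  unfolding l_def r_def by (intro zero_band e_Z)

lemma band_index:
  assumes i: "i \<in> I"
  shows "(THE B. B \<in> components S \<and> int (card {B' \<in> components S. Sup B' < Inf B}) = i + int m) = {l i..r i}"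
proof -
  have SI: "Inf (C (e k)) = l k" "Sup (C (e k)) = r k" for k by (simp_all add: l_def r_def L_def R_def)
  have comp: "components S = (\<lambda>k. C (e k)) ` I"
    unfolding components_S e_image[symmetric] by (simp add: image_image)
  have inj: "inj_on (\<lambda>k. C (e k)) I"
  proof (rule linorder_inj_onI)
    fix j k assume jk: "j < k" "j \<in> I" "k \<in> I"
    have "r j < l k" "l j < r j" using r_less_l[OF jk(2,3,1)] band_edges[OF jk(2)] by auto
    then have "l j \<noteq> l k" by simp
    then show "C (e j) \<noteq> C (e k)" using SI(1) by metis
  qed auto
  have rank: "int (card {B' \<in> components S. Sup B' < Inf (C (e k))}) = k + int m" if k: "k \<in> I" for k
  proof -
    have "{B' \<in> components S. Sup B' < Inf (C (e k))} = (\<lambda>k. C (e k)) ` {- int m..<k}"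
    proof (intro set_eqI iffI)
      fix B assume "B \<in> {B' \<in> components S. Sup B' < Inf (C (e k))}"
      then obtain j where j: "j \<in> I" "B = C (e j)" "r j < l k" unfolding comp SI by (auto simp: SI)
      have "j < k"
      proof (rule ccontr)
        assume "\<not> j < k"
        then have "j = k \<or> k < j" by auto
        then show False using j k band_edges[OF k] band_edges[OF j(1)] r_less_l[of k j] by auto
      qed
      then show "B \<in> (\<lambda>k. C (e k)) ` {- int m..<k}" using j by auto
    next
      fix B assume "B \<in> (\<lambda>k. C (e k)) ` {- int m..<k}"
      then obtain j where j: "j \<in> {- int m..<k}" "B = C (e j)" by blast
      then have "j \<in> I" "r j < l k" using k r_less_l[of j k] by auto
      then show "B \<in> {B' \<in> components S. Sup B' < Inf (C (e k))}" using j unfolding comp by (auto simp: SI)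
    qed
    moreover have "inj_on (\<lambda>k. C (e k)) {- int m..<k}"
      by (rule inj_on_subset[OF inj]) (use k in auto)
    ultimately show ?thesis using k by (simp add: card_image)
  qed
  have "(THE B. B \<in> components S \<and> int (card {B' \<in> components S. Sup B' < Inf B}) = i + int m) = C (e i)"
  proof (rule the_equality)
    show "C (e i) \<in> components S \<and> int (card {B' \<in> components S. Sup B' < Inf (C (e i))}) = i + int m"
      using rank[OF i] i unfolding comp by blast
    fix B assume B: "B \<in> components S \<and> int (card {B' \<in> components S. Sup B' < Inf B}) = i + int m"
    then obtain k where k: "k \<in> I" "B = C (e k)" unfolding comp by auto
    then have "k + int m = i + int m" using B rank[OF k(1)] by simp
    then show "B = C (e i)" using k by simp
  qed
  then show ?thesis using C_e[OF i] by simp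
qed

lemma zero_in_I: "0 \<in> I" by simp

lemma e_0: "e 0 = 0"
  using e_minus[OF zero_in_I] by simp

definition half_width :: real where "half_width = r 0"

lemma l_0: "l 0 = - half_width"
  using l_minus[OF zero_in_I] by (simp add: half_width_def)

lemma half_width_pos: "half_width > 0"
  using band_edges(2)[OF zero_in_I] by (simp add: half_width_def e_0)

lemma f'_eq_prod:
  assumes "\<bar>f x\<bar> \<le> 4"
  shows "f' x = - (\<Prod>\<mu>\<in>{\<mu>. f \<mu> = f x} - {x}. x - \<mu>)"
proof -
  define g where "g y = - (\<Prod>\<mu>\<in>{\<mu>. f \<mu> = f x} - {x}. y - \<mu>)" for y
  have "f y - f x = g y * (y - x)" for y
  proof -
    have "(\<Prod>\<mu> | f \<mu> = f x. y - \<mu>) = (y - x) * (\<Prod>\<mu>\<in>{\<mu>. f \<mu> = f x} - {x}. y - \<mu>)"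
      by (rule prod.remove) (use fin[OF assms] in auto)
    then show ?thesis using factor[OF assms, of y] by (simp add: g_def)
  qed
  moreover have "isCont g x" unfolding g_def by (intro continuous_intros)
  ultimately have "DERIV f x :> g x" unfolding CARAT_DERIV by blast
  then show ?thesis using deriv DERIV_unique unfolding g_def by blast
qed

text \<open>At the edge w of the central band, 4 = w P with P the product of |w - \<mu>| over the
  nonzero zeros \<mu>. Reflection gives the same product with w + \<mu>, so P^2 is a product of |w^2
  - \<mu>^2| \<le> \<mu>^2, using w < |\<mu>|, and P is at most the modulus of the derivative at
  0.\<close>

lemma half_width_ge: "4 / \<bar>f' 0\<bar> \<le> half_width" and f'_0_ge: "1 \<le> \<bar>f' 0\<bar>"
proof -
  show d: "1 \<le> \<bar>f' 0\<bar>" using deriv_ge[of 0] f_0 by simp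
  define Z' where "Z' = Z - {0}"
  have Z': "{\<mu>. f \<mu> = f 0} - {0} = Z'" by (auto simp: Z'_def Z_def f_0)
  have z: "\<bar>f' 0\<bar> = (\<Prod>\<mu>\<in>Z'. \<bar>\<mu>\<bar>)"
    using f'_eq_prod[of 0] f_0 unfolding Z' by (simp add: abs_prod)
  have "f half_width - 0 = - (\<Prod>\<mu> | f \<mu> = 0. half_width - \<mu>)" by (rule factor) simp
  also have "(\<Prod>\<mu> | f \<mu> = 0. half_width - \<mu>) = (half_width - 0) * (\<Prod>\<mu>\<in>Z'. half_width - \<mu>)"
    unfolding Z'_def Z_def by (rule prod.remove) (use fin[of 0] f_0 in auto)
  finally have "\<bar>f half_width\<bar> = half_width * (\<Prod>\<mu>\<in>Z'. \<bar>half_width - \<mu>\<bar>)" using half_width_pos by (simp add: abs_mult abs_prod)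
  then have four: "4 = half_width * (\<Prod>\<mu>\<in>Z'. \<bar>half_width - \<mu>\<bar>)" using f_band_edges(2)[OF zero_in_I] by (simp add: half_width_def)
  have "(\<Prod>\<mu>\<in>Z'. \<bar>half_width - \<mu>\<bar>) = (\<Prod>\<mu>\<in>Z'. \<bar>half_width + \<mu>\<bar>)"
    by (rule prod.reindex_bij_witness[of _ uminus uminus]) (auto simp: Z'_def minus_Z)
  then have "(\<Prod>\<mu>\<in>Z'. \<bar>half_width - \<mu>\<bar>)\<^sup>2 = (\<Prod>\<mu>\<in>Z'. \<bar>half_width - \<mu>\<bar> * \<bar>half_width + \<mu>\<bar>)"
    by (simp add: power2_eq_square prod.distrib)
  also have "\<dots> \<le> (\<Prod>\<mu>\<in>Z'. \<bar>\<mu>\<bar> * \<bar>\<mu>\<bar>)"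
  proof (rule prod_mono)
    fix \<mu> assume \<mu>: "\<mu> \<in> Z'"
    then obtain i where i: "i \<in> I" "\<mu> = e i" using Z_cases[of \<mu>] unfolding Z'_def by blast
    then have "i \<noteq> 0" using \<mu> e_0 by (auto simp: Z'_def)
    have "half_width < \<bar>\<mu>\<bar>"
    proof (cases "i > 0")
      case True
      have "half_width < l i" unfolding half_width_def by (rule r_less_l) (use i True in auto)
      then show ?thesis using band_edges(1)[OF i(1)] i by simp
    next
      case False
      have "r i < l 0" by (rule r_less_l) (use i False \<open>i \<noteq> 0\<close> in auto)
      then show ?thesis using band_edges(2)[OF i(1)] i l_0 by simp
    qed
    then have "half_width * half_width \<le> \<bar>\<mu>\<bar> * \<bar>\<mu>\<bar>" using half_width_pos by (intro mult_mono) auto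
    moreover have "\<bar>half_width - \<mu>\<bar> * \<bar>half_width + \<mu>\<bar> = \<bar>half_width * half_width - \<bar>\<mu>\<bar> * \<bar>\<mu>\<bar>\<bar>"
      by (simp add: algebra_simps flip: abs_mult)
    ultimately show "0 \<le> \<bar>half_width - \<mu>\<bar> * \<bar>half_width + \<mu>\<bar> \<and> \<bar>half_width - \<mu>\<bar> * \<bar>half_width + \<mu>\<bar> \<le> \<bar>\<mu>\<bar> * \<bar>\<mu>\<bar>"
      using half_width_pos by auto
  qed
  also have "\<dots> = (\<bar>f' 0\<bar>)\<^sup>2" unfolding z by (simp only: power2_eq_square prod.distrib)
  finally have "(\<Prod>\<mu>\<in>Z'. \<bar>half_width - \<mu>\<bar>) \<le> \<bar>f' 0\<bar>" by (rule power2_le_imp_le) simp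
  then have "4 \<le> half_width * \<bar>f' 0\<bar>" using four half_width_pos by (metis mult_left_mono less_imp_le)
  then show "4 / \<bar>f' 0\<bar> \<le> half_width" using d by (simp add: divide_le_eq)
qed

text \<open>Opposite values at the two edges would force a zero inside the gap.\<close>

lemma f_gap:
  assumes i: "i \<in> I" "i + 1 \<in> I"
  shows "f (l (i + 1)) = f (r i)"
proof (rule ccontr)
  assume ne: "f (l (i + 1)) \<noteq> f (r i)"
  have lt: "r i < l (i + 1)" using r_less_l[OF i] by simp
  have opp: "f (l (i + 1)) = - f (r i)"
    using ne f_band_edges(1)[OF i(2)] f_band_edges(2)[OF i(1)] by (auto simp: abs_if split: if_splits)
  have "\<exists>x. r i \<le> x \<and> x \<le> l (i + 1) \<and> f x = 0"
  proof (cases "f (r i) \<le> 0")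
    case True
    then show ?thesis using IVT'[of f "r i" 0 "l (i + 1)"] opp lt continuous_f by auto
  next
    case False
    then show ?thesis using IVT2'[of f "l (i + 1)" 0 "r i"] opp lt continuous_f by auto
  qed
  then obtain x where x: "r i \<le> x" "x \<le> l (i + 1)" "x \<in> Z" by (auto simp: Z_def)
  then obtain k where k: "k \<in> I" "x = e k" using Z_cases[of x] by blast
  have "e i < e k" using band_edges(2)[OF i(1)] x k by simp
  moreover have "e k < e (i + 1)" using band_edges(1)[OF i(2)] x k by simp
  ultimately have "i < k" "k < i + 1" using e_less_iff i k by blast+
  then show False by simp
qed

section \<open>Lower bounds for the gaps\<close>

lemma level_enum:
  assumes c: "\<bar>c\<bar> \<le> 4"
  shows "\<exists>\<rho>. bij_betw \<rho> I {x. f x = c} \<and> (\<forall>i\<in>I. \<rho> i \<in> {l i..r i})"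
proof -
  obtain \<rho> where \<rho>: "bij_betw \<rho> Z {x. f x = c}" "\<forall>\<zeta>\<in>Z. \<rho> \<zeta> \<in> {L \<zeta>..R \<zeta>}"
    using level_bij[OF c] by blast
  have "bij_betw (\<rho> \<circ> e) I {x. f x = c}" by (rule bij_betw_trans[OF e_bij \<rho>(1)])
  moreover have "\<forall>i\<in>I. (\<rho> \<circ> e) i \<in> {l i..r i}" using \<rho>(2) e_Z by (simp add: l_def r_def)
  ultimately show ?thesis by blast
qed

text \<open>Band edges at which \<open>f\<close> takes the same value \<open>\<plusminus>4\<close> have product of modulus 4, so in the
  factorisation of \<open>f'\<close> at a gap edge \<open>x\<close> only the factors \<open>1 - x/\<lambda>\<close> need to be controlled:
  the factor of the \<open>i\<close>-th band to the right of the gap is paired with that of band \<open>-(i+1)\<close>.\<close>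

lemma gap_ge:
  assumes j: "j < m"
  defines "x \<equiv> r (int j)"
  shows "x\<^sup>2 / (16 * (1 + x / half_width) ^ (2 * j)) < l (int j + 1) - r (int j)"
proof -
  define y where "y = l (int j + 1)"
  define c where "c = f x"
  have jI: "int j \<in> I" "int j + 1 \<in> I" using j by auto
  have c4: "\<bar>c\<bar> = 4" using f_band_edges(2)[OF jI(1)] by (simp add: c_def x_def)
  have fy: "f y = c" using f_gap[OF jI] by (simp add: y_def c_def x_def)
  have xy: "x < y" using r_less_l[OF jI] by (simp add: x_def y_def)
  have "\<bar>c\<bar> \<le> 4" using c4 by simp
  then obtain \<rho> where \<rho>: "bij_betw \<rho> I {x. f x = c}" "\<And>i. i \<in> I \<Longrightarrow> \<rho> i \<in> {l i..r i}"
    using level_enum by metis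
  have f\<rho>: "f (\<rho> i) = c" if "i \<in> I" for i using \<rho>(1) that by (auto simp: bij_betw_def)
  have uniq: "\<rho> i = t" if "i \<in> I" "t \<in> {l i..r i}" "f t = c" for i t
    using inj_on_band[OF that(1)] \<rho>(2)[OF that(1)] f\<rho>[OF that(1)] that by (auto simp: inj_on_def)
  have \<rho>x: "\<rho> (int j) = x" by (rule uniq) (use jI band_edges[OF jI(1)] in \<open>auto simp: x_def c_def\<close>)
  have \<rho>y: "\<rho> (int j + 1) = y" by (rule uniq) (use jI band_edges[OF jI(2)] fy in \<open>auto simp: y_def\<close>)
  have xw: "half_width \<le> x"
  proof (cases "j = 0")
    case False
    have "half_width < l (int j)" unfolding half_width_def by (rule r_less_l) (use j False in auto)
    then show ?thesis using band_edges[OF jI(1)] by (simp add: x_def)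
  qed (simp add: x_def half_width_def)
  have x0: "x > 0" using xw half_width_pos by simp
  \<comment> \<open>In the central band the solution is one of the two edges, as \<open>c\<close> is
    4 or -4; every other band lies beyond \<open>half_width\<close>.\<close>
  have \<rho>w: "half_width \<le> \<bar>\<rho> i\<bar>" if i: "i \<in> I" for i
  proof -
    consider "i = 0" | "i > 0" | "i < 0" by linarith
    then show ?thesis
    proof cases
      case 1
      have "c = f half_width \<or> c = f (l 0)"
        using c4 f_band_edges[OF zero_in_I] by (auto simp: half_width_def abs_if split: if_splits)
      then have "\<rho> 0 = half_width \<or> \<rho> 0 = l 0"
        using uniq[of 0 half_width] uniq[of 0 "l 0"] band_edges[OF zero_in_I] by (auto simp: half_width_def)
      then show ?thesis using 1 l_0 half_width_pos by auto
    next
      case 2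
      have "half_width < l i" unfolding half_width_def by (rule r_less_l) (use i 2 in auto)
      then show ?thesis using \<rho>(2)[OF i] by auto
    next
      case 3
      have "r i < l 0" by (rule r_less_l) (use i 3 in auto)
      then show ?thesis using \<rho>(2)[OF i] l_0 by auto
    qed
  qed
  have \<rho>nz: "\<rho> i \<noteq> 0" if "i \<in> I" for i using \<rho>w[OF that] half_width_pos by auto
  \<comment> \<open>The factorisation of \<open>f - c\<close>, read at the zero 0 of
    \<open>f\<close>.\<close>
  have prod4: "(\<Prod>i\<in>I. \<bar>\<rho> i\<bar>) = 4"
  proof -
    have "f 0 - c = - (\<Prod>\<mu> | f \<mu> = c. 0 - \<mu>)" by (rule factor) (use c4 in simp)
    also have "(\<Prod>\<mu> | f \<mu> = c. 0 - \<mu>) = (\<Prod>i\<in>I. 0 - \<rho> i)"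
      by (rule prod.reindex_bij_betw[OF \<rho>(1), symmetric])
    finally have "\<bar>c\<bar> = \<bar>\<Prod>i\<in>I. 0 - \<rho> i\<bar>" by (simp add: f_0)
    then show ?thesis using c4 by (simp add: abs_prod)
  qed
  define J where "J = I - {int j, int j + 1}"
  have splitI: "(\<Prod>i\<in>I. g i) = g (int j) * (g (int j + 1) * (\<Prod>i\<in>J. g i))" for g :: "int \<Rightarrow> real"
  proof -
    have "(\<Prod>i\<in>I. g i) = g (int j) * (\<Prod>i\<in>I - {int j}. g i)" by (rule prod.remove) (use jI in auto)
    also have "(\<Prod>i\<in>I - {int j}. g i) = g (int j + 1) * (\<Prod>i\<in>I - {int j} - {int j + 1}. g i)"
      by (rule prod.remove) (use jI in auto)
    also have "I - {int j} - {int j + 1} = J" by (auto simp: J_def)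
    finally show ?thesis .
  qed
  have dprod: "1 \<le> (y - x) * (\<Prod>i\<in>J. \<bar>x - \<rho> i\<bar>)"
  proof -
    have "f' x = - (\<Prod>\<mu>\<in>{\<mu>. f \<mu> = f x} - {x}. x - \<mu>)" by (rule f'_eq_prod) (use c4 in \<open>simp add: c_def\<close>)
    also have "(\<Prod>\<mu>\<in>{\<mu>. f \<mu> = f x} - {x}. x - \<mu>) = (\<Prod>i\<in>I - {int j}. x - \<rho> i)"
    proof -
      have "bij_betw \<rho> (I - {int j}) ({\<mu>. f \<mu> = f x} - {x})"
        using \<rho>(1) \<rho>x jI unfolding c_def by (metis bij_betw_DiffI bij_betw_singletonI empty_subsetI insert_subset bij_betwE c_def singletonI)
      then show ?thesis by (rule prod.reindex_bij_betw[symmetric])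
    qed
    also have "(\<Prod>i\<in>I - {int j}. x - \<rho> i) = (x - \<rho> (int j + 1)) * (\<Prod>i\<in>I - {int j} - {int j + 1}. x - \<rho> i)"
      by (rule prod.remove) (use jI in auto)
    also have "I - {int j} - {int j + 1} = J" by (auto simp: J_def)
    finally have "\<bar>f' x\<bar> = (y - x) * (\<Prod>i\<in>J. \<bar>x - \<rho> i\<bar>)"
      using xy by (simp add: \<rho>y abs_mult abs_prod)
    moreover have "1 \<le> \<bar>f' x\<bar>" by (rule deriv_ge) (use c4 in \<open>simp add: c_def\<close>)
    ultimately show ?thesis by simp
  qed
  have "(\<Prod>i\<in>J. \<bar>x - \<rho> i\<bar>) = (\<Prod>i\<in>J. \<bar>\<rho> i\<bar>) * (\<Prod>i\<in>J. \<bar>1 - x / \<rho> i\<bar>)"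
    unfolding prod.distrib[symmetric]
  proof (rule prod.cong[OF refl])
    fix i assume "i \<in> J"
    then have "\<rho> i \<noteq> 0" using \<rho>nz by (simp add: J_def)
    then have "x - \<rho> i = - (\<rho> i * (1 - x / \<rho> i))" by (simp add: field_simps)
    then show "\<bar>x - \<rho> i\<bar> = \<bar>\<rho> i\<bar> * \<bar>1 - x / \<rho> i\<bar>" by (metis abs_minus_cancel abs_mult)
  qed
  moreover have "x * y * (\<Prod>i\<in>J. \<bar>\<rho> i\<bar>) = 4"
    using splitI[of "\<lambda>i. \<bar>\<rho> i\<bar>"] prod4 \<rho>x \<rho>y x0 xy by simp
  \<comment> \<open>Each distance is |\<open>\<rho> i\<close>| times a ratio, and the product of the
    |\<open>\<rho> i\<close>| over \<open>J\<close> is exactly 4 / (x y).\<close>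
  ultimately have key: "x * y \<le> 4 * (y - x) * (\<Prod>i\<in>J. \<bar>1 - x / \<rho> i\<bar>)"
  proof -
    have "x * y * 1 \<le> x * y * ((y - x) * (\<Prod>i\<in>J. \<bar>x - \<rho> i\<bar>))"
      using dprod x0 xy by (intro mult_left_mono) auto
    also have "\<dots> = (x * y * (\<Prod>i\<in>J. \<bar>\<rho> i\<bar>)) * (y - x) * (\<Prod>i\<in>J. \<bar>1 - x / \<rho> i\<bar>)"
      unfolding \<open>(\<Prod>i\<in>J. \<bar>x - \<rho> i\<bar>) = _\<close> by (simp add: mult_ac)
    finally show ?thesis using \<open>x * y * (\<Prod>i\<in>J. \<bar>\<rho> i\<bar>) = 4\<close> by simp
  qed
  define h where "h i = x / \<bar>\<rho> i\<bar>" for i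
  \<comment> \<open>The outer bands up to index \<open>M\<close>. The second product starts at j + 2
    because band j + 1 is the other side of the gap and is already split off.\<close>
  define F where "F M = (\<Prod>k=Suc j..M. 1 + h (- int k)) * (\<Prod>k=j+2..M. 1 - h (int k))" for M
  have h0: "0 \<le> h i" for i using x0 by (simp add: h_def)
  have pos_far: "0 < \<rho> (int k)" "x < \<rho> (int k)" if "j < k" "k \<le> m" for k
  proof -
    have "x < l (int k)" unfolding x_def by (rule r_less_l) (use that j in auto)
    then show "0 < \<rho> (int k)" "x < \<rho> (int k)" using \<rho>(2)[of "int k"] that x0 by auto
  qed
  have neg_far: "\<rho> (- int k) < 0" "l (int k) \<le> - \<rho> (- int k)" "x < - \<rho> (- int k)" if "j < k" "k \<le> m" for k
  proof -
    have "x < l (int k)" unfolding x_def by (rule r_less_l) (use that j in auto)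
    moreover have "\<rho> (- int k) \<le> r (- int k)" using \<rho>(2)[of "- int k"] that by auto
    moreover have "r (- int k) = - l (int k)" using l_minus[of "- int k"] that by simp
    ultimately show "\<rho> (- int k) < 0" "l (int k) \<le> - \<rho> (- int k)" "x < - \<rho> (- int k)" using x0 by auto
  qed
  have h1: "h (int k) \<le> 1" "h (- int k) \<le> 1" if "j < k" "k \<le> m" for k
  proof -
    have "0 < \<bar>\<rho> (int k)\<bar>" "x \<le> \<bar>\<rho> (int k)\<bar>" "0 < \<bar>\<rho> (- int k)\<bar>" "x \<le> \<bar>\<rho> (- int k)\<bar>"
      using pos_far[OF that] neg_far[OF that] by auto
    then show "h (int k) \<le> 1" "h (- int k) \<le> 1"
      unfolding h_def by (simp_all only: divide_le_eq_1_pos)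
  qed
  have Fnn: "0 \<le> F M" if "M \<le> m" for M
    unfolding F_def using that h1 h0 by (intro mult_nonneg_nonneg prod_nonneg) (auto intro: add_nonneg_nonneg)
  have F1: "F (Suc j) \<le> 2" using h1(2)[of "Suc j"] j by (simp add: F_def)
  \<comment> \<open>The spare factor \<open>1 + h (int M)\<close> makes the induction work: it
    dominates the next factor from the left, since the reflection of band -(M + 1) lies beyond band
    M, and a new spare factor is free because (1 - h)(1 + h) \<le> 1. The base case has two left
    factors of at most 2.\<close>
  have F2: "F M * (1 + h (int M)) \<le> 4" if "j + 2 \<le> M" "M \<le> m" for M
    using that
  proof (induction M rule: nat_induct_at_least)
    case base
    have "{Suc j..j + 2} = {Suc j, j + 2}" by auto
    then have "F (j + 2) * (1 + h (int (j + 2))) = (1 + h (- int (Suc j))) * (1 + h (- int (j + 2))) * ((1 - h (int (j + 2))) * (1 + h (int (j + 2))))"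
      by (simp add: F_def mult_ac)
    also have "\<dots> \<le> (2 * 2) * 1"
    proof (intro mult_mono)
      show "(1 - h (int (j + 2))) * (1 + h (int (j + 2))) \<le> 1" by (simp add: algebra_simps)
      show "0 \<le> (1 - h (int (j + 2))) * (1 + h (int (j + 2)))"
        using h1(1)[of "j + 2"] h0[of "int (j + 2)"] base by (intro mult_nonneg_nonneg) auto
    qed (use h1(2)[of "Suc j"] h1(2)[of "j + 2"] h0 base in \<open>auto intro: add_nonneg_nonneg\<close>)
    finally show ?case by simp
  next
    case (Suc M)
    have hm: "h (- int (Suc M)) \<le> h (int M)"
    proof -
      have "\<rho> (int M) \<le> r (int M)" using \<rho>(2)[of "int M"] Suc by auto
      also have "r (int M) < l (int (Suc M))" by (rule r_less_l) (use Suc in auto)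
      also have "\<dots> \<le> - \<rho> (- int (Suc M))" using neg_far(2)[of "Suc M"] Suc by simp
      finally have "\<bar>\<rho> (int M)\<bar> \<le> \<bar>\<rho> (- int (Suc M))\<bar>" using pos_far(1)[of M] Suc by simp
      then show ?thesis unfolding h_def using x0 pos_far(1)[of M] Suc by (intro divide_left_mono) auto
    qed
    have "F (Suc M) * (1 + h (int (Suc M))) = F M * (1 + h (- int (Suc M))) * ((1 - h (int (Suc M))) * (1 + h (int (Suc M))))"
      using Suc.hyps by (simp add: F_def prod.cl_ivl_Suc mult_ac)
    also have "\<dots> \<le> F M * (1 + h (int M)) * 1"
    proof (intro mult_mono mult_left_mono Fnn)
      show "(1 - h (int (Suc M))) * (1 + h (int (Suc M))) \<le> 1" by (simp add: algebra_simps)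
      show "0 \<le> (1 - h (int (Suc M))) * (1 + h (int (Suc M)))"
        using h1(1)[of "Suc M"] h0[of "int (Suc M)"] Suc by (intro mult_nonneg_nonneg) auto
      show "0 \<le> F M * (1 + h (int M))"
        using Fnn[of M] h0[of "int M"] Suc by (intro mult_nonneg_nonneg) auto
    qed (use hm h0 Suc in \<open>auto intro: add_nonneg_nonneg\<close>)
    also have "\<dots> \<le> 4" using Suc by simp
    finally show ?case .
  qed
  have Fm: "F m \<le> 4"
  proof (cases "m = Suc j")
    case False
    then have "j + 2 \<le> m" using j by simp
    then have "F m * (1 + h (int m)) \<le> 4" using F2[of m] by simp
    moreover have "0 \<le> F m * h (int m)" using Fnn[of m] h0[of "int m"] by simp
    ultimately show ?thesis by (simp add: distrib_left)
  qed (use F1 in simp)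
  have "(\<Prod>i\<in>J. \<bar>1 - x / \<rho> i\<bar>) \<le> (1 + x / half_width) ^ (2 * j) * 4"
  proof -
    \<comment> \<open>These 2j bands lie no farther out than the gap edge \<open>x\<close>, so their
      ratios are only estimated through \<open>half_width\<close>.\<close>
    define N where "N = {- int j..<int j}"
    define A where "A = (\<lambda>k. - int k) ` {Suc j..m}"
    define D where "D = int ` {j+2..m}"
    have J: "J = N \<union> (A \<union> D)"
    proof (intro set_eqI iffI)
      fix i assume i: "i \<in> J"
      have "i < - int j \<or> i \<in> N \<or> i \<ge> int j + 2"
        using i unfolding J_def N_def by simp linarith
      then consider "i < - int j" | "i \<in> N" | "i \<ge> int j + 2" by blast
      then show "i \<in> N \<union> (A \<union> D)"
      proof cases
        case 1
        then have "i = - int (nat (- i))" "nat (- i) \<in> {Suc j..m}" using i by (auto simp: J_def)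
        then show ?thesis unfolding A_def by blast
      next
        case 3
        then have "i = int (nat i)" "nat i \<in> {j+2..m}" using i by (auto simp: J_def)
        then show ?thesis unfolding D_def by blast
      qed auto
    qed (use j in \<open>auto simp: J_def N_def A_def D_def\<close>)
    have "(\<Prod>i\<in>J. \<bar>1 - x / \<rho> i\<bar>) = (\<Prod>i\<in>N. \<bar>1 - x / \<rho> i\<bar>) * ((\<Prod>i\<in>A. \<bar>1 - x / \<rho> i\<bar>) * (\<Prod>i\<in>D. \<bar>1 - x / \<rho> i\<bar>))"
      unfolding J by (subst prod.union_disjoint, force simp: N_def, force simp: A_def D_def,
        force simp: N_def A_def D_def, subst prod.union_disjoint) (auto simp: A_def D_def)
    also have "(\<Prod>i\<in>A. \<bar>1 - x / \<rho> i\<bar>) = (\<Prod>k=Suc j..m. 1 + h (- int k))"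
      unfolding A_def
    proof (subst prod.reindex)
      show "prod ((\<lambda>i. \<bar>1 - x / \<rho> i\<bar>) \<circ> (\<lambda>k. - int k)) {Suc j..m} = (\<Prod>k=Suc j..m. 1 + h (- int k))"
      proof (rule prod.cong[OF refl])
        fix k assume k: "k \<in> {Suc j..m}"
        have "\<rho> (- int k) < 0" using neg_far(1)[of k] k by simp
        moreover from this have "x / \<rho> (- int k) < 0" using x0 by (simp add: divide_pos_neg)
        ultimately show "((\<lambda>i. \<bar>1 - x / \<rho> i\<bar>) \<circ> (\<lambda>k. - int k)) k = 1 + h (- int k)"
          by (simp add: h_def)
      qed
    qed (auto simp: inj_on_def)
    also have "(\<Prod>i\<in>D. \<bar>1 - x / \<rho> i\<bar>) = (\<Prod>k=j+2..m. 1 - h (int k))"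
      unfolding D_def
    proof (subst prod.reindex)
      show "prod ((\<lambda>i. \<bar>1 - x / \<rho> i\<bar>) \<circ> int) {j+2..m} = (\<Prod>k=j+2..m. 1 - h (int k))"
      proof (rule prod.cong[OF refl])
        fix k assume k: "k \<in> {j+2..m}"
        have "\<rho> (int k) > 0" "h (int k) \<le> 1" using pos_far(1)[of k] h1(1)[of k] k by simp_all
        then show "((\<lambda>i. \<bar>1 - x / \<rho> i\<bar>) \<circ> int) k = 1 - h (int k)"
          by (simp add: h_def)
      qed
    qed (auto simp: inj_on_def)
    also have "(\<Prod>k=Suc j..m. 1 + h (- int k)) * (\<Prod>k=j+2..m. 1 - h (int k)) = F m" by (simp add: F_def)
    also have "(\<Prod>i\<in>N. \<bar>1 - x / \<rho> i\<bar>) * F m \<le> (1 + x / half_width) ^ (2 * j) * 4"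
    proof (rule mult_mono)
      have "(\<Prod>i\<in>N. \<bar>1 - x / \<rho> i\<bar>) \<le> (\<Prod>i\<in>N. 1 + x / half_width)"
      proof (rule prod_mono)
        fix i assume "i \<in> N"
        then have i: "i \<in> I" using j by (auto simp: N_def)
        have "\<bar>1 - x / \<rho> i\<bar> \<le> 1 + \<bar>x / \<rho> i\<bar>" using abs_triangle_ineq4[of 1 "x / \<rho> i"] by simp
        also have "\<bar>x / \<rho> i\<bar> = x / \<bar>\<rho> i\<bar>" using x0 by simp
        also have "\<dots> \<le> x / half_width" using \<rho>w[OF i] half_width_pos x0 by (intro divide_left_mono) auto
        finally show "0 \<le> \<bar>1 - x / \<rho> i\<bar> \<and> \<bar>1 - x / \<rho> i\<bar> \<le> 1 + x / half_width" by simp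
      qed
      also have "\<dots> = (1 + x / half_width) ^ card N" by (rule prod_constant)
      also have "card N = 2 * j" by (simp add: N_def)
      finally show "(\<Prod>i\<in>N. \<bar>1 - x / \<rho> i\<bar>) \<le> (1 + x / half_width) ^ (2 * j)" .
    qed (use Fm Fnn[of m] x0 half_width_pos in auto)
    finally show ?thesis .
  qed
  then have "4 * (y - x) * (\<Prod>i\<in>J. \<bar>1 - x / \<rho> i\<bar>) \<le> 4 * (y - x) * ((1 + x / half_width) ^ (2 * j) * 4)"
    using xy by (intro mult_left_mono) auto
  with key have "x * y \<le> 4 * (y - x) * ((1 + x / half_width) ^ (2 * j) * 4)" by (rule order.trans)
  also have "\<dots> = (y - x) * (16 * (1 + x / half_width) ^ (2 * j))" by simp
  finally have "x * y \<le> (y - x) * (16 * (1 + x / half_width) ^ (2 * j))" .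
  moreover have "x\<^sup>2 < x * y" using xy x0 by (simp add: power2_eq_square)
  ultimately have "x\<^sup>2 < (y - x) * (16 * (1 + x / half_width) ^ (2 * j))" by simp
  moreover have "0 < 16 * (1 + x / half_width) ^ (2 * j)" using x0 half_width_pos by (simp add: add_pos_pos)
  ultimately have "x\<^sup>2 / (16 * (1 + x / half_width) ^ (2 * j)) < y - x" by (simp add: pos_divide_less_eq)
  then show ?thesis by (simp add: y_def x_def)
qed

text \<open>For j = 0 the edge is \<open>half_width\<close> itself and the power is 1, so the bound
  reads \<open>half_width\<close> squared over 16.\<close>

lemma gap_0_gt:
  assumes "0 < m"
  shows "(1 / \<bar>f' 0\<bar>)\<^sup>2 < l 1 - r 0"
proof -
  have "1 / \<bar>f' 0\<bar> \<le> half_width / 4" using half_width_ge by simp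
  then have "(1 / \<bar>f' 0\<bar>)\<^sup>2 \<le> (half_width / 4)\<^sup>2" by (intro power_mono) auto
  also have "\<dots> < l 1 - r 0"
    using gap_ge[of 0] assms by (simp add: half_width_def power_divide)
  finally show ?thesis .
qed

lemma gap_gt:
  assumes j: "1 \<le> j" "j < m"
  shows "(1 / (2 * \<bar>f' 0\<bar>)) ^ (2 * j) < l (int j + 1) - r (int j)"
proof -
  define x where "x = r (int j)"
  have jI: "int j \<in> I" using j by auto
  have x4: "x \<le> 4" using le_4[of x] f_band_edges(2)[OF jI] by (simp add: x_def)
  have "half_width < l (int j)" unfolding half_width_def by (rule r_less_l) (use j in auto)
  then have xw: "half_width < x" using band_edges[OF jI] by (simp add: x_def)
  then have x0: "0 < x" using half_width_pos by simp
  have "1 / (2 * \<bar>f' 0\<bar>) \<le> half_width / 8" using half_width_ge by (simp add: field_simps)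
  then have "(1 / (2 * \<bar>f' 0\<bar>)) ^ (2 * j) \<le> (half_width / 8) ^ (2 * j)" by (intro power_mono) auto
  \<comment> \<open>Only two powers of x/4 \<le> 1 are kept, to produce the x^2/16 of
    \<open>gap_ge\<close>; the other factor matches it through 1 + x/w \<le> 2x/w for w =
    \<open>half_width\<close>.\<close>
  also have "\<dots> = (half_width / (2 * x)) ^ (2 * j) * ((x / 4) ^ (2 * j))"
    using x0 by (simp flip: power_mult_distrib)
  also have "\<dots> \<le> (half_width / (2 * x)) ^ (2 * j) * ((x / 4)\<^sup>2)"
    using x0 x4 j half_width_pos by (intro mult_left_mono power_decreasing) auto
  also have "\<dots> = x\<^sup>2 / (16 * (2 * x / half_width) ^ (2 * j))"
    using x0 half_width_pos by (simp add: power_divide field_simps)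
  also have "\<dots> \<le> x\<^sup>2 / (16 * (1 + x / half_width) ^ (2 * j))"
  proof -
    have "1 + x / half_width \<le> 2 * x / half_width" using xw half_width_pos by (simp add: field_simps)
    then have "(1 + x / half_width) ^ (2 * j) \<le> (2 * x / half_width) ^ (2 * j)"
      using x0 half_width_pos by (intro power_mono) (auto intro: add_nonneg_nonneg)
    moreover have "0 < (1 + x / half_width) ^ (2 * j)" using x0 half_width_pos by (intro zero_less_power add_pos_pos) auto
    ultimately show ?thesis by (intro divide_left_mono) (auto intro: mult_pos_pos)
  qed
  also have "\<dots> < l (int j + 1) - r (int j)" using gap_ge[OF j(2)] by (simp add: x_def)
  finally show ?thesis .
qed

end

text \<open>With zero diagonal, changing the sign of every second basis vector turns the Jacobi
  matrix into its negative.\<close>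

lemma jacobi_parity: "poly (jacobi p q k) (- x) = (-1) ^ k * poly (jacobi p q k) x"
  by (induction p q k rule: jacobi.induct) (simp_all add: algebra_simps)

lemma discriminant_minus:
  assumes "odd q" "coprime p q"
  shows "discriminant p q (- x) = - discriminant p q x"
proof -
  have "complex_of_real (discriminant p q (- x)) = - poly (jacobi p q q) (- of_real x)"
    using poly_disc_poly_real[of p q "- x"] disc_poly_eq_jacobi[OF assms] by simp
  also have "\<dots> = poly (jacobi p q q) (of_real x)" using assms(1) by (simp add: jacobi_parity)
  also have "\<dots> = of_real (- discriminant p q x)"
    using poly_disc_poly_real[of p q x] disc_poly_eq_jacobi[OF assms]
    by (metis add.inverse_inverse of_real_minus poly_minus)
  finally show ?thesis by (simp only: of_real_eq_iff)
qed

lemma band_function_discriminant: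
  assumes q: "q = 2 * m + 1" and co: "coprime p q"
  shows "band_function (discriminant p q) (deriv (discriminant p q)) m"
proof
  have odd: "odd q" using q by simp
  note level = disc_poly_level[OF odd co _ poly_disc_poly_real]
  fix x :: real
  show "discriminant p q (- x) = - discriminant p q x" by (rule discriminant_minus[OF odd co])
  show "(discriminant p q has_real_derivative deriv (discriminant p q) x) (at x)"
    using discriminant_derivative(1)[of p q x] DERIV_imp_deriv by metis
  assume "\<bar>discriminant p q x\<bar> \<le> 4"
  note this[THEN level(2)] this[THEN level(3)]
  then show "1 \<le> \<bar>deriv (discriminant p q) x\<bar>" "\<bar>x\<bar> \<le> 4"
    by (simp_all flip: of_real_deriv_discriminant)
next
  have odd: "odd q" using q by simp
  fix c :: real assume c: "\<bar>c\<bar> \<le> 4"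
  note F = disc_poly_factor[OF odd co c]
  show "finite {x. discriminant p q x = c}" by (rule F(1))
  show "card {x. discriminant p q x = c} = 2 * m + 1" using F(2) q by simp
  show "discriminant p q x - c = - (\<Prod>\<mu> | discriminant p q \<mu> = c. x - \<mu>)" for x by (rule F(3))
qed

theorem theorem3:
  shows "\<exists>C1 C2 :: real.
    1 < C1 \<and> C1 < 14 \<and> 1 < C2 \<and> C2 < exp 10 \<and>
    (\<forall>p q :: nat. \<forall>as :: nat list. odd_even_cfrac p q as \<longrightarrow>
       \<bar>deriv (discriminant p q) 0\<bar> < C2 * real q powr C1 \<and>
       center_half_width p q \<ge> 4 / \<bar>deriv (discriminant p q) 0\<bar> \<and>
       4 / \<bar>deriv (discriminant p q) 0\<bar> > 4 * inverse C2 * real q powr (- C1)) \<and>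
    (\<forall>p q :: nat. \<forall>as :: nat list. odd_even_cfrac p q as \<and> q \<ge> 3 \<longrightarrow>
       gap_width p q 0 > (1 / (C2 * real q powr C1)) ^ 2 \<and>
       (\<forall>j :: nat. 1 \<le> j \<and> real j < (real q - 1) / 2 \<longrightarrow>
          gap_width p q (int j) > (1 / (2 * C2 * real q powr C1)) ^ (2 * j)))"
proof -
  have main: "1 \<le> D \<and> D < exp 7 * real q powr 10 \<and> 4 / D \<le> center_half_width p q \<and>
      (3 \<le> q \<longrightarrow> (1 / D)\<^sup>2 < gap_width p q 0) \<and>
      (\<forall>j. 1 \<le> j \<and> real j < (real q - 1) / 2 \<longrightarrow> (1 / (2 * D)) ^ (2 * j) < gap_width p q (int j))"
    if cf: "odd_even_cfrac p q as" and D: "D = \<bar>deriv (discriminant p q) 0\<bar>" for p q as D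
  proof -
    have q: "coprime p q" "q > 0" "odd q" using odd_even_cfracE[OF cf] by metis+
    obtain m where m: "q = 2 * m + 1" using q by (elim oddE)
    interpret B: band_function "discriminant p q" "deriv (discriminant p q)" m
      by (rule band_function_discriminant[OF m q(1)])
    have band: "band p q j = {B.l j..B.r j}" if "j \<in> {- int m..int m}" for j
    proof -
      have "spec_union (real p / real q) = B.S"
        unfolding B.S_def by (rule spec_union_eq[OF q(3,1)])
      moreover have "(int q - 1) div 2 = int m" using m by simp
      ultimately show ?thesis using B.band_index[OF that] by (simp add: band_def)
    qed
    have band_edges: "B.l j \<le> B.r j" if "j \<in> {- int m..int m}" for j
      using B.band_edges[OF that] by simp
    have gap: "gap_width p q j = B.l (j + 1) - B.r j" if "j \<in> {- int m..int m}" "j + 1 \<in> {- int m..int m}" for j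
      using band_edges[OF that(1)] band_edges[OF that(2)] by (simp add: gap_width_def band[OF that(1)] band[OF that(2)])
    have "center_half_width p q = B.half_width"
      using band_edges[OF B.zero_in_I] B.l_0 by (simp add: center_half_width_def band B.half_width_def)
    moreover have "D \<le> exp 6 * real q ^ 10" using deriv_discriminant_0[OF cf] D by simp
    \<comment> \<open>One more factor e makes the bound strict for every q, including 1.\<close>
    moreover have "exp 6 * real q ^ 10 < exp 7 * real q powr 10"
      using q by (simp add: powr_numeral)
    moreover have "(1 / D)\<^sup>2 < gap_width p q 0" if "3 \<le> q"
      using B.gap_0_gt gap[of 0] that m D by simp
    moreover have "(1 / (2 * D)) ^ (2 * j) < gap_width p q (int j)" if "1 \<le> j" "real j < (real q - 1) / 2" for j
      using B.gap_gt[of j] gap[of "int j"] that m D by simp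
    ultimately show ?thesis using B.half_width_ge B.f'_0_ge D by auto
  qed
  have K: "1 / (exp 7 * real q powr 10) \<le> 1 / D" "1 / (2 * exp 7 * real q powr 10) \<le> 1 / (2 * D)"
    "4 * inverse (exp 7) * real q powr - 10 < 4 / D"
    if "1 \<le> D" "D < exp 7 * real q powr 10" for D :: real and q :: nat
  proof -
    show "1 / (exp 7 * real q powr 10) \<le> 1 / D" "1 / (2 * exp 7 * real q powr 10) \<le> 1 / (2 * D)"
      using that by (auto intro!: divide_left_mono)
    have "4 * inverse (exp 7) * real q powr - 10 = 4 / (exp 7 * real q powr 10)"
      by (simp add: powr_minus divide_inverse)
    also have "\<dots> < 4 / D" using that by (intro divide_strict_left_mono) auto
    finally show "4 * inverse (exp 7) * real q powr - 10 < 4 / D" .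
  qed
  have C: "1 < (10 :: real)" "(10 :: real) < 14" "1 < exp (7 :: real)" "exp 7 < exp (10 :: real)" by simp_all
  have centre: "\<bar>deriv (discriminant p q) 0\<bar> < exp 7 * real q powr 10 \<and>
       center_half_width p q \<ge> 4 / \<bar>deriv (discriminant p q) 0\<bar> \<and>
       4 / \<bar>deriv (discriminant p q) 0\<bar> > 4 * inverse (exp 7) * real q powr (- 10)"
    if "odd_even_cfrac p q as" for p q as
    using main[OF that refl] K(3)[of "\<bar>deriv (discriminant p q) 0\<bar>" q] by blast
  have gaps: "gap_width p q 0 > (1 / (exp 7 * real q powr 10)) ^ 2 \<and>
       (\<forall>j :: nat. 1 \<le> j \<and> real j < (real q - 1) / 2 \<longrightarrow>
          gap_width p q (int j) > (1 / (2 * exp 7 * real q powr 10)) ^ (2 * j))"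
    if cf: "odd_even_cfrac p q as \<and> q \<ge> 3" for p q as
  proof -
    define D where "D = \<bar>deriv (discriminant p q) 0\<bar>"
    note M = main[OF conjunct1[OF cf] D_def]
    have "(1 / (exp 7 * real q powr 10))\<^sup>2 \<le> (1 / D)\<^sup>2"
      using K(1)[of D q] M by (intro power_mono) auto
    moreover have "(1 / (2 * exp 7 * real q powr 10)) ^ (2 * j) \<le> (1 / (2 * D)) ^ (2 * j)" for j
      using K(2)[of D q] M by (intro power_mono) auto
    ultimately show ?thesis using M cf by (meson order.strict_trans1)
  qed
  show ?thesis
    by (rule exI[of _ 10], rule exI[of _ "exp 7"]) (use C centre gaps in blast)
qed

end
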